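(* For every dimension $n\ge 1$ there is a constant $C$ depending only on $n$ such that the following holds. Let $Q=[0,1]^n$ be the unit cube of $\mathbb{R}^n$ and let $\sigma:\mathbb{R}^n\to\mathbb{R}$ be a measurable, $Q$-periodic function with $0<\inf\sigma\le\sup\sigma<\infty$. Let $\bar\sigma=\frac1n \operatorname{tr}A$, where $A$ is the effective conductivity matrix of $\sigma$, and let $F(t)=|\{x\in Q:\sigma(x)>t\}|$. Then for every $S>0$, $$\bar\sigma\le H+E,$$ where $$H=-(n-1)S+\left(\int_Q(\sigma(x)+(n-1)S)^{-1}\,dx\right)^{-1},$$ $$E=\frac{C\,(\operatorname{osc}\sigma)^2\left(\int_Q(\sigma(x)+(n-1)S)^{-1}\,dx\right)^{-2}}{(\inf\sigma+(n-1)S)^2(\sup\sigma+(n-1)S)^2}\int_S^\infty F(t)\,(1-\log F(t))^2\,dt.$$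
   Context: The effective conductivity matrix $A$ associated with $\sigma$ is the symmetric $n\times n$ matrix determined by the cell problem: for every $v\in\mathbb{R}^n$, $$\langle Av,v\rangle=\min_{u\in H^1_p(Q)}\int_Q\sigma(x)\,|v+\nabla u(x)|^2\,dx,$$ where $H^1_p(Q)$ is the space of $H^1$ functions on the unit cube $Q$ with periodic boundary conditions. Thus $\bar\sigma=\frac1n\sum_{i=1}^n\langle Ae_i,e_i\rangle$, with $e_1,\dots,e_n$ the standard basis. Here $|\cdot|$ of a set is Lebesgue measure, $\inf\sigma$ and $\sup\sigma$ are the essential infimum and essential supremum of $\sigma$, and $\operatorname{osc}\sigma=\sup\sigma-\inf\sigma$. The expression $F(t)(1-\log F(t))^2$ is understood to be $0$ when $F(t)=0$. *)

theory Defs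
  imports "HOL-Analysis.Analysis" "HOL-Probability.Essential_Supremum"
begin

abbreviation unit_cube :: "(real^'n) set" where
  "unit_cube \<equiv> cbox 0 1"

definition cube_periodic :: "(real^'n \<Rightarrow> 'b) \<Rightarrow> bool" where
  "cube_periodic f \<longleftrightarrow> (\<forall>x i. f (x + axis i 1) = f x)"

definition partial :: "'n \<Rightarrow> (real^'n \<Rightarrow> real) \<Rightarrow> real^'n \<Rightarrow> real" where
  "partial i f x = frechet_derivative f (at x) (axis i 1)"

definition grad :: "(real^'n \<Rightarrow> real) \<Rightarrow> real^'n \<Rightarrow> real^'n" where
  "grad f x = (\<chi> i. partial i f x)"

primrec C_k :: "nat \<Rightarrow> (real^'n \<Rightarrow> real) \<Rightarrow> bool" where
  "C_k 0 f \<longleftrightarrow> continuous_on UNIV f"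
| "C_k (Suc k) f \<longleftrightarrow> (\<forall>x. f differentiable (at x)) \<and> (\<forall>i. C_k k (partial i f))"

definition test_function :: "(real^'n \<Rightarrow> real) \<Rightarrow> bool" where
  "test_function \<phi> \<longleftrightarrow> (\<forall>k. C_k k \<phi>) \<and> compact (closure {x. \<phi> x \<noteq> 0})"

definition locally_square_integrable :: "(real^'n \<Rightarrow> 'b::euclidean_space) \<Rightarrow> bool" where
  "locally_square_integrable f \<longleftrightarrow> f \<in> borel_measurable lebesgue \<and>
     (\<forall>K. compact K \<longrightarrow> set_integrable lebesgue K (\<lambda>x. (norm (f x))\<^sup>2))"

text \<open>
  For locally square integrable \<open>u\<close> and \<open>g\<close> all integrands below are integrable, so that no
  default value of the Bochner integral is involved.
\<close>
definition has_weak_gradient :: "(real^'n \<Rightarrow> real) \<Rightarrow> (real^'n \<Rightarrow> real^'n) \<Rightarrow> bool" where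
  "has_weak_gradient u g \<longleftrightarrow>
     (\<forall>\<phi>. test_function \<phi> \<longrightarrow>
        (LINT x|lebesgue. u x *\<^sub>R grad \<phi> x) = - (LINT x|lebesgue. \<phi> x *\<^sub>R g x))"

text \<open>
  \<open>H1_periodic u g\<close>: the function \<open>u\<close> belongs to \<open>H\<^sup>1\<^sub>p(Q)\<close> and \<open>g\<close> is (a representative of) its
  weak gradient. The space \<open>H\<^sup>1\<^sub>p(Q)\<close> is realised as the space of \<open>Q\<close>-periodic functions in
  \<open>H\<^sup>1\<^sub>l\<^sub>o\<^sub>c\<close> of the whole space; requiring the weak gradient to exist across the faces
  of the periodic copies of \<open>Q\<close> is what imposes the periodic boundary conditions.
\<close>
definition H1_periodic :: "(real^'n \<Rightarrow> real) \<Rightarrow> (real^'n \<Rightarrow> real^'n) \<Rightarrow> bool" where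
  "H1_periodic u g \<longleftrightarrow> cube_periodic u \<and> locally_square_integrable u \<and>
     locally_square_integrable g \<and> has_weak_gradient u g"

definition cell_energies :: "(real^'n \<Rightarrow> real) \<Rightarrow> real^'n \<Rightarrow> real set" where
  "cell_energies \<sigma> v =
     {(LINT x:unit_cube|lebesgue. \<sigma> x * (norm (v + g x))\<^sup>2) | u g. H1_periodic u g}"

text \<open>The second conjunct says that \<open>A v \<bullet> v\<close> is the (attained) minimum of the cell energies.\<close>
definition effective_conductivity_matrix :: "(real^'n \<Rightarrow> real) \<Rightarrow> real^'n^'n \<Rightarrow> bool" where
  "effective_conductivity_matrix \<sigma> A \<longleftrightarrow> transpose A = A \<and>
     (\<forall>v. (A *v v) \<bullet> v \<in> cell_energies \<sigma> v \<and>
          (\<forall>e \<in> cell_energies \<sigma> v. (A *v v) \<bullet> v \<le> e))"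

definition ess_sup :: "(real^'n \<Rightarrow> real) \<Rightarrow> ereal" where
  "ess_sup \<sigma> = esssup lebesgue (\<lambda>x. ereal (\<sigma> x))"

definition ess_inf :: "(real^'n \<Rightarrow> real) \<Rightarrow> ereal" where
  "ess_inf \<sigma> = - esssup lebesgue (\<lambda>x. - ereal (\<sigma> x))"

definition distribution_fun :: "(real^'n \<Rightarrow> real) \<Rightarrow> real \<Rightarrow> real" where
  "distribution_fun \<sigma> t = measure lebesgue {x \<in> unit_cube. \<sigma> x > t}"

definition mean_conductivity :: "real^'n^'n \<Rightarrow> real" where
  "mean_conductivity A = trace A / real CARD('n)"

definition inverse_mean :: "(real^'n \<Rightarrow> real) \<Rightarrow> real \<Rightarrow> real" where
  "inverse_mean \<sigma> S =
     (LINT x:unit_cube|lebesgue. inverse (\<sigma> x + (real CARD('n) - 1) * S))"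

definition H_term :: "(real^'n \<Rightarrow> real) \<Rightarrow> real \<Rightarrow> real" where
  "H_term \<sigma> S = - (real CARD('n) - 1) * S + inverse (inverse_mean \<sigma> S)"

text \<open>
  Where \<open>F t = 0\<close> the integrand of the last integral vanishes whatever the value of \<open>ln 0\<close>,
  as the convention on \<open>F (1 - log F)\<^sup>2\<close> demands.
\<close>
definition E_term :: "real \<Rightarrow> (real^'n \<Rightarrow> real) \<Rightarrow> real \<Rightarrow> real" where
  "E_term C \<sigma> S =
     (let m = real_of_ereal (ess_inf \<sigma>); M = real_of_ereal (ess_sup \<sigma>);
          n = real CARD('n); F = distribution_fun \<sigma>
      in C * (M - m)\<^sup>2 * (inverse (inverse_mean \<sigma> S))\<^sup>2 /
           ((m + (n - 1) * S)\<^sup>2 * (M + (n - 1) * S)\<^sup>2) *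
         (LINT t:{S..}|lebesgue. F t * (1 - ln (F t))\<^sup>2))"

end

theory Submission
  imports Defs "HOL-Real_Asymp.Real_Asymp" "HOL-Probability.Probability_Measure"
begin

text \<open>
  Write \<open>n\<close> for the dimension. The trial fields are the second derivatives of one periodic
  function: for \<open>\<phi>\<close> with Laplacian \<open>f\<close>, the functions \<open>\<partial>\<^sub>j \<phi>\<close> are admissible in the cell problems
  of the basis vectors \<open>e\<^sub>j\<close>, and the sum of their energies is \<open>\<integral> \<sigma> |I + D\<^sup>2\<phi>|\<^sup>2\<close>. Here
  \<open>|I + D\<^sup>2\<phi>|\<^sup>2 = n + 2f + |D\<^sup>2\<phi>|\<^sup>2\<close> is at least \<open>(n + f)\<^sup>2 / n\<close>, because \<open>f\<close> is the trace of
  \<open>D\<^sup>2\<phi>\<close>, and \<open>\<integral> |D\<^sup>2\<phi>|\<^sup>2 = \<integral> f\<^sup>2\<close>. Splitting \<open>\<sigma> = (\<sigma> - S) + S\<close> and using the pointwise lower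
  bound where \<open>\<sigma> < S\<close> gives
  \<open>trace A \<le> \<integral> ((\<sigma> - S) (n + f)\<^sup>2 / n + S (n + f\<^sup>2)) + \<integral> (\<sigma> - S)\<^sub>+ |D\<^sup>2\<phi>|\<^sup>2\<close>.
  With \<open>f = n (g - 1)\<close> the first integral equals
  \<open>n (\<integral> (\<sigma> + (n - 1) S) g\<^sup>2 - (n - 1) S)\<close>; among the \<open>g\<close> of mean one it is smallest for \<open>g\<close>
  proportional to \<open>1 / (\<sigma> + (n - 1) S)\<close>, and its value is then \<open>n\<close> times the term \<open>H\<close>
  (\<open>comparison_energy_optimal\<close>). For this \<open>g\<close> the supremum \<open>K\<close> of \<open>|f|\<close> is at most \<open>n\<close> times the
  square root of the prefactor of \<open>E\<close> (\<open>trial_field_identities\<close>).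

  By the layer cake formula the second integral is the integral over \<open>t \<ge> S\<close> of \<open>|D\<^sup>2\<phi>|\<^sup>2\<close> over
  the sets \<open>{\<sigma> > t}\<close>, so the theorem comes down to the bound
  \<open>\<integral>\<^sub>E |D\<^sup>2\<phi>|\<^sup>2 \<le> C K\<^sup>2 |E| (1 - log |E|)\<^sup>2\<close> for all \<open>E\<close> in the cube
  (\<open>hessian_set_integral_le\<close>). It expresses that second derivatives of a function with bounded
  Laplacian are exponentially integrable, the Calderon--Zygmund and John--Nirenberg theorems in
  their endpoint form.

  Both are proved with the heat semigroup \<open>P\<^sub>t\<close>, in the algebra of trigonometric polynomials,
  where existence and smoothness are trivial. The one property of \<open>P\<^sub>t\<close> that is not algebra is
  positivity. It turns the identity for the derivative of \<open>P\<^sub>t\<^sub>-\<^sub>s ((P\<^sub>s f)\<^sup>2)\<close> in \<open>s\<close> into the gradient bound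
  \<open>|\<partial>\<^sub>i P\<^sub>t f| \<le> sup |f| / \<surd>(2t)\<close>. The role of the mean oscillation of \<open>h = \<partial>\<^sub>i \<partial>\<^sub>j \<phi>\<close> over a ball of
  radius \<open>\<surd>t\<close> is played by the variance \<open>P\<^sub>t (h\<^sup>2) - (P\<^sub>t h)\<^sup>2\<close>. It is bounded by a multiple of
  \<open>K\<^sup>2\<close> (\<open>heat_variance_hessian\<close>): the part of \<open>\<phi>\<close> of scale larger than \<open>\<surd>t\<close> has third derivatives
  \<open>O(K / \<surd>t)\<close>, and for the remaining part \<open>w\<close>, whose gradient is \<open>O(K \<surd>t)\<close>, one uses that
  \<open>|D\<^sup>2w|\<^sup>2\<close> differs from \<open>(\<Delta>w)\<^sup>2\<close> by second derivatives of products of first derivatives of \<open>w\<close>.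
  Exponential integrability follows from a Bellman function along the heat flow
  (\<open>exp_integral_le_of_heat_variance\<close>), in place of a stopping time decomposition.

  Finally the optimal \<open>f\<close> is merely measurable, so it is approximated boundedly and almost
  everywhere by trigonometric polynomials of mean zero, for which the Poisson equation is solved
  mode by mode.
\<close>

section \<open>Trigonometric polynomials\<close>

definition mode :: "real \<Rightarrow> real^'n \<Rightarrow> real \<Rightarrow> real^'n \<Rightarrow> real" where
  "mode a w \<theta> x = a * cos (w \<bullet> x + \<theta>)"

definition frequencies :: "(real^'n) set" where
  "frequencies = {w. \<forall>i. \<exists>k::int. w $ i = 2 * pi * of_int k}"

text \<open>
  Phase-shifted cosines cover the sines as well, and products, partial derivatives and the heat
  flow all send a mode to modes. Identities that are linear in \<open>f\<close> can thus be checked on a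
  single mode.
\<close>
inductive_set trig :: "(real^'n \<Rightarrow> real) set" where
  trig_mode: "w \<in> frequencies \<Longrightarrow> mode a w \<theta> \<in> trig"
| trig_add: "f \<in> trig \<Longrightarrow> g \<in> trig \<Longrightarrow> (\<lambda>x. f x + g x) \<in> trig"

lemma frequencies_0 [simp]: "0 \<in> frequencies"
  by (auto simp: frequencies_def intro!: exI[of _ 0])

lemma frequencies_add: "w \<in> frequencies \<Longrightarrow> v \<in> frequencies \<Longrightarrow> w + v \<in> frequencies"
  unfolding frequencies_def by simp (metis distrib_left of_int_add)

lemma frequencies_diff: "w \<in> frequencies \<Longrightarrow> v \<in> frequencies \<Longrightarrow> w - v \<in> frequencies"
  unfolding frequencies_def by simp (metis right_diff_distrib of_int_diff)

lemma mode_0: "mode a 0 \<theta> = (\<lambda>x. a * cos \<theta>)"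
  by (auto simp: mode_def)

lemma trig_const [simp]: "(\<lambda>x. c) \<in> trig"
  using trig_mode[of 0 c 0] by (simp add: mode_0)

lemma mode_cmult: "(\<lambda>x. c * mode a w \<theta> x) = mode (c * a) w \<theta>"
  by (auto simp: mode_def)

lemma trig_cmult: "f \<in> trig \<Longrightarrow> (\<lambda>x. c * f x) \<in> trig"
  by (induction rule: trig.induct)
    (auto simp: mode_cmult distrib_left intro: trig.intros)

lemma trig_minus: "f \<in> trig \<Longrightarrow> (\<lambda>x. - f x) \<in> trig"
  using trig_cmult[of f "-1"] by simp

lemma trig_diff: "f \<in> trig \<Longrightarrow> g \<in> trig \<Longrightarrow> (\<lambda>x. f x - g x) \<in> trig"
  using trig_add[OF _ trig_minus, of f g] by simp

lemma mode_mult: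
  "mode a w \<theta> x * mode b v \<eta> x
     = mode (a * b / 2) (w - v) (\<theta> - \<eta>) x + mode (a * b / 2) (w + v) (\<theta> + \<eta>) x"
proof -
  define X Y where "X = w \<bullet> x + \<theta>" and "Y = v \<bullet> x + \<eta>"
  have "(w - v) \<bullet> x + (\<theta> - \<eta>) = X - Y" "(w + v) \<bullet> x + (\<theta> + \<eta>) = X + Y"
    by (simp_all add: X_def Y_def inner_diff_left inner_add_left)
  moreover have "a * cos X * (b * cos Y) = a * b / 2 * cos (X - Y) + a * b / 2 * cos (X + Y)"
    by (simp add: cos_add cos_diff field_simps)
  ultimately show ?thesis
    unfolding mode_def by (simp only: X_def[symmetric] Y_def[symmetric])
qed

lemma trig_mult:
  assumes "f \<in> trig" "g \<in> trig"
  shows "(\<lambda>x. f x * g x) \<in> trig"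
  using assms(1)
proof (induction rule: trig.induct)
  case (trig_mode w a \<theta>)
  show ?case
    using assms(2)
  proof (induction rule: trig.induct)
    case (trig_mode v b \<eta>)
    show ?case
      unfolding mode_mult
      using \<open>w \<in> frequencies\<close> \<open>v \<in> frequencies\<close>
      by (intro trig.intros frequencies_add frequencies_diff)
  qed (auto simp: distrib_left intro: trig.intros)
qed (auto simp: distrib_right intro: trig.intros)

lemma trig_power2: "f \<in> trig \<Longrightarrow> (\<lambda>x. (f x)\<^sup>2) \<in> trig"
  by (simp add: power2_eq_square trig_mult)

lemma trig_sum: "(\<And>i. i \<in> I \<Longrightarrow> f i \<in> trig) \<Longrightarrow> (\<lambda>x. \<Sum>i\<in>I. f i x) \<in> trig"
  by (induction I rule: infinite_finite_induct) (auto intro: trig_add)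

lemma mode_has_derivative:
  "(mode a w \<theta> has_derivative (\<lambda>v. - (a * sin (w \<bullet> x + \<theta>)) * (w \<bullet> v))) (at x)"
  unfolding mode_def
  by (auto intro!: derivative_eq_intros)

lemma partial_mode: "partial i (mode a w \<theta>) = mode (a * w $ i) w (\<theta> + pi / 2)"
proof
  fix x
  have "frechet_derivative (mode a w \<theta>) (at x) = (\<lambda>v. - (a * sin (w \<bullet> x + \<theta>)) * (w \<bullet> v))"
    using frechet_derivative_at[OF mode_has_derivative] by metis
  moreover have "cos (w \<bullet> x + (\<theta> + pi / 2)) = - sin (w \<bullet> x + \<theta>)"
    by (simp add: minus_sin_cos_eq add.assoc)
  ultimately show "partial i (mode a w \<theta>) x = mode (a * w $ i) w (\<theta> + pi / 2) x"
    by (simp add: partial_def mode_def inner_axis)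
qed

lemma trig_differentiable: "f \<in> trig \<Longrightarrow> f differentiable (at x)"
  by (induction rule: trig.induct)
    (auto intro: differentiableI[OF mode_has_derivative] differentiable_add)

lemma trig_has_derivative: "f \<in> trig \<Longrightarrow> (f has_derivative frechet_derivative f (at x)) (at x)"
  using trig_differentiable frechet_derivative_works by blast

lemma partial_add:
  assumes "f \<in> trig" "g \<in> trig"
  shows "partial i (\<lambda>x. f x + g x) = (\<lambda>x. partial i f x + partial i g x)"
proof
  fix x
  show "partial i (\<lambda>x. f x + g x) x = partial i f x + partial i g x"
    unfolding partial_def
    using frechet_derivative_at[OF has_derivative_add[OF trig_has_derivative[OF assms(1)]
          trig_has_derivative[OF assms(2)]]] by metis
qed

lemma partial_mult:
  assumes "f \<in> trig" "g \<in> trig"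
  shows "partial i (\<lambda>x. f x * g x) = (\<lambda>x. f x * partial i g x + partial i f x * g x)"
proof
  fix x
  show "partial i (\<lambda>x. f x * g x) x = f x * partial i g x + partial i f x * g x"
    unfolding partial_def
    using frechet_derivative_at[OF has_derivative_mult[OF trig_has_derivative[OF assms(1)]
          trig_has_derivative[OF assms(2)]]] by metis
qed

lemma partial_const: "partial i (\<lambda>x. c) = (\<lambda>x. 0)"
  by (auto simp: partial_def)

lemma partial_cmult: "f \<in> trig \<Longrightarrow> partial i (\<lambda>x. c * f x) = (\<lambda>x. c * partial i f x)"
  using partial_mult[OF trig_const, of f i c] by (simp add: partial_const)

lemma partial_minus: "f \<in> trig \<Longrightarrow> partial i (\<lambda>x. - f x) = (\<lambda>x. - partial i f x)"
  using partial_cmult[of f i "-1"] by simp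

lemma partial_diff:
  "f \<in> trig \<Longrightarrow> g \<in> trig \<Longrightarrow> partial i (\<lambda>x. f x - g x) = (\<lambda>x. partial i f x - partial i g x)"
  using partial_add[OF _ trig_minus, of f g i] by (simp add: partial_minus)

lemma trig_partial: "f \<in> trig \<Longrightarrow> partial i f \<in> trig"
  by (induction rule: trig.induct) (auto simp: partial_mode partial_add intro: trig.intros)

lemma partial_sum:
  "(\<And>j. j \<in> I \<Longrightarrow> f j \<in> trig) \<Longrightarrow> partial i (\<lambda>x. \<Sum>j\<in>I. f j x) = (\<lambda>x. \<Sum>j\<in>I. partial i (f j) x)"
  by (induction I rule: infinite_finite_induct) (auto simp: partial_const partial_add trig_sum)

lemma partial_commute: "f \<in> trig \<Longrightarrow> partial i (partial j f) = partial j (partial i f)"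
  by (induction rule: trig.induct)
    (auto simp: partial_mode partial_add trig_partial mult_ac)

lemma differentiable_DERIV_along_axis:
  assumes "f differentiable (at (x + s *\<^sub>R axis i 1))"
  shows "((\<lambda>s. f (x + s *\<^sub>R axis i 1)) has_real_derivative partial i f (x + s *\<^sub>R axis i 1)) (at s)"
proof -
  let ?D = "frechet_derivative f (at (x + s *\<^sub>R axis i 1))"
  have D: "(f has_derivative ?D) (at (x + s *\<^sub>R axis i 1))"
    using assms frechet_derivative_works by blast
  have "((\<lambda>s. f (x + s *\<^sub>R axis i 1)) has_derivative (\<lambda>h. ?D (h *\<^sub>R axis i 1))) (at s)"
    by (rule has_derivative_compose[of "\<lambda>s. x + s *\<^sub>R axis i 1" "\<lambda>h. h *\<^sub>R axis i 1" s UNIV f, OF _ D])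
      (auto intro!: derivative_eq_intros)
  then show ?thesis
    using linear_scale[OF has_derivative_linear[OF D]]
    by (simp add: has_field_derivative_def partial_def mult_commute_abs)
qed

lemma trig_DERIV:
  assumes "f \<in> trig"
  shows "((\<lambda>s. f (x + s *\<^sub>R axis i 1)) has_real_derivative partial i f (x + s *\<^sub>R axis i 1)) (at s)"
  by (intro differentiable_DERIV_along_axis trig_differentiable assms)

lemma trig_continuous: "f \<in> trig \<Longrightarrow> continuous_on S f"
  by (meson continuous_at_imp_continuous_on differentiable_imp_continuous_within
      trig_differentiable)

lemma mode_periodic: "w \<in> frequencies \<Longrightarrow> mode a w \<theta> (x + axis i 1) = mode a w \<theta> x"
proof -
  assume "w \<in> frequencies"
  then obtain k :: int where k: "w $ i = 2 * pi * of_int k"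
    by (auto simp: frequencies_def)
  have "cos (w \<bullet> x + \<theta> + of_int k * (2 * pi)) = cos (w \<bullet> x + \<theta>)"
    by (simp add: cos_add sin_int_2pin cos_int_2pin mult.commute[of _ "2 * pi"])
  then show ?thesis
    by (simp add: mode_def inner_add_right inner_axis k algebra_simps)
qed

lemma trig_periodic: "f \<in> trig \<Longrightarrow> cube_periodic f"
  unfolding cube_periodic_def
  by (induction rule: trig.induct) (auto simp: mode_periodic)

lemma trig_bounded: "f \<in> trig \<Longrightarrow> \<exists>B>0. \<forall>x. \<bar>f x\<bar> \<le> B"
proof (induction rule: trig.induct)
  case (trig_mode w a \<theta>)
  have "\<bar>mode a w \<theta> x\<bar> \<le> \<bar>a\<bar> + 1" for x
    using mult_mono[OF order_refl abs_cos_le_one, of "\<bar>a\<bar>" "w \<bullet> x + \<theta>"]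
    by (simp add: mode_def abs_mult)
  then show ?case by (intro exI[of _ "\<bar>a\<bar> + 1"]) auto
next
  case (trig_add f g)
  then obtain B C where "B > 0" "\<forall>x. \<bar>f x\<bar> \<le> B" "C > 0" "\<forall>x. \<bar>g x\<bar> \<le> C"
    by blast
  then have "\<forall>x. \<bar>f x + g x\<bar> \<le> B + C"
    by (meson abs_triangle_ineq add_mono order_trans)
  then show ?case
    using \<open>B > 0\<close> \<open>C > 0\<close> by (intro exI[of _ "B + C"]) auto
qed

section \<open>The heat semigroup\<close>

definition walk :: "real \<Rightarrow> (real^'n \<Rightarrow> real) \<Rightarrow> real^'n \<Rightarrow> real" where
  "walk h f x = (\<Sum>i\<in>UNIV. f (x + h *\<^sub>R axis i 1) + f (x - h *\<^sub>R axis i 1)) / (2 * real CARD('n))"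

text \<open>
  The limit of random walks of \<open>N\<close> steps with the variance of the heat flow at time \<open>t\<close>. Each step is an
  average, so the positivity of the heat flow is visible in this definition; on trigonometric
  polynomials it agrees with the multiplier \<open>exp (- |w|\<^sup>2 t)\<close>, see \<open>heat_mode\<close>.
\<close>
definition heat :: "real \<Rightarrow> (real^'n \<Rightarrow> real) \<Rightarrow> real^'n \<Rightarrow> real" where
  "heat t f x = lim (\<lambda>N. (walk (sqrt (2 * real CARD('n) * t / real N)) ^^ N) f x)"

text \<open>
  The eigenvalue of \<open>walk h\<close> on a mode of frequency \<open>w\<close>.
\<close>
definition walk_factor :: "real \<Rightarrow> real^'n \<Rightarrow> real" where
  "walk_factor h w = (\<Sum>i\<in>UNIV. cos (h * w $ i)) / real CARD('n)"

lemma walk_mode: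
  fixes w :: "real^'n"
  shows "walk h (mode a w \<theta>) = mode (walk_factor h w * a) w \<theta>"
proof
  fix x :: "real^'n"
  have "mode a w \<theta> (x + h *\<^sub>R axis i 1) + mode a w \<theta> (x - h *\<^sub>R axis i 1)
      = 2 * a * cos (h * w $ i) * cos (w \<bullet> x + \<theta>)" for i
  proof -
    have "cos (w \<bullet> x + \<theta> + h * w $ i) + cos (w \<bullet> x + \<theta> - h * w $ i)
        = 2 * cos (h * w $ i) * cos (w \<bullet> x + \<theta>)"
      by (simp add: cos_add cos_diff)
    then show ?thesis
      by (simp add: mode_def inner_add_right inner_diff_right inner_axis algebra_simps
          flip: distrib_left)
  qed
  then show "walk h (mode a w \<theta>) x = mode (walk_factor h w * a) w \<theta> x"
    by (simp add: walk_def walk_factor_def mode_def sum_distrib_left sum_distrib_right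
        sum_divide_distrib field_simps)
qed

lemma walk_add: "walk h (\<lambda>x. f x + g x) = (\<lambda>x. walk h f x + walk h g x)"
  by (auto simp: walk_def add_divide_distrib sum.distrib)

lemma walk_pow_add: "(walk h ^^ N) (\<lambda>x. f x + g x) = (\<lambda>x. (walk h ^^ N) f x + (walk h ^^ N) g x)"
  by (induction N) (auto simp: walk_add)

lemma walk_pow_mode: "(walk h ^^ N) (mode a w \<theta>) = mode (walk_factor h w ^ N * a) w \<theta>"
  by (induction N) (auto simp: walk_mode mult_ac)

lemma walk_pow_nonneg: "(\<And>x. 0 \<le> f x) \<Longrightarrow> 0 \<le> (walk h ^^ N) f x"
  by (induction N arbitrary: x) (auto simp: walk_def intro!: divide_nonneg_pos sum_nonneg)

lemma abs_walk_factor_le: "\<bar>walk_factor h w\<bar> \<le> 1"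
proof -
  have "\<bar>\<Sum>i\<in>(UNIV::'a set). cos (h * w $ i)\<bar> \<le> (\<Sum>i\<in>(UNIV::'a set). 1)"
    by (rule order_trans[OF sum_abs sum_mono]) auto
  then show ?thesis by (simp add: walk_factor_def field_simps)
qed

lemma power_diff_le:
  fixes a b :: real
  assumes "\<bar>a\<bar> \<le> 1" "\<bar>b\<bar> \<le> 1"
  shows "\<bar>a ^ N - b ^ N\<bar> \<le> real N * \<bar>a - b\<bar>"
proof (induction N)
  case (Suc N)
  have "a ^ Suc N - b ^ Suc N = a * (a ^ N - b ^ N) + (a - b) * b ^ N"
    by (simp add: algebra_simps)
  also have "\<bar>\<dots>\<bar> \<le> \<bar>a\<bar> * \<bar>a ^ N - b ^ N\<bar> + \<bar>a - b\<bar> * \<bar>b ^ N\<bar>"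
    by (metis abs_mult abs_triangle_ineq)
  also have "\<dots> \<le> 1 * (real N * \<bar>a - b\<bar>) + \<bar>a - b\<bar> * 1"
    using assms Suc by (intro add_mono mult_mono) (auto simp: power_abs power_le_one)
  finally show ?case by (simp add: algebra_simps)
qed auto

text \<open>
  The eigenvalue and \<open>exp (- |w|\<^sup>2 t / N)\<close> agree up to \<open>o(1 / N)\<close>, and taking \<open>N\<close>-th powers of
  numbers in the unit interval multiplies the error by at most \<open>N\<close>.
\<close>
lemma walk_factor_tendsto:
  fixes w :: "real^'n"
  assumes "0 \<le> t"
  shows "(\<lambda>N. walk_factor (sqrt (2 * real CARD('n) * t / real N)) w ^ N)
           \<longlonglongrightarrow> exp (- (norm w)\<^sup>2 * t)"
proof -
  let ?n = "real CARD('n)"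
  define h where "h N = sqrt (2 * ?n * t / real N)" for N
  define D where "D N = walk_factor (h N) w - exp (- (norm w)\<^sup>2 * t / real N)" for N
  \<comment> \<open>The factor \<open>2 n t / N\<close> under the root makes the second-order term of the average equal to
     \<open>- |w|\<^sup>2 t / N\<close>.\<close>
  have cos_lim: "(\<lambda>N. real N * (cos (sqrt (b / real N)) - 1)) \<longlonglongrightarrow> - b / 2" if "b \<ge> 0" for b
  proof (cases "b = 0")
    case False
    then have "sqrt b > 0" using that by simp
    moreover have "(\<lambda>N. real N * (cos (c / sqrt (real N)) - 1)) \<longlonglongrightarrow> - (c * c / 2)" if "c > 0" for c
      using that by real_asymp
    ultimately show ?thesis
      using that by (fastforce simp: real_sqrt_divide)
  qed simp
  have 1: "(\<lambda>N. real N * (cos (h N * w $ i) - 1)) \<longlonglongrightarrow> - (?n * t * (w $ i)\<^sup>2)" for i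
  proof -
    have "cos (h N * w $ i) = cos (sqrt (2 * ?n * t * (w $ i)\<^sup>2 / real N))" for N
    proof -
      have "sqrt (2 * ?n * t * (w $ i)\<^sup>2 / real N) = sqrt (2 * ?n * t / real N) * \<bar>w $ i\<bar>"
        by (metis real_sqrt_abs real_sqrt_mult times_divide_eq_left mult.commute)
      then show ?thesis
        unfolding h_def by (cases "w $ i \<ge> 0") auto
    qed
    then show ?thesis
      using cos_lim[of "2 * ?n * t * (w $ i)\<^sup>2"] assms by (simp add: mult.assoc)
  qed
  have 2: "(\<lambda>N. real N * (exp (- (norm w)\<^sup>2 * t / real N) - 1)) \<longlonglongrightarrow> - (norm w)\<^sup>2 * t"
  proof -
    have "(\<lambda>N. real N * (exp (b / real N) - 1)) \<longlonglongrightarrow> b" for b :: real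
      by (cases "b = 0") (simp, real_asymp)
    then show ?thesis .
  qed
  have "(\<lambda>N. (\<Sum>i\<in>UNIV. real N * (cos (h N * w $ i) - 1)) / ?n
          - real N * (exp (- (norm w)\<^sup>2 * t / real N) - 1))
      \<longlonglongrightarrow> (\<Sum>i\<in>UNIV. - (?n * t * (w $ i)\<^sup>2)) / ?n - (- (norm w)\<^sup>2 * t)"
    by (intro tendsto_intros 1 2) auto
  moreover have "(\<Sum>i\<in>UNIV. - (?n * t * (w $ i)\<^sup>2)) / ?n - (- (norm w)\<^sup>2 * t) = 0"
    by (simp add: sum_negf norm_vec_def L2_set_def sum_nonneg flip: sum_distrib_left)
  moreover have "(\<Sum>i\<in>UNIV. real N * (cos (h N * w $ i) - 1)) / ?n
          - real N * (exp (- (norm w)\<^sup>2 * t / real N) - 1) = real N * D N" for N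
    by (simp add: D_def walk_factor_def sum_subtractf field_simps flip: sum_distrib_left)
  ultimately have "(\<lambda>N. real N * D N) \<longlonglongrightarrow> 0" by simp
  then have *: "(\<lambda>N. \<bar>real N * D N\<bar>) \<longlonglongrightarrow> 0"
    by (rule tendsto_rabs_zero)
  have "(\<lambda>N. walk_factor (h N) w ^ N - exp (- (norm w)\<^sup>2 * t)) \<longlonglongrightarrow> 0"
  proof (rule Lim_null_comparison[OF _ *])
    show "\<forall>\<^sub>F N in sequentially.
        norm (walk_factor (h N) w ^ N - exp (- (norm w)\<^sup>2 * t)) \<le> \<bar>real N * D N\<bar>"
      using eventually_gt_at_top[of 0]
    proof eventually_elim
      case (elim N)
      have "exp (- (norm w)\<^sup>2 * t) = exp (- (norm w)\<^sup>2 * t / real N) ^ N"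
        using elim by (simp add: exp_of_nat_mult[symmetric])
      moreover have "\<bar>exp (- (norm w)\<^sup>2 * t / real N)\<bar> \<le> 1"
        using assms by simp
      ultimately show ?case
        using power_diff_le[OF abs_walk_factor_le, of "exp (- (norm w)\<^sup>2 * t / real N)" "h N" w N]
        by (simp add: D_def abs_mult)
    qed
  qed
  then show ?thesis
    unfolding h_def by (simp add: LIM_zero_iff)
qed

lemma walk_pow_mode_tendsto:
  "0 \<le> t \<Longrightarrow> (\<lambda>N. (walk (sqrt (2 * real CARD('n) * t / real N)) ^^ N) (mode a (w::real^'n) \<theta>) x)
     \<longlonglongrightarrow> mode (a * exp (- (norm w)\<^sup>2 * t)) w \<theta> x"
  unfolding walk_pow_mode mode_def
  using tendsto_mult_right[OF tendsto_mult_right[OF walk_factor_tendsto], of t w a "cos (w \<bullet> x + \<theta>)"]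
  by (simp add: mult_ac)

lemma heat_mode:
  "0 \<le> t \<Longrightarrow> heat t (mode a w \<theta>) = mode (a * exp (- (norm w)\<^sup>2 * t)) w \<theta>"
  unfolding heat_def using walk_pow_mode_tendsto limI by blast

lemma walk_tendsto_heat:
  assumes "f \<in> trig" "0 \<le> t"
  shows "(\<lambda>N. (walk (sqrt (2 * real CARD('n) * t / real N)) ^^ N) f (x::real^'n)) \<longlonglongrightarrow> heat t f x"
proof -
  have "convergent (\<lambda>N. (walk (sqrt (2 * real CARD('n) * t / real N)) ^^ N) f x)"
    using assms(1)
  proof (induction rule: trig.induct)
    case trig_mode
    show ?case using walk_pow_mode_tendsto[OF assms(2)] convergentI by blast
  next
    case (trig_add f g)
    then show ?case by (simp add: walk_pow_add convergent_add)
  qed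
  then show ?thesis
    by (simp add: heat_def convergent_LIMSEQ_iff)
qed

lemma heat_nonneg: "f \<in> trig \<Longrightarrow> 0 \<le> t \<Longrightarrow> (\<And>x. 0 \<le> f x) \<Longrightarrow> 0 \<le> heat t f x"
  by (rule LIMSEQ_le_const[OF walk_tendsto_heat]) (auto intro: walk_pow_nonneg)

lemma heat_add:
  assumes "f \<in> trig" "g \<in> trig" "0 \<le> t"
  shows "heat t (\<lambda>x. f x + g x) = (\<lambda>x. heat t f x + heat t g x)"
proof
  fix x
  show "heat t (\<lambda>x. f x + g x) x = heat t f x + heat t g x"
    unfolding heat_def[of t "\<lambda>x. f x + g x"] walk_pow_add
    by (intro limI tendsto_add walk_tendsto_heat assms)
qed

lemma trig_heat: "f \<in> trig \<Longrightarrow> 0 \<le> t \<Longrightarrow> heat t f \<in> trig"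
  by (induction rule: trig.induct) (auto simp: heat_mode heat_add intro: trig.intros)

lemma heat_const: "0 \<le> t \<Longrightarrow> heat t (\<lambda>x. c) = (\<lambda>x. c)"
  using heat_mode[of t c 0 0] by (simp add: mode_0)

lemma heat_cmult: "f \<in> trig \<Longrightarrow> 0 \<le> t \<Longrightarrow> heat t (\<lambda>x. c * f x) = (\<lambda>x. c * heat t f x)"
  by (induction rule: trig.induct)
    (auto simp: heat_mode mode_cmult distrib_left heat_add trig_cmult mult.assoc)

lemma heat_minus: "f \<in> trig \<Longrightarrow> 0 \<le> t \<Longrightarrow> heat t (\<lambda>x. - f x) = (\<lambda>x. - heat t f x)"
  using heat_cmult[of f t "-1"] by simp

lemma heat_diff:
  "f \<in> trig \<Longrightarrow> g \<in> trig \<Longrightarrow> 0 \<le> t \<Longrightarrow> heat t (\<lambda>x. f x - g x) = (\<lambda>x. heat t f x - heat t g x)"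
  using heat_add[OF _ trig_minus, of f g t] by (simp add: heat_minus)

lemma heat_sum:
  "(\<And>j. j \<in> I \<Longrightarrow> f j \<in> trig) \<Longrightarrow> 0 \<le> t \<Longrightarrow>
     heat t (\<lambda>x. \<Sum>j\<in>I. f j x) = (\<lambda>x. \<Sum>j\<in>I. heat t (f j) x)"
  by (induction I rule: infinite_finite_induct) (auto simp: heat_const heat_add trig_sum)

lemma heat_0: "f \<in> trig \<Longrightarrow> heat 0 f = f"
  by (induction rule: trig.induct) (auto simp: heat_mode heat_add)

lemma heat_heat: "f \<in> trig \<Longrightarrow> 0 \<le> s \<Longrightarrow> 0 \<le> t \<Longrightarrow> heat s (heat t f) = heat (s + t) f"
  by (induction rule: trig.induct)
    (auto simp: heat_mode heat_add trig_heat algebra_simps mult_exp_exp)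

lemma partial_heat: "f \<in> trig \<Longrightarrow> 0 \<le> t \<Longrightarrow> partial i (heat t f) = heat t (partial i f)"
  by (induction rule: trig.induct)
    (auto simp: heat_mode heat_add trig_heat partial_mode partial_add trig_partial mult_ac)

lemma heat_mono:
  assumes "f \<in> trig" "g \<in> trig" "0 \<le> t" "\<And>x. f x \<le> g x"
  shows "heat t f x \<le> heat t g x"
proof -
  have "0 \<le> heat t (\<lambda>x. g x - f x) x"
    using assms by (intro heat_nonneg trig_diff) auto
  then show ?thesis using assms by (simp add: heat_diff)
qed

lemma heat_abs_le:
  assumes "f \<in> trig" "0 \<le> t" "\<And>x. \<bar>f x\<bar> \<le> B"
  shows "\<bar>heat t f x\<bar> \<le> B"
proof -
  have "heat t f x \<le> heat t (\<lambda>x. B) x" "heat t (\<lambda>x. - B) x \<le> heat t f x"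
    using assms by (auto intro!: heat_mono simp: abs_le_iff minus_le_iff)
  then show ?thesis using assms by (simp add: heat_const abs_le_iff)
qed

definition laplacian :: "(real^'n \<Rightarrow> real) \<Rightarrow> real^'n \<Rightarrow> real" where
  "laplacian f x = (\<Sum>i\<in>UNIV. partial i (partial i f) x)"

lemma laplacian_mode: "laplacian (mode a w \<theta>) = mode (- (norm w)\<^sup>2 * a) w \<theta>"
proof
  fix x
  have "cos (w \<bullet> x + (\<theta> + pi)) = - cos (w \<bullet> x + \<theta>)"
    by (simp add: cos_periodic_pi[of "w \<bullet> x + \<theta>", symmetric] add.assoc)
  then show "laplacian (mode a w \<theta>) x = mode (- (norm w)\<^sup>2 * a) w \<theta> x"
    by (simp add: laplacian_def partial_mode mode_def norm_vec_def L2_set_def sum_nonneg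
        sum_distrib_left sum_distrib_right power2_eq_square sum_negf mult.left_commute[of a] mult.assoc add.assoc)
qed

lemma laplacian_add:
  "f \<in> trig \<Longrightarrow> g \<in> trig \<Longrightarrow> laplacian (\<lambda>x. f x + g x) = (\<lambda>x. laplacian f x + laplacian g x)"
  by (auto simp: laplacian_def partial_add trig_partial sum.distrib)

lemma trig_laplacian: "f \<in> trig \<Longrightarrow> laplacian f \<in> trig"
  using trig_sum[of UNIV "\<lambda>i. partial i (partial i f)"]
  by (simp add: trig_partial laplacian_def[abs_def])

lemma heat_equation:
  assumes "f \<in> trig" "0 < t"
  shows "((\<lambda>t. heat t f x) has_real_derivative heat t (laplacian f) x) (at t)"
  using assms(1)
proof (induction rule: trig.induct)
  case (trig_mode w a \<theta>)
  have "((\<lambda>t. mode (a * exp (- (norm w)\<^sup>2 * t)) w \<theta> x) has_real_derivative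
      mode (- (norm w)\<^sup>2 * a * exp (- (norm w)\<^sup>2 * t)) w \<theta> x) (at t)"
    unfolding mode_def by (auto intro!: derivative_eq_intros)
  moreover have "\<forall>\<^sub>F t in nhds t. mode (a * exp (- (norm w)\<^sup>2 * t)) w \<theta> x = heat t (mode a w \<theta>) x"
    using eventually_nhds_in_open[OF open_greaterThan[of 0], of t] assms(2)
    by (auto simp: heat_mode elim!: eventually_mono)
  ultimately show ?case
    using assms(2) DERIV_cong_ev[OF refl _ refl, THEN iffD1]
    by (simp add: laplacian_mode heat_mode)
next
  case (trig_add f g)
  have "((\<lambda>t. heat t f x + heat t g x) has_real_derivative
      heat t (laplacian f) x + heat t (laplacian g) x) (at t)"
    by (intro DERIV_add trig_add)
  moreover have "\<forall>\<^sub>F t in nhds t. heat t f x + heat t g x = heat t (\<lambda>x. f x + g x) x"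
    using eventually_nhds_in_open[OF open_greaterThan[of 0], of t] assms(2) trig_add
    by (auto simp: heat_add elim!: eventually_mono)
  ultimately show ?case
    using assms(2) DERIV_cong_ev[OF refl _ refl, THEN iffD1] trig_add
    by (simp add: laplacian_add heat_add trig_laplacian)
qed

lemma heat_continuous:
  assumes "f \<in> trig"
  shows "continuous_on ({0..} \<times> UNIV) (\<lambda>(t, x). heat t f x)"
  using assms
proof (induction rule: trig.induct)
  case (trig_mode w a \<theta>)
  have "continuous_on ({0..} \<times> UNIV) (\<lambda>(t, x). mode (a * exp (- (norm w)\<^sup>2 * t)) w \<theta> x)"
    unfolding mode_def split_beta by (intro continuous_intros)
  then show ?case by (rule continuous_on_eq) (auto simp: heat_mode)
next
  case (trig_add f g)
  have "continuous_on ({0..} \<times> UNIV) (\<lambda>z. (case z of (t, x) \<Rightarrow> heat t f x) + (case z of (t, x) \<Rightarrow> heat t g x))"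
    by (intro continuous_on_add trig_add)
  then show ?case by (rule continuous_on_eq) (auto simp: heat_add trig_add)
qed

section \<open>Gradient bounds from positivity\<close>

text \<open>
  Positivity applied to \<open>(f - c)\<^sup>2\<close>, where \<open>c\<close> is the value of \<open>heat t f\<close> at the point in question.
\<close>
lemma heat_square_ge:
  assumes "f \<in> trig" "0 \<le> t"
  shows "(heat t f x)\<^sup>2 \<le> heat t (\<lambda>y. (f y)\<^sup>2) x"
proof -
  define c where "c = heat t f x"
  have "(\<lambda>y. (f y - c)\<^sup>2) = (\<lambda>y. (f y)\<^sup>2 - (2 * c * f y - c\<^sup>2))"
    by (auto simp: power2_eq_square algebra_simps)
  then have "heat t (\<lambda>y. (f y - c)\<^sup>2) x = heat t (\<lambda>y. (f y)\<^sup>2) x - (2 * c * c - c\<^sup>2)"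
    using assms by (simp add: heat_diff heat_cmult heat_const trig_power2 trig_cmult trig_diff c_def)
  moreover have "0 \<le> heat t (\<lambda>y. (f y - c)\<^sup>2) x"
    using assms by (intro heat_nonneg trig_power2 trig_diff) auto
  ultimately show ?thesis
    by (simp add: c_def power2_eq_square)
qed

lemma heat_mult_mode:
  assumes "w \<in> frequencies" "v \<in> frequencies" "0 \<le> u"
  shows "heat u (\<lambda>y. mode a w \<theta> y * mode b v \<eta> y) x
    = a * b / 2 * (exp (- (norm (w - v))\<^sup>2 * u) * cos ((w - v) \<bullet> x + (\<theta> - \<eta>))
                 + exp (- (norm (w + v))\<^sup>2 * u) * cos ((w + v) \<bullet> x + (\<theta> + \<eta>)))"
  unfolding mode_mult using assms
  by (simp add: heat_add trig_mode frequencies_add frequencies_diff heat_mode)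
    (simp add: mode_def algebra_simps)

lemma exp_product_derivative:
  fixes a b p q r u c d t :: real
  shows "((\<lambda>s. a * exp (- p * s) * (b * exp (- q * s)) / 2
            * (exp (- r * (t - s)) * c + exp (- u * (t - s)) * d)) has_real_derivative
    a * exp (- p * s) * (b * exp (- q * s)) / 2
      * ((r - p - q) * (exp (- r * (t - s)) * c) + (u - p - q) * (exp (- u * (t - s)) * d))) (at s)"
  by (auto intro!: derivative_eq_intros) (auto simp: field_simps)

text \<open>
  The derivative of \<open>s \<mapsto> P\<^sub>t\<^sub>-\<^sub>s (P\<^sub>s q \<cdot> P\<^sub>s r)\<close> is \<open>P\<^sub>t\<^sub>-\<^sub>s\<close> of \<open>u \<Delta>v + v \<Delta>u - \<Delta>(u v) = - 2 \<nabla>u \<cdot> \<nabla>v\<close>, with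
  \<open>u = P\<^sub>s q\<close> and \<open>v = P\<^sub>s r\<close>. The statement is bilinear in \<open>q\<close> and \<open>r\<close>, and on two modes it is an
  identity between exponentials. The form with two functions, rather than a square, is
  what makes this reduction possible.
\<close>
lemma carre_du_champ_derivative:
  assumes "q \<in> trig" "r \<in> trig"
  shows "continuous_on {0..t} (\<lambda>s. heat (t - s) (\<lambda>y. heat s q y * heat s r y) x) \<and>
    (\<forall>s\<in>{0<..<t}. ((\<lambda>s. heat (t - s) (\<lambda>y. heat s q y * heat s r y) x) has_real_derivative
      - 2 * (\<Sum>i\<in>UNIV. heat (t - s) (\<lambda>y. partial i (heat s q) y * partial i (heat s r) y) x)) (at s))"
    (is "?P q r")
proof -
  have add_left: "?P (\<lambda>x. q x + q' x) r" if "q \<in> trig" "q' \<in> trig" "r \<in> trig" "?P q r" "?P q' r"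
    for q q' r
  proof -
    let ?F = "\<lambda>q s. heat (t - s) (\<lambda>y. heat s q y * heat s r y) x"
    have *: "?F q s + ?F q' s = ?F (\<lambda>x. q x + q' x) s" if "s \<in> {0..t}" for s
      using that \<open>q \<in> trig\<close> \<open>q' \<in> trig\<close> \<open>r \<in> trig\<close>
      by (simp add: heat_add trig_heat distrib_right trig_mult)
    have "continuous_on {0..t} (\<lambda>s. ?F q s + ?F q' s)"
      using that by (intro continuous_on_add) auto
    then have 1: "continuous_on {0..t} (?F (\<lambda>x. q x + q' x))"
      by (rule continuous_on_eq) (rule *)
    have 2: "(?F (\<lambda>x. q x + q' x) has_real_derivative
      - 2 * (\<Sum>i\<in>UNIV. heat (t - s) (\<lambda>y. partial i (heat s (\<lambda>x. q x + q' x)) y * partial i (heat s r) y) x)) (at s)"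
      if s: "s \<in> {0<..<t}" for s
    proof -
      have "((\<lambda>s. ?F q s + ?F q' s) has_real_derivative
      - 2 * (\<Sum>i\<in>UNIV. heat (t - s) (\<lambda>y. partial i (heat s q) y * partial i (heat s r) y) x)
      + - 2 * (\<Sum>i\<in>UNIV. heat (t - s) (\<lambda>y. partial i (heat s q') y * partial i (heat s r) y) x)) (at s)"
        using that \<open>?P q r\<close> \<open>?P q' r\<close> by (intro DERIV_add) auto
      moreover have "heat (t - s) (\<lambda>y. partial i (heat s (\<lambda>x. q x + q' x)) y * partial i (heat s r) y) x
          = heat (t - s) (\<lambda>y. partial i (heat s q) y * partial i (heat s r) y) x
          + heat (t - s) (\<lambda>y. partial i (heat s q') y * partial i (heat s r) y) x" for i
        using s \<open>q \<in> trig\<close> \<open>q' \<in> trig\<close> \<open>r \<in> trig\<close>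
        by (simp add: heat_add partial_add trig_heat trig_partial distrib_right trig_mult)
      ultimately have "((\<lambda>s. ?F q s + ?F q' s) has_real_derivative
      - 2 * (\<Sum>i\<in>UNIV. heat (t - s) (\<lambda>y. partial i (heat s (\<lambda>x. q x + q' x)) y * partial i (heat s r) y) x)) (at s)"
        by (simp add: sum.distrib)
      then show ?thesis
        by (rule has_field_derivative_transform_within_open[of _ _ _ "{0<..<t}"]) (use s * in auto)
    qed
    show ?thesis using 1 2 by blast
  qed
  have commute: "?P r q" if "?P q r" for q r
    using that by (simp add: mult.commute)
  have modes: "?P (mode a w \<theta>) (mode b v \<eta>)" if w: "w \<in> frequencies" and v: "v \<in> frequencies"
    for a b w v \<theta> \<eta>
  proof -
    let ?c1 = "cos ((w - v) \<bullet> x + (\<theta> - \<eta>))" and ?c2 = "cos ((w + v) \<bullet> x + (\<theta> + \<eta>))"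
    let ?F = "\<lambda>s. heat (t - s) (\<lambda>y. heat s (mode a w \<theta>) y * heat s (mode b v \<eta>) y) x"
    let ?e = "\<lambda>s. a * exp (- (norm w)\<^sup>2 * s) * (b * exp (- (norm v)\<^sup>2 * s)) / 2"
    let ?G = "\<lambda>s. ?e s * (exp (- (norm (w - v))\<^sup>2 * (t - s)) * ?c1
                                 + exp (- (norm (w + v))\<^sup>2 * (t - s)) * ?c2)"
    have FG: "?G s = ?F s" if "s \<in> {0..t}" for s
      using that w v by (simp add: heat_mode heat_mult_mode)
    have 1: "continuous_on {0..t} ?F"
      by (rule continuous_on_eq[of _ ?G, OF _ FG]) (auto intro!: continuous_intros)
    have 2: "(?F has_real_derivative - 2 * (\<Sum>i\<in>UNIV. heat (t - s)
          (\<lambda>y. partial i (heat s (mode a w \<theta>)) y * partial i (heat s (mode b v \<eta>)) y) x)) (at s)"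
      if s: "s \<in> {0<..<t}" for s
    proof -
      let ?E1 = "exp (- (norm (w - v))\<^sup>2 * (t - s)) * ?c1"
      let ?E2 = "exp (- (norm (w + v))\<^sup>2 * (t - s)) * ?c2"
      have rearrange: "e * (- 2 * k * y + 2 * k * z) = - 2 * k * (e * y - e * z)" for e k y z :: real
        by (simp add: algebra_simps)
      have "(?G has_real_derivative ?e s * (((norm (w - v))\<^sup>2 - (norm w)\<^sup>2 - (norm v)\<^sup>2) * ?E1
              + ((norm (w + v))\<^sup>2 - (norm w)\<^sup>2 - (norm v)\<^sup>2) * ?E2)) (at s)"
        by (rule exp_product_derivative)
      moreover have "(norm (w - v))\<^sup>2 - (norm w)\<^sup>2 - (norm v)\<^sup>2 = - 2 * (w \<bullet> v)"
        "(norm (w + v))\<^sup>2 - (norm w)\<^sup>2 - (norm v)\<^sup>2 = 2 * (w \<bullet> v)"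
        by (simp_all add: power2_norm_eq_inner inner_add_left inner_add_right inner_diff_left
            inner_diff_right inner_commute)
      ultimately have "(?G has_real_derivative - 2 * (w \<bullet> v) * (?e s * ?E1 - ?e s * ?E2)) (at s)"
        by (simp only: rearrange)
      moreover have comp: "heat (t - s) (\<lambda>y. partial i (heat s (mode a w \<theta>)) y * partial i (heat s (mode b v \<eta>)) y) x
          = w $ i * v $ i * (?e s * ?E1 - ?e s * ?E2)" for i
      proof -
        have shift: "(w + v) \<bullet> x + (\<theta> + pi / 2 + (\<eta> + pi / 2)) = (w + v) \<bullet> x + (\<theta> + \<eta>) + pi"
          "(w - v) \<bullet> x + (\<theta> + pi / 2 - (\<eta> + pi / 2)) = (w - v) \<bullet> x + (\<theta> - \<eta>)"
          by simp_all
        have rearrange: "A * wi * (B * vi) / 2 * (y + z * - d) = wi * vi * (A * B / 2 * y - A * B / 2 * (z * d))"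
          for A B wi vi y z d :: real
          by (simp add: field_simps)
        have "0 \<le> s" "0 \<le> t - s" using s by auto
        then show ?thesis
          unfolding heat_mode[OF \<open>0 \<le> s\<close>] partial_mode heat_mult_mode[OF w v \<open>0 \<le> t - s\<close>]
            shift cos_periodic_pi rearrange by simp
      qed
      moreover have "(\<Sum>i\<in>UNIV. heat (t - s)
            (\<lambda>y. partial i (heat s (mode a w \<theta>)) y * partial i (heat s (mode b v \<eta>)) y) x)
          = (w \<bullet> v) * (?e s * ?E1 - ?e s * ?E2)"
        unfolding comp by (simp only: inner_vec_def inner_real_def sum_distrib_right)
      ultimately have "(?G has_real_derivative - 2 * (\<Sum>i\<in>UNIV. heat (t - s)
          (\<lambda>y. partial i (heat s (mode a w \<theta>)) y * partial i (heat s (mode b v \<eta>)) y) x)) (at s)"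
        by (simp only: mult.assoc)
      then show ?thesis
        by (rule has_field_derivative_transform_within_open[of _ _ _ "{0<..<t}"]) (use s FG in auto)
    qed
    show ?thesis using 1 2 by blast
  qed
  have left: "?P q (mode b v \<eta>)" if v: "v \<in> frequencies" for b v \<eta>
    using assms(1)
  proof (induction rule: trig.induct)
    case (trig_mode w a \<theta>)
    then show ?case using v by (rule modes)
  next
    case (trig_add q q')
    then show ?case using trig_mode[OF v] by (intro add_left)
  qed
  show ?thesis
    using assms(2)
  proof (induction rule: trig.induct)
    case (trig_mode v b \<eta>)
    then show ?case by (rule left)
  next
    case (trig_add r r')
    show ?case
      by (rule commute, rule add_left) (use trig_add assms(1) commute in blast)+
  qed
qed

text \<open>
  The difference of the two endpoint values of \<open>s \<mapsto> P\<^sub>t\<^sub>-\<^sub>s ((P\<^sub>s f)\<^sup>2)\<close> is the variance of \<open>f\<close> at time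
  \<open>t\<close>; a mean value of its derivative suffices for bounds from both sides.
\<close>
lemma carre_du_champ_mvt:
  assumes "f \<in> trig" "0 < t"
  obtains s where "0 < s" "s < t"
    "heat t (\<lambda>y. (f y)\<^sup>2) x - (heat t f x)\<^sup>2
       = 2 * t * (\<Sum>i\<in>UNIV. heat (t - s) (\<lambda>y. (heat s (partial i f) y)\<^sup>2) x)"
proof -
  let ?F = "\<lambda>s. heat (t - s) (\<lambda>y. heat s f y * heat s f y) x"
  let ?D = "\<lambda>s. - 2 * (\<Sum>i\<in>UNIV. heat (t - s) (\<lambda>y. partial i (heat s f) y * partial i (heat s f) y) x)"
  note aux = carre_du_champ_derivative[OF assms(1) assms(1), of t x]
  obtain s where s: "s \<in> {0<..<t}" and "?F t - ?F 0 = ?D s * (t - 0)"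
    by (rule mvt[OF assms(2), of ?F "\<lambda>s. (*) (?D s)"])
      (use aux in \<open>auto simp: has_field_derivative_def\<close>)
  moreover have "?F t = (heat t f x)\<^sup>2"
    using assms by (simp add: heat_0 trig_mult trig_heat power2_eq_square)
  moreover have "?F 0 = heat t (\<lambda>y. (f y)\<^sup>2) x"
    using assms by (simp add: heat_0 power2_eq_square)
  moreover have "partial i (heat s f) = heat s (partial i f)" for i
    using s assms by (simp add: partial_heat)
  ultimately show ?thesis
    using that[of s] s by (simp add: power2_eq_square algebra_simps)
qed

text \<open>
  This reverse Poincare inequality gives the smoothing of the heat flow without any kernel: the
  variance is at most \<open>sup f\<^sup>2\<close>, so the gradient at time \<open>t\<close> is of order \<open>1 / \<surd>t\<close>.
\<close>
lemma heat_variance_ge: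
  assumes "f \<in> trig" "0 < t"
  shows "2 * t * (\<Sum>i\<in>UNIV. (heat t (partial i f) x)\<^sup>2)
           \<le> heat t (\<lambda>y. (f y)\<^sup>2) x - (heat t f x)\<^sup>2"
proof -
  obtain s where s: "0 < s" "s < t" and eq: "heat t (\<lambda>y. (f y)\<^sup>2) x - (heat t f x)\<^sup>2
       = 2 * t * (\<Sum>i\<in>UNIV. heat (t - s) (\<lambda>y. (heat s (partial i f) y)\<^sup>2) x)"
    using carre_du_champ_mvt[OF assms] .
  have "(heat t (partial i f) x)\<^sup>2 \<le> heat (t - s) (\<lambda>y. (heat s (partial i f) y)\<^sup>2) x" for i
    using heat_square_ge[of "heat s (partial i f)" "t - s" x] s assms
    by (simp add: heat_heat trig_partial trig_heat)
  then show ?thesis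
    unfolding eq using assms by (intro mult_left_mono sum_mono) auto
qed

text \<open>
  The Poincare inequality for the heat flow: \<open>P\<^sub>t\<^sub>-\<^sub>s ((P\<^sub>s \<partial>\<^sub>i f)\<^sup>2) \<le> P\<^sub>t ((\<partial>\<^sub>i f)\<^sup>2)\<close> by positivity.
\<close>
lemma heat_variance_le:
  assumes "f \<in> trig" "0 < t" and G: "\<And>y. (\<Sum>i\<in>UNIV. (partial i f y)\<^sup>2) \<le> G"
  shows "heat t (\<lambda>y. (f y)\<^sup>2) x - (heat t f x)\<^sup>2 \<le> 2 * t * G"
proof -
  obtain s where s: "0 < s" "s < t" and eq: "heat t (\<lambda>y. (f y)\<^sup>2) x - (heat t f x)\<^sup>2
       = 2 * t * (\<Sum>i\<in>UNIV. heat (t - s) (\<lambda>y. (heat s (partial i f) y)\<^sup>2) x)"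
    using carre_du_champ_mvt[OF assms(1,2)] .
  note [simp] = trig_partial[OF assms(1)] trig_power2 trig_heat trig_sum
  have "heat (t - s) (\<lambda>y. (heat s (partial i f) y)\<^sup>2) x \<le> heat t (\<lambda>y. (partial i f y)\<^sup>2) x" for i
  proof -
    have "heat (t - s) (\<lambda>y. (heat s (partial i f) y)\<^sup>2) x
        \<le> heat (t - s) (heat s (\<lambda>y. (partial i f y)\<^sup>2)) x"
      using s by (intro heat_mono heat_square_ge) auto
    then show ?thesis using s by (simp add: heat_heat)
  qed
  then have "(\<Sum>i\<in>UNIV. heat (t - s) (\<lambda>y. (heat s (partial i f) y)\<^sup>2) x)
      \<le> heat t (\<lambda>y. \<Sum>i\<in>UNIV. (partial i f y)\<^sup>2) x"
    using assms by (simp add: heat_sum sum_mono)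
  also have "\<dots> \<le> heat t (\<lambda>y. G) x"
    using assms by (intro heat_mono) auto
  finally show ?thesis
    unfolding eq using assms by (intro mult_left_mono) (auto simp: heat_const)
qed

lemma partial_heat_bound:
  assumes "f \<in> trig" "0 < t" "\<And>y. \<bar>f y\<bar> \<le> B"
  shows "\<bar>partial i (heat t f) x\<bar> \<le> B / sqrt (2 * t)"
proof -
  have B: "0 \<le> B" using assms(3)[of 0] by linarith
  have "2 * t * (heat t (partial i f) x)\<^sup>2 \<le> 2 * t * (\<Sum>i\<in>UNIV. (heat t (partial i f) x)\<^sup>2)"
    using assms(2) by (intro mult_left_mono member_le_sum) auto
  also have "\<dots> \<le> heat t (\<lambda>y. (f y)\<^sup>2) x"
    using heat_variance_ge[OF assms(1,2), of x] zero_le_power2[of "heat t f x"] by linarith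
  also have "\<dots> \<le> heat t (\<lambda>y. B\<^sup>2) x"
    using assms by (intro heat_mono trig_power2) (auto simp: abs_le_square_iff[symmetric] B)
  finally have "(sqrt (2 * t) * \<bar>heat t (partial i f) x\<bar>)\<^sup>2 \<le> B\<^sup>2"
    using assms(2) by (simp add: heat_const power_mult_distrib)
  then have "sqrt (2 * t) * \<bar>heat t (partial i f) x\<bar> \<le> B"
    by (rule power2_le_imp_le) (rule B)
  then show ?thesis
    using assms by (simp add: partial_heat pos_le_divide_eq mult.commute)
qed

text \<open>
  Each derivative is taken after a separate half of the time.
\<close>
lemma partial2_heat_bound:
  assumes "f \<in> trig" "0 < t" "\<And>y. \<bar>f y\<bar> \<le> B"
  shows "\<bar>partial i (partial j (heat t f)) x\<bar> \<le> B / t"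
proof -
  have "heat t f = heat (t / 2) (heat (t / 2) f)"
    using assms by (simp add: heat_heat)
  then have "partial i (partial j (heat t f)) = partial i (heat (t / 2) (partial j (heat (t / 2) f)))"
    using assms by (simp add: partial_heat trig_heat)
  moreover have "\<bar>\<dots> x\<bar> \<le> (B / sqrt (2 * (t / 2))) / sqrt (2 * (t / 2))"
    using assms by (intro partial_heat_bound trig_partial trig_heat) auto
  ultimately show ?thesis using assms(2) by simp
qed

lemma partial3_heat_bound:
  assumes "f \<in> trig" "0 < t" "\<And>y. \<bar>f y\<bar> \<le> B"
  shows "\<bar>partial i (partial j (partial l (heat t f))) x\<bar> \<le> 2 * B / (t * sqrt t)"
proof -
  have B: "0 \<le> B" using assms(3)[of 0] by linarith
  let ?u = "t / 3"
  have "heat t f = heat ?u (heat ?u (heat ?u f))"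
    using assms by (simp add: heat_heat)
  then have "partial i (partial j (partial l (heat t f)))
      = partial i (heat ?u (partial j (heat ?u (partial l (heat ?u f)))))"
    using assms by (simp add: partial_heat trig_heat trig_partial)
  moreover have "\<bar>\<dots> x\<bar> \<le> ((B / sqrt (2 * ?u)) / sqrt (2 * ?u)) / sqrt (2 * ?u)"
    using assms by (intro partial_heat_bound trig_partial trig_heat) auto
  moreover have "((B / sqrt (2 * ?u)) / sqrt (2 * ?u)) / sqrt (2 * ?u) \<le> 2 * B / (t * sqrt t)"
  proof -
    have "sqrt t \<le> sqrt (2 * t / 3) * (4 / 3)"
      using assms(2) by (intro real_le_lsqrt) (auto simp: power_mult_distrib power_divide)
    then have "t * sqrt t / 2 \<le> (2 * t / 3) * sqrt (2 * t / 3)"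
      using assms(2) by (simp add: field_simps)
    then have "B / ((2 * t / 3) * sqrt (2 * t / 3)) \<le> B / (t * sqrt t / 2)"
      using assms(2) B by (intro divide_left_mono) auto
    then show ?thesis using assms(2) by (simp add: mult_ac)
  qed
  ultimately show ?thesis by simp
qed

section \<open>The Hessian at a fixed heat scale\<close>

lemma abs_diff_le_of_derivative:
  fixes D r :: "real \<Rightarrow> real"
  assumes "a \<le> b" "continuous_on {a..b} D" "continuous_on {a..b} r"
    and D: "\<And>s. a < s \<Longrightarrow> s < b \<Longrightarrow> (D has_real_derivative D' s) (at s)"
    and r: "\<And>s. a < s \<Longrightarrow> s < b \<Longrightarrow> (r has_real_derivative r' s) (at s)"
    and le: "\<And>s. a < s \<Longrightarrow> s < b \<Longrightarrow> \<bar>D' s\<bar> \<le> r' s"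
  shows "\<bar>D b - D a\<bar> \<le> r b - r a"
proof -
  have "r a - D a \<le> r b - D b"
    by (rule DERIV_nonneg_imp_increasing_open[OF assms(1)])
      (use le in \<open>force intro!: continuous_intros assms DERIV_diff D r simp: abs_le_iff\<close>)+
  moreover have "r a + D a \<le> r b + D b"
    by (rule DERIV_nonneg_imp_increasing_open[OF assms(1)])
      (use le in \<open>force intro!: continuous_intros assms DERIV_add D r simp: abs_le_iff\<close>)+
  ultimately show ?thesis by linarith
qed

lemma heat_continuous_time:
  assumes "f \<in> trig" "0 \<le> a"
  shows "continuous_on {a..b} (\<lambda>s. heat s f x)"
proof -
  have "continuous_on {a..b} (\<lambda>s. (s, x))" "(\<lambda>s. (s, x)) ` {a..b} \<subseteq> {0..} \<times> UNIV"
    using assms(2) by (auto intro!: continuous_intros)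
  from continuous_on_compose2[OF heat_continuous[OF assms(1)] this] show ?thesis
    by simp
qed

lemma laplacian_partial: "f \<in> trig \<Longrightarrow> laplacian (partial i f) = partial i (laplacian f)"
  unfolding laplacian_def[abs_def]
  by (simp add: partial_sum trig_partial partial_commute[of _ i])

lemma heat_laplacian: "f \<in> trig \<Longrightarrow> 0 \<le> t \<Longrightarrow> heat t (laplacian f) = laplacian (heat t f)"
  unfolding laplacian_def[abs_def]
  by (simp add: heat_sum trig_partial partial_heat trig_heat)

text \<open>
  The part of \<open>\<phi>\<close> below scale \<open>\<surd>t\<close> is \<open>- \<integral>\<^sub>0\<^sup>t P\<^sub>s (\<Delta>\<phi>) ds\<close>, and \<open>|\<partial>\<^sub>i P\<^sub>s (\<Delta>\<phi>)| \<le> K / \<surd>(2s)\<close> is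
  integrable at \<open>0\<close>, with integral \<open>K \<surd>(2t)\<close>.
\<close>
lemma heat_small_time:
  assumes "\<phi> \<in> trig" "0 < t" "\<And>y. \<bar>laplacian \<phi> y\<bar> \<le> K"
  shows "\<bar>partial i (\<lambda>y. \<phi> y - heat t \<phi> y) x\<bar> \<le> K * sqrt (2 * t)"
proof -
  note [simp] = trig_partial trig_heat trig_laplacian assms(1)
  let ?D = "\<lambda>s. heat s (partial i \<phi>) x"
  have "\<bar>?D t - ?D 0\<bar> \<le> K * sqrt (2 * t) - K * sqrt (2 * 0)"
  proof (rule abs_diff_le_of_derivative)
    fix s :: real assume s: "0 < s" "s < t"
    show "(?D has_real_derivative partial i (heat s (laplacian \<phi>)) x) (at s)"
      using heat_equation[of "partial i \<phi>" s x] s by (simp add: laplacian_partial partial_heat)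
    show "((\<lambda>s. K * sqrt (2 * s)) has_real_derivative K / sqrt (2 * s)) (at s)"
      using s by (auto intro!: derivative_eq_intros simp: field_simps)
    show "\<bar>partial i (heat s (laplacian \<phi>)) x\<bar> \<le> K / sqrt (2 * s)"
      using s assms by (intro partial_heat_bound) auto
  qed (use assms in \<open>auto intro!: continuous_intros heat_continuous_time\<close>)
  then show ?thesis
    using assms(2) by (simp add: heat_0 partial_diff partial_heat abs_minus_commute)
qed

text \<open>
  The part of \<open>\<phi>\<close> above scale \<open>\<surd>t\<close> is \<open>- \<integral>\<^sub>t\<^sup>\<infinity> P\<^sub>s (\<Delta>\<phi>) ds\<close> up to a constant, and third
  derivatives of the integrand are \<open>O(K s\<^sup>-\<^sup>3\<^sup>/\<^sup>2)\<close>, integrable at infinity.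
\<close>
lemma heat_third_derivative_bound:
  assumes "\<phi> \<in> trig" "0 < t" "\<And>y. \<bar>laplacian \<phi> y\<bar> \<le> K"
  shows "\<bar>partial i (partial j (partial l (heat t \<phi>))) x\<bar> \<le> 4 * K / sqrt t"
proof -
  note [simp] = trig_partial trig_heat trig_laplacian assms(1)
  have K: "0 \<le> K" using assms(3)[of 0] by linarith
  define h where "h = partial j (partial l \<phi>)"
  have h[simp]: "h \<in> trig" by (simp add: h_def)
  obtain B where B: "\<And>y. \<bar>h y\<bar> \<le> B" using trig_bounded[OF h] by blast
  let ?D = "\<lambda>s. heat s (partial i h) x"
  \<comment> \<open>Compare times \<open>t\<close> and \<open>T\<close>; the derivative at time \<open>T\<close> vanishes as \<open>T\<close> tends to infinity.\<close>
  have *: "\<bar>?D t\<bar> \<le> 4 * K / sqrt t + B / sqrt (2 * T)" if T: "t \<le> T" for T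
  proof -
    have "\<bar>?D T - ?D t\<bar> \<le> - 4 * K / sqrt T - - 4 * K / sqrt t"
    proof (rule abs_diff_le_of_derivative[OF T])
      fix s :: real assume s': "t < s" "s < T"
      with assms have s: "0 < s" by simp
      have eq: "heat s (laplacian (partial i h)) = partial i (partial j (partial l (heat s (laplacian \<phi>))))"
        using s by (simp add: h_def laplacian_partial partial_heat)
      show "(?D has_real_derivative partial i (partial j (partial l (heat s (laplacian \<phi>)))) x) (at s)"
        using heat_equation[of "partial i h" s x] s by (simp add: eq)
      show "((\<lambda>s. - 4 * K / sqrt s) has_real_derivative 2 * K / (s * sqrt s)) (at s)"
        using s by (auto intro!: derivative_eq_intros simp: field_simps)
      show "\<bar>partial i (partial j (partial l (heat s (laplacian \<phi>)))) x\<bar> \<le> 2 * K / (s * sqrt s)"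
        using s assms by (intro partial3_heat_bound) auto
    qed (use assms in \<open>auto intro!: continuous_intros heat_continuous_time\<close>)
    moreover have "\<bar>?D T\<bar> \<le> B / sqrt (2 * T)"
      using partial_heat_bound[OF h _ B, of T i x] T assms(2) by (simp add: partial_heat)
    moreover have "0 \<le> 4 * K / sqrt T" using K T assms(2) by simp
    ultimately show ?thesis by (simp add: abs_le_iff)
  qed
  have "((\<lambda>T. 4 * K / sqrt t + B / sqrt (2 * T)) \<longlongrightarrow> 4 * K / sqrt t + 0) at_top"
    by (intro tendsto_add tendsto_const) real_asymp
  then have "\<bar>?D t\<bar> \<le> 4 * K / sqrt t + 0"
    by (rule tendsto_lowerbound) (use eventually_mono[OF eventually_ge_at_top[of t] *] in auto)
  then show ?thesis
    using assms by (simp add: h_def partial_heat)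
qed

lemma laplacian_diff:
  "f \<in> trig \<Longrightarrow> g \<in> trig \<Longrightarrow> laplacian (\<lambda>x. f x - g x) = (\<lambda>x. laplacian f x - laplacian g x)"
  by (auto simp: laplacian_def partial_diff trig_partial sum_subtractf)

text \<open>
  \<open>|D\<^sup>2w|\<^sup>2 - (\<Delta>w)\<^sup>2\<close> is the double divergence \<open>\<Delta>|\<nabla>w|\<^sup>2 - \<Sum> \<partial>\<^sub>i \<partial>\<^sub>j (\<partial>\<^sub>i w \<partial>\<^sub>j w)\<close>. Both the
  local and the global \<open>L\<^sup>2\<close> bounds of the Hessian come from this identity.
\<close>
lemma hessian_identity:
  fixes w :: "real^'n \<Rightarrow> real"
  assumes "w \<in> trig"
  shows "(\<Sum>i\<in>UNIV. \<Sum>j\<in>UNIV. (partial i (partial j w) x)\<^sup>2)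
    = (laplacian w x)\<^sup>2
      + (\<Sum>i\<in>UNIV. partial i (partial i (\<lambda>y. \<Sum>j\<in>UNIV. (partial j w y)\<^sup>2)) x)
      - (\<Sum>i\<in>UNIV. \<Sum>j\<in>UNIV. partial i (partial j (\<lambda>y. partial i w y * partial j w y)) x)"
proof -
  note [simp] = trig_partial assms trig_mult trig_add partial_add partial_mult trig_sum trig_cmult partial_const
  let ?a = "\<lambda>i. partial i w x" and ?p = "\<lambda>i j. partial i (partial j w) x"
  let ?t = "\<lambda>i k. partial i (partial i (partial k w)) x"
  have "partial i (partial i (\<lambda>y. \<Sum>j\<in>UNIV. (partial j w y)\<^sup>2)) x
      = (\<Sum>j\<in>UNIV. 2 * (?p i j)\<^sup>2 + 2 * (?a j * ?t i j))" for i
    by (simp add: partial_sum power2_eq_square algebra_simps)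
  then have 1: "(\<Sum>i\<in>UNIV. partial i (partial i (\<lambda>y. \<Sum>j\<in>UNIV. (partial j w y)\<^sup>2)) x)
      = 2 * (\<Sum>i\<in>UNIV. \<Sum>j\<in>UNIV. (?p i j)\<^sup>2) + 2 * (\<Sum>i\<in>UNIV. \<Sum>j\<in>UNIV. ?a j * ?t i j)"
    by (simp add: sum.distrib sum_distrib_left)
  have third: "partial i (partial j (partial i w)) = partial i (partial i (partial j w))"
    "partial i (partial j (partial j w)) = partial j (partial j (partial i w))" for i j
    by (simp_all add: partial_commute[of _ i j])
  have "partial i (partial j (\<lambda>y. partial i w y * partial j w y)) x
      = (?p i j)\<^sup>2 + ?p i i * ?p j j + ?a j * ?t i j + ?a i * ?t j i" for i j
  proof -
    have "partial j (partial i w) x = ?p i j"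
      by (simp add: partial_commute[of w j i])
    moreover have "partial i (partial j (partial i w)) x = ?t i j"
      "partial i (partial j (partial j w)) x = ?t j i"
      using third[of i j] by simp_all
    ultimately show ?thesis
      by (simp add: power2_eq_square algebra_simps)
  qed
  then have "(\<Sum>i\<in>UNIV. \<Sum>j\<in>UNIV. partial i (partial j (\<lambda>y. partial i w y * partial j w y)) x)
      = (\<Sum>i\<in>UNIV. \<Sum>j\<in>UNIV. (?p i j)\<^sup>2) + (laplacian w x)\<^sup>2
        + (\<Sum>i\<in>UNIV. \<Sum>j\<in>UNIV. ?a j * ?t i j) + (\<Sum>i\<in>UNIV. \<Sum>j\<in>UNIV. ?a i * ?t j i)"
    by (simp only: sum.distrib laplacian_def power2_eq_square sum_product)
  moreover have "(\<Sum>i\<in>UNIV. \<Sum>j\<in>UNIV. ?a i * ?t j i) = (\<Sum>i\<in>UNIV. \<Sum>j\<in>UNIV. ?a j * ?t i j)"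
    by (rule sum.swap)
  ultimately show ?thesis
    using 1 by simp
qed


text \<open>
  The variance is a nonnegative quadratic form, so the parallelogram law applies.
\<close>
lemma heat_variance_add_le:
  assumes f: "f \<in> trig" and g: "g \<in> trig" and t: "0 \<le> t"
  shows "heat t (\<lambda>y. (f y + g y)\<^sup>2) x - (heat t (\<lambda>y. f y + g y) x)\<^sup>2
    \<le> 2 * (heat t (\<lambda>y. (f y)\<^sup>2) x - (heat t f x)\<^sup>2) + 2 * (heat t (\<lambda>y. (g y)\<^sup>2) x - (heat t g x)\<^sup>2)"
proof -
  note [simp] = f g trig_mult trig_add trig_diff trig_power2 trig_cmult
  have "(\<lambda>y. (f y - g y)\<^sup>2) = (\<lambda>y. (2 * (f y)\<^sup>2 + 2 * (g y)\<^sup>2) - (f y + g y)\<^sup>2)"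
    by (auto simp: power2_eq_square algebra_simps)
  then have "heat t (\<lambda>y. (f y - g y)\<^sup>2) x = heat t (\<lambda>y. (2 * (f y)\<^sup>2 + 2 * (g y)\<^sup>2) - (f y + g y)\<^sup>2) x"
    by simp
  then have "heat t (\<lambda>y. (f y - g y)\<^sup>2) x = 2 * heat t (\<lambda>y. (f y)\<^sup>2) x + 2 * heat t (\<lambda>y. (g y)\<^sup>2) x
      - heat t (\<lambda>y. (f y + g y)\<^sup>2) x"
    using t by (simp add: heat_diff heat_add heat_cmult)
  moreover have "(heat t (\<lambda>y. f y - g y) x)\<^sup>2 \<le> heat t (\<lambda>y. (f y - g y)\<^sup>2) x"
    using t by (intro heat_square_ge) auto
  ultimately show ?thesis
    using t by (simp add: heat_add heat_diff power2_eq_square algebra_simps)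
qed

text \<open>
  Twice \<open>4 + 4 n\<^sup>2\<close> from the small scales plus twice \<open>32 n\<close> from the large scales, see
  \<open>heat_variance_hessian\<close>.
\<close>
definition bmo_const :: "'n itself \<Rightarrow> real" where
  "bmo_const _ = 8 + 8 * (real CARD('n))\<^sup>2 + 64 * real CARD('n)"

text \<open>
  A localised \<open>L\<^sup>2\<close> estimate in which \<open>P\<^sub>t\<close> replaces a cutoff of width \<open>\<surd>t\<close>: in \<open>hessian_identity\<close>
  the two outer derivatives fall on \<open>P\<^sub>t\<close> and cost a factor \<open>1 / t\<close>.
\<close>
lemma heat_hessian_square_small_scale:
  fixes w :: "real^'n \<Rightarrow> real"
  assumes w: "w \<in> trig" and t: "0 < t"
    and lap: "\<And>y. \<bar>laplacian w y\<bar> \<le> L"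
    and grad: "\<And>i y. \<bar>partial i w y\<bar> \<le> G"
  shows "heat t (\<lambda>y. \<Sum>i\<in>UNIV. \<Sum>j\<in>UNIV. (partial i (partial j w) y)\<^sup>2) x
           \<le> L\<^sup>2 + 2 * (real CARD('n))\<^sup>2 * G\<^sup>2 / t"
proof -
  let ?n = "real CARD('n)"
  note [simp] = w trig_partial trig_mult trig_sum trig_add trig_diff trig_power2 trig_laplacian
  define A where "A = (\<lambda>y. \<Sum>j\<in>UNIV. (partial j w y)\<^sup>2)"
  define B where "B = (\<lambda>i j y. partial i w y * partial j w y)"
  have B: "(\<lambda>y. partial i w y * partial j w y) = B i j" for i j
    by (simp add: B_def)
  have [simp]: "A \<in> trig" "B i j \<in> trig" for i j
    by (simp_all add: A_def B_def)
  have L: "0 \<le> L" and G: "0 \<le> G" using lap[of 0] grad[of undefined 0] by linarith+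
  have G2: "\<bar>B i j y\<bar> \<le> G\<^sup>2" for i j y
    unfolding B_def abs_mult power2_eq_square using grad G by (intro mult_mono) auto
  have A: "\<bar>A y\<bar> \<le> ?n * G\<^sup>2" for y
  proof -
    have "\<bar>A y\<bar> \<le> (\<Sum>j\<in>(UNIV::'n set). G\<^sup>2)"
      unfolding A_def by (rule order_trans[OF sum_abs sum_mono])
        (use abs_le_D1[OF G2[of j j y for j]] in \<open>auto simp: power2_eq_square B_def\<close>)
    then show ?thesis by simp
  qed
  have "heat t (\<lambda>y. \<Sum>i\<in>UNIV. \<Sum>j\<in>UNIV. (partial i (partial j w) y)\<^sup>2) x
     = heat t (\<lambda>y. (laplacian w y)\<^sup>2) x + (\<Sum>i\<in>UNIV. partial i (partial i (heat t A)) x)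
      - (\<Sum>i\<in>UNIV. \<Sum>j\<in>UNIV. partial i (partial j (heat t (B i j))) x)"
    unfolding hessian_identity[OF w] A_def[symmetric] B
    using t by (simp add: heat_add heat_diff heat_sum partial_heat)
  also have "\<dots> \<le> L\<^sup>2 + ?n * (?n * G\<^sup>2 / t) + ?n * (?n * (G\<^sup>2 / t))"
  proof -
    have "heat t (\<lambda>y. (laplacian w y)\<^sup>2) x \<le> heat t (\<lambda>y. L\<^sup>2) x"
      using t lap L by (intro heat_mono) (auto simp: abs_le_square_iff[symmetric])
    then have 1: "heat t (\<lambda>y. (laplacian w y)\<^sup>2) x \<le> L\<^sup>2"
      using t by (simp add: heat_const)
    have "\<bar>partial i (partial i (heat t A)) x\<bar> \<le> ?n * G\<^sup>2 / t" for i
      using t by (intro partial2_heat_bound A) auto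
    then have 2: "(\<Sum>i\<in>UNIV. partial i (partial i (heat t A)) x) \<le> (\<Sum>i\<in>(UNIV::'n set). ?n * G\<^sup>2 / t)"
      by (intro sum_mono) (simp add: abs_le_iff)
    have "\<bar>partial i (partial j (heat t (B i j))) x\<bar> \<le> G\<^sup>2 / t" for i j
      using t by (intro partial2_heat_bound G2) auto
    then have low: "- (G\<^sup>2 / t) \<le> partial i (partial j (heat t (B i j))) x" for i j
      by (metis abs_le_iff minus_le_iff)
    have 3: "(\<Sum>i\<in>(UNIV::'n set). \<Sum>j\<in>(UNIV::'n set). - (G\<^sup>2 / t))
        \<le> (\<Sum>i\<in>UNIV. \<Sum>j\<in>UNIV. partial i (partial j (heat t (B i j))) x)"
      by (intro sum_mono low)
    have "(\<Sum>i\<in>UNIV. partial i (partial i (heat t A)) x) \<le> ?n * (?n * G\<^sup>2 / t)"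
      "- (?n * (?n * (G\<^sup>2 / t))) \<le> (\<Sum>i\<in>UNIV. \<Sum>j\<in>UNIV. partial i (partial j (heat t (B i j))) x)"
      using 2 3 by simp_all
    moreover have "a + b - c \<le> p + q + r" if "a \<le> p" "b \<le> q" "- r \<le> c" for a b c p q r :: real
      using that by linarith
    ultimately show ?thesis using 1 by blast
  qed
  finally show ?thesis
    by (simp add: power2_eq_square field_simps)
qed

text \<open>
  A bound of BMO type that holds at all heat scales at once. At scale \<open>\<surd>t\<close> the function is split into
  \<open>\<phi> - P\<^sub>t \<phi>\<close>, where the full second moment is bounded, and \<open>P\<^sub>t \<phi>\<close>, where the Hessian is Lipschitz
  with constant \<open>O(K / \<surd>t)\<close> and hence varies by \<open>O(K)\<close> over distances \<open>\<surd>t\<close>.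
\<close>
theorem heat_variance_hessian:
  fixes \<phi> :: "real^'n \<Rightarrow> real"
  assumes \<phi>: "\<phi> \<in> trig" and K: "\<And>y. \<bar>laplacian \<phi> y\<bar> \<le> K" and t: "0 < t"
  shows "heat t (\<lambda>y. (partial i (partial j \<phi>) y)\<^sup>2) x - (heat t (partial i (partial j \<phi>)) x)\<^sup>2
           \<le> bmo_const TYPE('n) * K\<^sup>2"
proof -
  let ?n = "real CARD('n)"
  have K0: "0 \<le> K" using K[of 0] by linarith
  define w where "w = (\<lambda>y. \<phi> y - heat t \<phi> y)"
  define f where "f = partial i (partial j w)"
  define g where "g = partial i (partial j (heat t \<phi>))"
  have w: "w \<in> trig" using \<phi> t by (simp add: w_def trig_diff trig_heat)
  have f: "f \<in> trig" and g: "g \<in> trig"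
    using \<phi> t w by (simp_all add: f_def g_def trig_partial trig_heat)
  have sum: "partial i (partial j \<phi>) = (\<lambda>y. f y + g y)"
    using \<phi> t by (simp add: f_def g_def w_def partial_diff trig_partial trig_heat)
  have lap: "\<bar>laplacian w y\<bar> \<le> 2 * K" for y
  proof -
    have "\<bar>heat t (laplacian \<phi>) y\<bar> \<le> K"
      using \<phi> t K by (intro heat_abs_le trig_laplacian) auto
    then show ?thesis
      using K[of y] \<phi> t by (simp add: w_def laplacian_diff trig_heat heat_laplacian abs_le_iff)
  qed
  have "heat t (\<lambda>y. (f y)\<^sup>2) x
      \<le> heat t (\<lambda>y. \<Sum>i\<in>UNIV. \<Sum>j\<in>UNIV. (partial i (partial j w) y)\<^sup>2) x"
  proof (rule heat_mono)
    fix y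
    have "(partial i (partial j w) y)\<^sup>2 \<le> (\<Sum>j\<in>UNIV. (partial i (partial j w) y)\<^sup>2)"
      by (rule member_le_sum) auto
    also have "\<dots> \<le> (\<Sum>i\<in>UNIV. \<Sum>j\<in>UNIV. (partial i (partial j w) y)\<^sup>2)"
      by (rule member_le_sum) (auto intro: sum_nonneg)
    finally show "(f y)\<^sup>2 \<le> (\<Sum>i\<in>UNIV. \<Sum>j\<in>UNIV. (partial i (partial j w) y)\<^sup>2)"
      by (simp add: f_def)
  qed (use f w t in \<open>auto intro!: trig_power2 trig_sum trig_partial\<close>)
  also have "\<dots> \<le> (2 * K)\<^sup>2 + 2 * ?n\<^sup>2 * (K * sqrt (2 * t))\<^sup>2 / t"
    using lap heat_small_time[OF \<phi> t K] by (intro heat_hessian_square_small_scale w t) (simp_all add: w_def)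
  also have "\<dots> = (4 + 4 * ?n\<^sup>2) * K\<^sup>2"
    using t by (simp add: power_mult_distrib field_simps)
  finally have 1: "heat t (\<lambda>y. (f y)\<^sup>2) x - (heat t f x)\<^sup>2 \<le> (4 + 4 * ?n\<^sup>2) * K\<^sup>2"
    using zero_le_power2[of "heat t f x"] by linarith
  have "(\<Sum>k\<in>UNIV. (partial k g y)\<^sup>2) \<le> (\<Sum>k\<in>(UNIV::'n set). (4 * K / sqrt t)\<^sup>2)" for y
    unfolding g_def using heat_third_derivative_bound[OF \<phi> t K] K0 t
    by (intro sum_mono) (simp add: abs_le_square_iff[symmetric])
  then have G: "(\<Sum>k\<in>UNIV. (partial k g y)\<^sup>2) \<le> ?n * (16 * K\<^sup>2 / t)" for y
    using t by (simp add: power_divide power_mult_distrib)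
  have "heat t (\<lambda>y. (g y)\<^sup>2) x - (heat t g x)\<^sup>2 \<le> 2 * t * (?n * (16 * K\<^sup>2 / t))"
    by (intro heat_variance_le g t G)
  also have "\<dots> = 32 * ?n * K\<^sup>2" using t by simp
  finally have 2: "heat t (\<lambda>y. (g y)\<^sup>2) x - (heat t g x)\<^sup>2 \<le> 32 * ?n * K\<^sup>2" .
  show ?thesis
    using heat_variance_add_le[OF f g, of t x] 1 2 t
    unfolding sum bmo_const_def by (simp add: algebra_simps)
qed

section \<open>Integrals of derivatives\<close>

lemma content_unit_cube: "measure lborel (unit_cube :: (real^'n) set) = 1"
  by (subst content_cbox_cart) (auto simp: interval_ne_empty_cart)

text \<open>
  Cut the translated cube along the face \<open>x\<^sub>i = 1\<close> of the original one and move the protruding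
  slab back by \<open>e\<^sub>i\<close>.
\<close>
lemma integral_cube_translate:
  fixes F :: "real^'n \<Rightarrow> real"
  assumes per: "cube_periodic F" and cont: "continuous_on UNIV F" and h: "0 \<le> h" "h \<le> 1"
  shows "integral unit_cube (\<lambda>x. F (x + h *\<^sub>R axis i 1)) = integral unit_cube F"
proof -
  let ?e = "axis i 1 :: real^'n"
  let ?lo = "(\<chi> j. if j = i then h else 1) :: real^'n"
  have int: "F integrable_on cbox a b" for a b
    by (rule integrable_continuous) (rule continuous_on_subset[OF cont], simp)
  have k: "?e \<in> Basis" by (simp add: axis_in_Basis_iff)
  have comp: "x \<bullet> ?e = x $ i" for x by (simp add: inner_axis)
  have box: "x \<in> cbox a b \<longleftrightarrow> (a $ i \<le> x $ i \<and> x $ i \<le> b $ i)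
      \<and> (\<forall>j. j \<noteq> i \<longrightarrow> a $ j \<le> x $ j \<and> x $ j \<le> b $ j)" for x a b :: "real^'n"
    unfolding mem_box_cart by metis
  have ax: "?e $ j = (if j = i then 1 else 0)" for j
    by (simp add: axis_def)
  have shift: "integral (cbox a b) (\<lambda>x. F (x + c)) = integral (cbox (a + c) (b + c)) F" for a b c
    using integral_shift_cbox_plus[of a b F c] by (simp add: o_def add.commute)
  have upper: "cbox (h *\<^sub>R ?e) (1 + h *\<^sub>R ?e) \<inter> {x. x \<bullet> ?e \<le> 1} = cbox (h *\<^sub>R ?e) 1"
    "cbox (h *\<^sub>R ?e) (1 + h *\<^sub>R ?e) \<inter> {x. 1 \<le> x \<bullet> ?e} = cbox (0 + ?e) (?lo + ?e)"
    "cbox 0 1 \<inter> {x. h \<le> x \<bullet> ?e} = cbox (h *\<^sub>R ?e) 1"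
    "cbox 0 1 \<inter> {x. x \<bullet> ?e \<le> h} = cbox 0 ?lo"
    using h by (auto simp: comp box ax)
  have "integral unit_cube (\<lambda>x. F (x + h *\<^sub>R ?e)) = integral (cbox (h *\<^sub>R ?e) (1 + h *\<^sub>R ?e)) F"
    using shift[of 0 1 "h *\<^sub>R ?e"] by simp
  also have "\<dots> = integral (cbox (h *\<^sub>R ?e) 1) F + integral (cbox (0 + ?e) (?lo + ?e)) F"
    using integral_split[OF int k, of "h *\<^sub>R ?e" "1 + h *\<^sub>R ?e" 1] unfolding upper .
  also have "integral (cbox (0 + ?e) (?lo + ?e)) F = integral (cbox 0 ?lo) F"
    using shift[of 0 ?lo ?e] per by (simp add: cube_periodic_def)
  also have "integral (cbox (h *\<^sub>R ?e) 1) F + integral (cbox 0 ?lo) F = integral unit_cube F"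
    using integral_split[OF int k, of 0 1 h] unfolding upper by simp
  finally show ?thesis .
qed

text \<open>
  The derivative at \<open>s = 0\<close> of a constant function of \<open>s\<close>, computed under the integral sign. It
  is used for periodic functions on the cube and for functions of compact support.
\<close>
lemma integral_derivative_eq_0_if_translation_invariant:
  fixes F F' :: "real^'n \<Rightarrow> real"
  assumes cont: "continuous_on UNIV F" "continuous_on UNIV F'"
    and deriv: "\<And>x s. ((\<lambda>s. F (x + s *\<^sub>R axis i 1)) has_real_derivative F' (x + s *\<^sub>R axis i 1)) (at s)"
    and invariant: "\<And>s. s \<in> {0..1} \<Longrightarrow> integral (cbox a b) (\<lambda>x. F (x + s *\<^sub>R axis i 1)) = I"
  shows "integral (cbox a b) F' = 0"
proof -
  let ?J = "\<lambda>s. integral (cbox a b) (\<lambda>x. F (x + s *\<^sub>R axis i 1))"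
  have c: "continuous_on S (\<lambda>x. F (x + s *\<^sub>R axis i 1))" for S s
    by (rule continuous_on_compose2[OF cont(1)]) (auto intro!: continuous_intros)
  have "(?J has_field_derivative integral (cbox a b) (\<lambda>x. F' (x + 0 *\<^sub>R axis i 1))) (at 0 within {0..1})"
  proof (rule leibniz_rule_field_derivative)
    show "continuous_on ({0..1} \<times> cbox a b) (\<lambda>(s, x). F' (x + s *\<^sub>R axis i 1))"
      unfolding split_beta by (rule continuous_on_compose2[OF cont(2)]) (auto intro!: continuous_intros)
    show "(\<lambda>x. F (x + s *\<^sub>R axis i 1)) integrable_on cbox a b" for s
      by (intro integrable_continuous c)
    show "((\<lambda>s. F (x + s *\<^sub>R axis i 1)) has_real_derivative F' (x + s *\<^sub>R axis i 1)) (at s within {0..1})" for s x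
      using deriv by (rule has_field_derivative_at_within)
  qed auto
  then have 1: "(?J has_vector_derivative integral (cbox a b) F') (at 0 within cbox 0 1)"
    by (simp add: has_real_derivative_iff_has_vector_derivative)
  have "((\<lambda>s. I) has_vector_derivative 0) (at 0 within cbox (0::real) 1)"
    by (rule has_vector_derivative_const)
  then have "(?J has_vector_derivative 0) (at 0 within cbox 0 1)"
    by (rule has_vector_derivative_transform[rotated 2]) (auto simp: invariant)
  then show ?thesis
    by (rule vector_derivative_unique_within_closed_interval[OF _ _ 1, of 0, rotated 2]) auto
qed

lemma integral_cube_derivative_eq_0:
  fixes F F' :: "real^'n \<Rightarrow> real"
  assumes "cube_periodic F" "continuous_on UNIV F" "continuous_on UNIV F'"
    and "\<And>x s. ((\<lambda>s. F (x + s *\<^sub>R axis i 1)) has_real_derivative F' (x + s *\<^sub>R axis i 1)) (at s)"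
  shows "integral unit_cube F' = 0"
  by (rule integral_derivative_eq_0_if_translation_invariant[OF assms(2-4), of _ _ "integral unit_cube F"])
    (auto intro: integral_cube_translate assms)

section \<open>Exponential integrability of second derivatives\<close>

text \<open>
  For \<open>U(m, V) = exp (c m) g(V)\<close> this is the form \<open>(2 U\<^sub>V - U\<^sub>m\<^sub>m) a\<^sup>2 - 2 U\<^sub>m\<^sub>V a b - U\<^sub>V\<^sub>V b\<^sup>2\<close>, up to
  the factor \<open>exp (c m)\<close>. The concavity of \<open>g\<close> pays for the mixed term.
\<close>
lemma bellman_quadratic_form:
  fixes a b V \<beta> c :: real
  assumes \<beta>: "0 < \<beta>" and c: "c = 1 / (2 * sqrt \<beta>)" and V: "0 \<le> V" "V \<le> \<beta>"
  defines "g \<equiv> 1 + 4 * (V / \<beta>) - (V / \<beta>)\<^sup>2" and "g' \<equiv> (4 - 2 * (V / \<beta>)) / \<beta>"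
  shows "0 \<le> 2 * g' * a\<^sup>2 - c\<^sup>2 * g * a\<^sup>2 - 2 * c * g' * a * b + 2 / \<beta>\<^sup>2 * b\<^sup>2"
proof -
  define v where "v = V / \<beta>"
  define p q where "p = a / sqrt \<beta>" and "q = b / \<beta>"
  have v: "0 \<le> v" "v \<le> 1" using V \<beta> by (auto simp: v_def)
  have a: "a = p * sqrt \<beta>" and b: "b = q * \<beta>" using \<beta> by (auto simp: p_def q_def)
  have "2 * g' * a\<^sup>2 - c\<^sup>2 * g * a\<^sup>2 - 2 * c * g' * a * b + 2 / \<beta>\<^sup>2 * b\<^sup>2
      = 2 * (4 - 2 * v) * p\<^sup>2 - (1 + 4 * v - v\<^sup>2) / 4 * p\<^sup>2 - (4 - 2 * v) * (p * q) + 2 * q\<^sup>2"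
    using \<beta> unfolding g_def g'_def c a b v_def[symmetric]
    by (simp add: power_mult_distrib power_divide field_simps) 
  also have "\<dots> = 2 * (q - (2 - v) / 2 * p)\<^sup>2
      + (8 - 4 * v - (1 + 4 * v - v\<^sup>2) / 4 - (2 - v)\<^sup>2 / 2) * p\<^sup>2"
    by (simp add: power2_eq_square field_simps)
  also have "\<dots> \<ge> 0"
  proof (intro add_nonneg_nonneg mult_nonneg_nonneg)
    have "8 - 4 * v - (1 + 4 * v - v\<^sup>2) / 4 - (2 - v)\<^sup>2 / 2 = 23 / 4 - 3 * v - v\<^sup>2 / 4"
      by (simp add: power2_eq_square field_simps)
    moreover have "v\<^sup>2 \<le> 1" using v by (simp add: power_le_one)
    ultimately show "0 \<le> 8 - 4 * v - (1 + 4 * v - v\<^sup>2) / 4 - (2 - v)\<^sup>2 / 2"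
      using v by linarith
  qed auto
  finally show ?thesis .
qed

text \<open>
  A John--Nirenberg inequality. Along the heat flow let \<open>m\<close> be the mean \<open>P\<^sub>t h\<close> and \<open>V\<close> the variance;
  they satisfy \<open>\<partial>\<^sub>t m = \<Delta>m\<close> and \<open>\<partial>\<^sub>t V = \<Delta>V + 2 |\<nabla>m|\<^sup>2\<close>. For \<open>U = exp (c m) g(V)\<close> the expression
  \<open>\<partial>\<^sub>t U - \<Delta>U\<close> is a sum of the forms of \<open>bellman_quadratic_form\<close>, hence nonnegative, so \<open>\<integral> U\<close> does
  not decrease in time. It starts from \<open>\<integral> exp (c h)\<close>, as \<open>V = 0\<close> at time \<open>0\<close>, and at late times \<open>m\<close>
  is close to \<open>0\<close> because \<open>h\<close> is a derivative.
\<close>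
lemma exp_integral_le_of_heat_variance:
  fixes q :: "real^'n \<Rightarrow> real"
  assumes q: "q \<in> trig" and \<beta>: "0 < \<beta>"
    and var: "\<And>t x. 0 < t \<Longrightarrow>
      heat t (\<lambda>y. (partial k q y)\<^sup>2) x - (heat t (partial k q) x)\<^sup>2 \<le> \<beta>"
  shows "integral unit_cube (\<lambda>x. exp (partial k q x / (2 * sqrt \<beta>))) \<le> 8"
proof -
  define h where "h = partial k q"
  define c where "c = 1 / (2 * sqrt \<beta>)"
  have c: "0 < c" using \<beta> by (simp add: c_def)
  have h: "h \<in> trig" using q by (simp add: h_def trig_partial)
  note [simp] = h trig_partial trig_mult trig_sum trig_add trig_diff trig_power2 trig_laplacian trig_heat
  define m where "m t = heat t h" for t
  define V where "V t = (\<lambda>x. heat t (\<lambda>y. (h y)\<^sup>2) x - (m t x)\<^sup>2)" for t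
  have m: "m t \<in> trig" and Vt: "V t \<in> trig" if "0 \<le> t" for t
    using that by (simp_all add: m_def V_def)
  have V0: "0 \<le> V t x" if "0 \<le> t" for t x
    using heat_square_ge[OF h that, of x] by (simp add: V_def m_def)
  have V1: "V t x \<le> \<beta>" if "0 \<le> t" for t x
    using var[of t x] that \<beta> by (cases "t = 0") (auto simp: V_def m_def h_def[symmetric] heat_0)
  \<comment> \<open>Between \<open>0\<close> and \<open>\<beta>\<close> this function increases from \<open>1\<close> to \<open>4\<close> and is uniformly concave.\<close>
  define g where "g v = 1 + 4 * (v / \<beta>) - (v / \<beta>)\<^sup>2" for v
  define g' where "g' v = (4 - 2 * (v / \<beta>)) / \<beta>" for v
  have dg: "(g has_real_derivative g' v) (at v)" for v
    unfolding g_def g'_def using \<beta> by (auto intro!: derivative_eq_intros simp: power2_eq_square field_simps)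
  have dg': "(g' has_real_derivative - 2 / \<beta>\<^sup>2) (at v)" for v
    unfolding g'_def using \<beta> by (auto intro!: derivative_eq_intros simp: power2_eq_square field_simps)
  have contg: "continuous_on S g" "continuous_on S g'" for S
    using \<beta> by (auto simp: g_def g'_def intro!: continuous_intros)
  define U where "U t x = exp (c * m t x) * g (V t x)" for t x
  define U' where "U' t x = exp (c * m t x) * (c * laplacian (m t) x * g (V t x)
      + g' (V t x) * (heat t (laplacian (\<lambda>y. (h y)\<^sup>2)) x - 2 * m t x * laplacian (m t) x))" for t x
  have contm: "continuous_on ({0..} \<times> UNIV) (\<lambda>(t, x). m t x)"
    unfolding m_def by (rule heat_continuous) simp
  have contV: "continuous_on ({0..} \<times> UNIV) (\<lambda>(t, x). V t x)"
    unfolding V_def split_beta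
    by (intro continuous_intros heat_continuous[unfolded split_beta] contm[unfolded split_beta]) simp
  have contL: "continuous_on ({0..} \<times> UNIV) (\<lambda>(t, x). laplacian (m t) x)"
    by (rule continuous_on_eq[OF heat_continuous[of "laplacian h"]])
      (auto simp: m_def heat_laplacian)
  have contU: "continuous_on ({0..} \<times> UNIV) (\<lambda>(t, x). U t x)"
    unfolding U_def split_beta
    by (intro continuous_intros contm[unfolded split_beta]
        continuous_on_compose2[OF contg(1)] contV[unfolded split_beta]) auto
  have contU': "continuous_on ({0..} \<times> UNIV) (\<lambda>(t, x). U' t x)"
    unfolding U'_def split_beta
    by (intro continuous_intros contm[unfolded split_beta] contL[unfolded split_beta]
        heat_continuous[unfolded split_beta]
        continuous_on_compose2[OF contg(1)] continuous_on_compose2[OF contg(2)]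
        contV[unfolded split_beta]) auto
  have dU: "((\<lambda>t. U t x) has_real_derivative U' t x) (at t)" if t: "0 < t" for t x
  proof -
    have dm: "((\<lambda>t. m t x) has_real_derivative laplacian (m t) x) (at t)"
      using heat_equation[OF h t, of x] t by (simp add: m_def heat_laplacian)
    have dV: "((\<lambda>t. V t x) has_real_derivative
        heat t (laplacian (\<lambda>y. (h y)\<^sup>2)) x - 2 * m t x * laplacian (m t) x) (at t)"
      unfolding V_def
      by (rule derivative_eq_intros heat_equation dm t refl | simp)+
    show ?thesis
      unfolding U_def U'_def
      by (rule derivative_eq_intros DERIV_chain2[OF dg dV] dm refl)+ (simp add: algebra_simps)
  qed
  \<comment> \<open>\<open>W t i\<close> is the \<open>i\<close>-th partial derivative of \<open>U t\<close>, and \<open>W' t i\<close> that of \<open>W t i\<close>.\<close>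
  define W where "W t i x = exp (c * m t x) * (c * partial i (m t) x * g (V t x)
      + g' (V t x) * partial i (V t) x)" for t i x
  define W' where "W' t i x = exp (c * m t x) *
     (c\<^sup>2 * g (V t x) * (partial i (m t) x)\<^sup>2 + 2 * c * g' (V t x) * partial i (m t) x * partial i (V t) x
      - 2 / \<beta>\<^sup>2 * (partial i (V t) x)\<^sup>2
      + c * partial i (partial i (m t)) x * g (V t x) + g' (V t x) * partial i (partial i (V t)) x)" for t i x
  have intW: "integral unit_cube (W' t i) = 0" "W' t i integrable_on unit_cube" if t: "0 \<le> t" for t i
  proof (rule integral_cube_derivative_eq_0[of "W t i" _ i])
    note [simp] = m[OF t] Vt[OF t]
    show "cube_periodic (W t i)"
      using trig_periodic[OF m[OF t]] trig_periodic[OF Vt[OF t]]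
        trig_periodic[OF trig_partial[OF m[OF t]]] trig_periodic[OF trig_partial[OF Vt[OF t]]]
      unfolding cube_periodic_def W_def by simp
    note cont = trig_continuous[of "m t" UNIV] trig_continuous[of "partial j (m t)" UNIV for j]
      trig_continuous[of "partial j (partial j (m t))" UNIV for j]
      trig_continuous[of "partial j (V t)" UNIV for j]
      trig_continuous[of "partial j (partial j (V t))" UNIV for j]
      continuous_on_compose2[OF contg(1)[of UNIV] trig_continuous[OF Vt[OF t], of UNIV]]
      continuous_on_compose2[OF contg(2)[of UNIV] trig_continuous[OF Vt[OF t], of UNIV]]
    show "continuous_on UNIV (W t i)"
      unfolding W_def by (intro continuous_intros cont) simp_all
    show cW': "continuous_on UNIV (W' t i)"
      unfolding W'_def by (intro continuous_intros cont) simp_all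
    show "W' t i integrable_on unit_cube"
      by (intro integrable_continuous continuous_on_subset[OF cW']) simp
    fix x :: "real^'n" and s :: real
    let ?y = "\<lambda>s::real. x + s *\<^sub>R axis i 1"
    show "((\<lambda>s. W t i (?y s)) has_real_derivative W' t i (?y s)) (at s)"
      unfolding W_def W'_def
      by (rule derivative_eq_intros refl trig_DERIV DERIV_chain2[OF dg trig_DERIV]
          DERIV_chain2[OF dg' trig_DERIV] | simp)+
        (simp add: algebra_simps power2_eq_square)
  qed
  have main: "(\<Sum>i\<in>UNIV. W' t i x) \<le> U' t x" if t: "0 \<le> t" for t x
  proof -
    note [simp] = m[OF t] Vt[OF t]
    have VV: "partial i (partial i (V t)) x = partial i (partial i (heat t (\<lambda>y. (h y)\<^sup>2))) x
        - 2 * (partial i (m t) x)\<^sup>2 - 2 * m t x * partial i (partial i (m t)) x" for i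
      using t by (simp add: V_def power2_eq_square partial_diff partial_mult partial_add trig_mult partial_const)
    let ?Q = "\<lambda>i. 2 * g' (V t x) * (partial i (m t) x)\<^sup>2 - c\<^sup>2 * g (V t x) * (partial i (m t) x)\<^sup>2
        - 2 * c * g' (V t x) * partial i (m t) x * partial i (V t) x + 2 / \<beta>\<^sup>2 * (partial i (V t) x)\<^sup>2"
    have Q: "0 \<le> ?Q i" for i
      unfolding g_def g'_def
      by (rule bellman_quadratic_form[OF \<beta> c_def V0[OF t] V1[OF t]])
    have "U' t x - (\<Sum>i\<in>UNIV. W' t i x) = exp (c * m t x) * (\<Sum>i\<in>UNIV. ?Q i)"
    proof -
      have "U' t x = (\<Sum>i\<in>UNIV. exp (c * m t x) * (c * partial i (partial i (m t)) x * g (V t x)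
        + g' (V t x) * (partial i (partial i (heat t (\<lambda>y. (h y)\<^sup>2))) x
            - 2 * m t x * partial i (partial i (m t)) x)))"
        using t by (simp add: U'_def heat_laplacian laplacian_def sum.distrib sum_subtractf
            flip: sum_distrib_left sum_distrib_right)
      then show ?thesis
        unfolding W'_def VV sum_distrib_left
        by (simp only: sum_subtractf[symmetric]) (rule sum.cong; simp add: algebra_simps)
    qed
    moreover have "0 \<le> exp (c * m t x) * (\<Sum>i\<in>UNIV. ?Q i)"
      by (intro mult_nonneg_nonneg sum_nonneg Q) auto
    ultimately show ?thesis by linarith
  qed
  define I where "I t = integral unit_cube (U t)" for t
  have sub: "{0..T} \<times> unit_cube \<subseteq> {0..} \<times> UNIV" for T :: real by auto
  have contUt: "continuous_on S (U t)" "continuous_on S (U' t)" if "0 \<le> t" for t S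
  proof -
    have *: "continuous_on S (\<lambda>x. (t, x))" "(\<lambda>x. (t, x)) ` S \<subseteq> {0..} \<times> UNIV"
      using that by (auto intro!: continuous_intros)
    show "continuous_on S (U t)" using continuous_on_compose2[OF contU *] by simp
    show "continuous_on S (U' t)" using continuous_on_compose2[OF contU' *] by simp
  qed
  have mono: "I 0 \<le> I T" if "0 \<le> T" for T
  proof (rule DERIV_nonneg_imp_increasing_open[OF that])
    show "continuous_on {0..T} I"
      unfolding I_def
      by (rule integral_continuous_on_param) (rule continuous_on_subset[OF contU sub])
    fix t assume "0 < t" "t < T"
    then have t: "0 \<le> t" "t \<in> {0<..}" by auto
    have "((\<lambda>t. integral unit_cube (U t)) has_field_derivative integral unit_cube (U' t)) (at t within {0<..})"
    proof (rule leibniz_rule_field_derivative[OF _ _ _ t(2)])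
      show "continuous_on ({0<..} \<times> unit_cube) (\<lambda>(t, x). U' t x)"
        by (rule continuous_on_subset[OF contU']) auto
      show "((\<lambda>t. U t x) has_real_derivative U' t x) (at t within {0<..})" if "t \<in> {0<..}" for t x
        using that dU[of t x] by (auto intro: has_field_derivative_at_within)
      show "U t integrable_on unit_cube" if "t \<in> {0<..}" for t
        using that by (intro integrable_continuous contUt) auto
    qed auto
    then have "(I has_field_derivative integral unit_cube (U' t)) (at t)"
      using t(2) by (simp add: I_def[abs_def] at_within_open[of t "{0<..}"])
    moreover have "0 \<le> integral unit_cube (U' t)"
    proof -
      note contW' = intW(2)[OF t(1)]
      have "integral unit_cube (\<lambda>x. \<Sum>i\<in>UNIV. W' t i x) \<le> integral unit_cube (U' t)"
        by (intro integral_le integrable_sum contW' integrable_continuous contUt t main) auto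
      then show ?thesis
        using t by (simp add: integral_sum contW' intW)
    qed
    ultimately show "\<exists>y. (I has_real_derivative y) (at t) \<and> 0 \<le> y" by blast
  qed
  obtain B where B: "B > 0" "\<And>y. \<bar>q y\<bar> \<le> B" using trig_bounded[OF q] by blast
  \<comment> \<open>A time so late that \<open>exp (c m) \<le> 2\<close>; together with \<open>g \<le> 4\<close> this yields the bound \<open>8\<close>.\<close>
  define T where "T = (c * B / ln 2)\<^sup>2"
  have T: "0 < T" using B c by (simp add: T_def)
  have mT: "c * m T x \<le> ln 2" for x
  proof -
    have "\<bar>m T x\<bar> \<le> B / sqrt (2 * T)"
      using partial_heat_bound[OF q T B(2), of k x] T q by (simp add: m_def h_def partial_heat)
    also have "\<dots> \<le> B / sqrt T" using B T by (intro divide_left_mono) auto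
    also have "\<dots> = ln 2 / c" using B c by (simp add: T_def)
    finally show ?thesis using c by (simp add: field_simps abs_le_iff)
  qed
  have "U T x \<le> 8" for x
  proof -
    have v: "0 \<le> V T x / \<beta>" "V T x / \<beta> \<le> 1"
      using V0[of T x] V1[of T x] T \<beta> by auto
    have "(V T x / \<beta> - 1) * (V T x / \<beta> - 3) \<ge> 0" using v by (intro mult_nonpos_nonpos) auto
    then have "g (V T x) \<le> 4" by (simp add: g_def power2_eq_square algebra_simps)
    moreover have "0 \<le> g (V T x)"
      using mult_left_mono[OF v(2) v(1)] v by (simp add: g_def power2_eq_square)
    moreover have "exp (c * m T x) \<le> 2"
      using mT[of x] by (metis exp_le_cancel_iff exp_ln zero_less_numeral)
    ultimately show ?thesis
      using mult_mono[of "exp (c * m T x)" 2 "g (V T x)" 4] by (simp add: U_def)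
  qed
  then have "I T \<le> integral unit_cube (\<lambda>x::real^'n. 8)"
    unfolding I_def using T by (intro integral_le integrable_continuous contUt) auto
  also have "\<dots> = 8" by (simp add: content_unit_cube)
  finally have "I 0 \<le> 8" using mono[of T] T by linarith
  moreover have "U 0 = (\<lambda>x. exp (h x / (2 * sqrt \<beta>)))"
    by (auto simp: fun_eq_iff U_def V_def m_def heat_0 g_def c_def)
  ultimately show ?thesis
    by (simp add: I_def h_def)
qed


text \<open>
  The previous lemma for \<open>h\<close> and for \<open>- h\<close>.
\<close>
lemma exp_abs_hessian_integral_le:
  fixes \<phi> :: "real^'n \<Rightarrow> real"
  assumes \<phi>: "\<phi> \<in> trig" and K: "0 < K" "\<And>y. \<bar>laplacian \<phi> y\<bar> \<le> K"
  shows "integral unit_cube (\<lambda>x. exp (\<bar>partial i (partial j \<phi>) x\<bar> / (2 * sqrt (bmo_const TYPE('n)) * K))) \<le> 16"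
proof -
  have b: "0 < bmo_const TYPE('n)"
    by (simp add: bmo_const_def add_pos_nonneg)
  let ?\<beta> = "bmo_const TYPE('n) * K\<^sup>2"
  let ?h = "partial i (partial j \<phi>)"
  have \<beta>: "0 < ?\<beta>" using b K by simp
  have sq: "2 * sqrt ?\<beta> = 2 * sqrt (bmo_const TYPE('n)) * K"
    using K by (simp add: real_sqrt_mult)
  have h: "?h \<in> trig" using \<phi> by (simp add: trig_partial)
  have pos: "integral unit_cube (\<lambda>x. exp (?h x / (2 * sqrt ?\<beta>))) \<le> 8"
    using heat_variance_hessian[OF \<phi> K(2)] \<phi> \<beta>
    by (intro exp_integral_le_of_heat_variance trig_partial) auto
  have neg: "integral unit_cube (\<lambda>x. exp (partial i (\<lambda>y. - partial j \<phi> y) x / (2 * sqrt ?\<beta>))) \<le> 8"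
  proof (rule exp_integral_le_of_heat_variance)
    show "heat t (\<lambda>y. (partial i (\<lambda>y. - partial j \<phi> y) y)\<^sup>2) x
        - (heat t (partial i (\<lambda>y. - partial j \<phi> y)) x)\<^sup>2 \<le> ?\<beta>" if "0 < t" for t x
      using heat_variance_hessian[OF \<phi> K(2) that, of i j x] \<phi> that
      by (simp add: partial_minus trig_partial heat_minus)
  qed (use \<phi> \<beta> in \<open>auto intro: trig_minus trig_partial\<close>)
  have cont: "continuous_on unit_cube (\<lambda>x. exp (?h x / d))" "continuous_on unit_cube (\<lambda>x. exp (- ?h x / d))"
      "continuous_on unit_cube (\<lambda>x. exp (\<bar>?h x\<bar> / d))" if "d > 0" for d
    using that by (auto intro!: continuous_intros trig_continuous[OF h])
  let ?d = "2 * sqrt ?\<beta>"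
  have d: "?d > 0" using \<beta> by simp
  have "integral unit_cube (\<lambda>x. exp (\<bar>?h x\<bar> / ?d))
      \<le> integral unit_cube (\<lambda>x. exp (?h x / ?d) + exp (- ?h x / ?d))"
    by (intro integral_le integrable_continuous continuous_on_add cont d) (auto simp: abs_if)
  also have "\<dots> = integral unit_cube (\<lambda>x. exp (?h x / ?d)) + integral unit_cube (\<lambda>x. exp (- ?h x / ?d))"
    by (intro integral_add integrable_continuous cont d)
  also have "\<dots> \<le> 16"
    using pos neg \<phi> by (simp add: partial_minus trig_partial)
  finally show ?thesis unfolding sq .
qed

section \<open>Second derivatives on small sets\<close>

abbreviation cube_measure :: "(real^'n) measure" where
  "cube_measure \<equiv> lebesgue_on unit_cube"

lemma prob_space_cube_measure: "prob_space (cube_measure :: (real^'n) measure)"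
proof
  have "emeasure lebesgue (unit_cube :: (real^'n) set) = ennreal (measure lborel (unit_cube :: (real^'n) set))"
    using emeasure_eq_ennreal_measure[of lborel "unit_cube :: (real^'n) set"] emeasure_lborel_cbox_finite[of 0 "1 :: real^'n"]
    by simp
  then show "emeasure (cube_measure :: (real^'n) measure) (space cube_measure) = 1"
    by (simp add: emeasure_restrict_space content_unit_cube)
qed

interpretation cube: prob_space "cube_measure :: (real^'n) measure"
  by (rule prob_space_cube_measure)

lemma set_integral_cube:
  fixes f :: "real^'n \<Rightarrow> real"
  shows "(LINT x:unit_cube|lebesgue. f x) = (LINT x|cube_measure. f x)"
  by (simp add: set_lebesgue_integral_def integral_restrict_space)

lemma continuous_cube_measurable:
  fixes f :: "real^'n \<Rightarrow> real"
  assumes "continuous_on UNIV f"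
  shows "f \<in> borel_measurable cube_measure"
  using borel_measurable_continuous_onI[OF assms]
  by (intro measurable_restrict_space1 measurable_completion) simp

lemma continuous_cube_integrable:
  fixes f :: "real^'n \<Rightarrow> real"
  assumes "continuous_on UNIV f"
  shows "integrable cube_measure f"
proof -
  have "compact (f ` unit_cube)"
    by (rule compact_continuous_image) (auto intro: continuous_on_subset[OF assms])
  then have "bounded (f ` unit_cube)" by (rule compact_imp_bounded)
  then obtain B where "\<And>x. x \<in> unit_cube \<Longrightarrow> norm (f x) \<le> B"
    unfolding bounded_iff by auto
  then show ?thesis
    by (intro cube.integrable_const_bound[of _ B] AE_I2 continuous_cube_measurable assms)
      (auto simp: space_restrict_space)
qed

lemma integral_cube_continuous:
  fixes f :: "real^'n \<Rightarrow> real"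
  assumes "continuous_on UNIV f"
  shows "(LINT x|cube_measure. f x) = integral unit_cube f"
  using continuous_cube_integrable[OF assms]
  by (intro lebesgue_integral_eq_integral) (auto simp: integrable_on_lebesgue_on)

text \<open>
  If \<open>z > 2 L\<close>, then \<open>exp (z / 2) \<le> exp (z - L)\<close>, and \<open>z\<^sup>2 \<le> 8 exp (z / 2)\<close> always holds.
\<close>
lemma square_le_exp:
  fixes z L :: real
  assumes "0 \<le> z" "0 \<le> L"
  shows "z\<^sup>2 \<le> 4 * L\<^sup>2 + 8 * exp z * exp (- L)"
proof (cases "z \<le> 2 * L")
  case True
  then have "z\<^sup>2 \<le> (2 * L)\<^sup>2" using assms by (intro power_mono)
  then show ?thesis by (simp add: power_mult_distrib add_increasing2)
next
  case False
  have "1 + z / 2 + (z / 2)\<^sup>2 / 2 \<le> exp (z / 2)"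
    using assms exp_lower_Taylor_quadratic by simp
  then have "z\<^sup>2 \<le> 8 * exp (z / 2)"
    using assms by (simp add: power_divide)
  also have "\<dots> \<le> 8 * exp (z - L)" using False by simp
  also have "8 * exp (z - L) = 8 * exp z * exp (- L)" by (simp add: exp_diff exp_minus divide_inverse)
  finally show ?thesis using zero_le_power2[of L] by linarith
qed

definition log_modulus :: "real \<Rightarrow> real" where
  "log_modulus e = e * (1 - ln e)\<^sup>2"

text \<open>
  Apply \<open>square_le_exp\<close> to \<open>z = |h| / d\<close> with \<open>L = 1 - ln |E|\<close>: the first term integrates to
  \<open>4 L\<^sup>2 |E|\<close>, and the factor \<open>exp (- L) \<le> |E|\<close> makes up for extending the integral of the second
  one to the whole cube.
\<close>
lemma set_integral_square_le_log_modulus: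
  fixes h :: "real^'n \<Rightarrow> real"
  assumes cont: "continuous_on UNIV h" and d: "0 < d"
    and exp: "integral unit_cube (\<lambda>x. exp (\<bar>h x\<bar> / d)) \<le> 16"
    and E: "E \<in> sets cube_measure"
  shows "(LINT x|cube_measure. indicator E x * (h x)\<^sup>2) \<le> 132 * d\<^sup>2 * log_modulus (measure cube_measure E)"
proof (cases "measure cube_measure E = 0")
  case True
  then have "AE x in cube_measure. x \<notin> E"
    by (intro AE_not_in) (use E in \<open>auto simp: null_sets_def cube.emeasure_eq_measure\<close>)
  then have "(LINT x|cube_measure. indicator E x * (h x)\<^sup>2) = (LINT x|(cube_measure :: (real^'n) measure). 0)"
    using borel_measurable_times[OF borel_measurable_indicator[OF E] continuous_cube_measurable[of "\<lambda>x. (h x)\<^sup>2"]] cont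
    by (intro integral_cong_AE) (auto intro!: continuous_intros)
  then show ?thesis using True by (simp add: log_modulus_def)
next
  case False
  define e where "e = measure cube_measure E"
  define L where "L = 1 - ln e"
  have e: "0 < e" "e \<le> 1"
    using False by (auto simp: e_def zero_less_measure_iff)
  then have L: "1 \<le> L" by (simp add: L_def)
  have "exp (- L) = e * exp (- 1)" using e by (simp add: L_def exp_diff exp_minus divide_inverse)
  also have "\<dots> \<le> e" using e by simp
  finally have eL: "exp (- L) \<le> e" .
  have pw: "indicator E x * (h x)\<^sup>2 \<le> d\<^sup>2 * (4 * L\<^sup>2 * indicator E x + 8 * e * exp (\<bar>h x\<bar> / d))" for x
  proof -
    have "(h x)\<^sup>2 = d\<^sup>2 * (\<bar>h x\<bar> / d)\<^sup>2" using d by (simp add: power_divide)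
    also have "\<dots> \<le> d\<^sup>2 * (4 * L\<^sup>2 + 8 * exp (\<bar>h x\<bar> / d) * exp (- L))"
      using L d by (intro mult_left_mono square_le_exp) auto
    also have "\<dots> \<le> d\<^sup>2 * (4 * L\<^sup>2 + 8 * exp (\<bar>h x\<bar> / d) * e)"
      using eL by (intro mult_left_mono add_left_mono) auto
    finally show ?thesis using e by (auto simp: indicator_def mult_ac)
  qed
  have c: "continuous_on UNIV (\<lambda>x. exp (\<bar>h x\<bar> / d))" "continuous_on UNIV (\<lambda>x. (h x)\<^sup>2)"
    using d by (auto intro!: continuous_intros cont)
  have iE: "integrable cube_measure (indicator E :: _ \<Rightarrow> real)"
    using E by (intro integrable_real_indicator) (auto simp: cube.emeasure_eq_measure)
  have E_sub: "E \<inter> unit_cube = E"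
    using sets.sets_into_space[OF E] by (auto simp: space_restrict_space)
  have i1: "integrable cube_measure (\<lambda>x. indicator E x * (h x)\<^sup>2)"
    using integrable_mult_indicator[OF E continuous_cube_integrable[OF c(2)]] by simp
  have i2: "integrable cube_measure (\<lambda>x. d\<^sup>2 * (4 * L\<^sup>2 * indicator E x + 8 * e * exp (\<bar>h x\<bar> / d)))"
    using iE continuous_cube_integrable[OF c(1)] by simp
  have "(LINT x|cube_measure. indicator E x * (h x)\<^sup>2)
      \<le> (LINT x|cube_measure. d\<^sup>2 * (4 * L\<^sup>2 * indicator E x + 8 * e * exp (\<bar>h x\<bar> / d)))"
    by (intro integral_mono pw i1 i2)
  also have "\<dots> = d\<^sup>2 * (4 * L\<^sup>2 * e + 8 * e * integral unit_cube (\<lambda>x. exp (\<bar>h x\<bar> / d)))"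
    using E iE c continuous_cube_integrable[OF c(1)] E_sub
    by (simp add: integral_cube_continuous e_def Bochner_Integration.integral_add)
  also have "\<dots> \<le> d\<^sup>2 * (4 * L\<^sup>2 * e + 8 * e * 16)"
    using exp e by (intro mult_left_mono add_left_mono) auto
  also have "\<dots> \<le> d\<^sup>2 * (4 * L\<^sup>2 * e + 8 * e * (16 * L\<^sup>2))"
    using e L by (intro mult_left_mono add_left_mono) auto
  finally show ?thesis
    by (simp add: e_def[symmetric] log_modulus_def L_def[symmetric] algebra_simps)
qed

definition hessian_const :: "'n itself \<Rightarrow> real" where
  "hessian_const _ = 528 * bmo_const TYPE('n)"

text \<open>
  Exponential integrability at height proportional to \<open>K\<close>, read off on a set of given measure.
  The logarithm is the price for \<open>p = \<infinity>\<close>: for bounded \<open>\<Delta>\<phi>\<close> the Hessian itself need not be bounded.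
\<close>
theorem hessian_set_integral_le:
  fixes \<phi> :: "real^'n \<Rightarrow> real"
  assumes \<phi>: "\<phi> \<in> trig" and K: "0 < K" "\<And>y. \<bar>laplacian \<phi> y\<bar> \<le> K" and E: "E \<in> sets cube_measure"
  shows "(LINT x|cube_measure. indicator E x * (partial i (partial j \<phi>) x)\<^sup>2)
           \<le> hessian_const TYPE('n) * K\<^sup>2 * log_modulus (measure cube_measure E)"
proof -
  have b: "0 < bmo_const TYPE('n)"
    by (simp add: bmo_const_def add_pos_nonneg)
  let ?d = "2 * sqrt (bmo_const TYPE('n)) * K"
  have "(LINT x|cube_measure. indicator E x * (partial i (partial j \<phi>) x)\<^sup>2)
      \<le> 132 * ?d\<^sup>2 * log_modulus (measure cube_measure E)"
    using \<phi> K b E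
    by (intro set_integral_square_le_log_modulus exp_abs_hessian_integral_le trig_continuous trig_partial) auto
  also have "132 * ?d\<^sup>2 = hessian_const TYPE('n) * K\<^sup>2"
    using b by (simp add: hessian_const_def power_mult_distrib)
  finally show ?thesis .
qed

lemma log_modulus_nonneg: "0 \<le> e \<Longrightarrow> 0 \<le> log_modulus e"
  by (simp add: log_modulus_def)

text \<open>
  In terms of \<open>y = - ln e\<close> this is \<open>(1 + y)\<^sup>2 \<le> 4 (1 + y / 2)\<^sup>2 \<le> 4 exp y\<close>.
\<close>
lemma log_modulus_le_4:
  assumes "0 \<le> e" "e \<le> 1"
  shows "log_modulus e \<le> 4"
proof (cases "e = 0")
  case False
  define y where "y = - ln e"
  have y: "0 \<le> y" "e = exp (- y)" using assms False by (auto simp: y_def)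
  have "(1 + y)\<^sup>2 \<le> (2 * (1 + y / 2))\<^sup>2" using y by (intro power_mono) auto
  also have "\<dots> = 4 * (1 + y / 2)\<^sup>2" by (simp only: power_mult_distrib) simp
  also have "\<dots> \<le> 4 * (exp (y / 2))\<^sup>2"
    using y by (intro mult_left_mono power_mono exp_ge_add_one_self) auto
  also have "\<dots> = 4 * exp y" by (simp add: power2_eq_square mult_exp_exp)
  finally have "exp (- y) * (1 + y)\<^sup>2 \<le> exp (- y) * (4 * exp y)" by (intro mult_left_mono) auto
  moreover have "log_modulus e = exp (- y) * (1 + y)\<^sup>2"
    unfolding log_modulus_def y_def using assms False by simp
  moreover have "exp (- y) * (4 * exp y) = 4" by (simp add: exp_minus)
  ultimately show ?thesis by linarith
qed (simp add: log_modulus_def)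

text \<open>
  Write \<open>(\<sigma> - S)\<^sub>+\<close> as the integral of the indicator of \<open>{t. S \<le> t < \<sigma>}\<close> and exchange the
  integrals. The upper bound \<open>M\<close> makes the integral over \<open>t\<close> one of a bounded function on a bounded
  interval, so that it is a genuine integral and not a default value.
\<close>
lemma layer_cake_log_modulus:
  fixes \<sigma> q :: "real^'n \<Rightarrow> real"
  assumes \<sigma>: "\<sigma> \<in> borel_measurable lebesgue" and bound: "AE x in lebesgue. \<sigma> x \<le> M"
    and q: "continuous_on UNIV q" "\<And>x. 0 \<le> q x" and D: "0 \<le> D"
    and sets: "\<And>E. E \<in> sets cube_measure \<Longrightarrow>
      (LINT x|cube_measure. indicator E x * q x) \<le> D * log_modulus (measure cube_measure E)"
  shows "(LINT x|cube_measure. max (\<sigma> x - S) 0 * q x)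
    \<le> D * (LINT t:{S..}|lebesgue. distribution_fun \<sigma> t * (1 - ln (distribution_fun \<sigma> t))\<^sup>2)"
proof -
  let ?F = "distribution_fun \<sigma>"
  have \<sigma>Q [measurable]: "\<sigma> \<in> borel_measurable cube_measure"
    using \<sigma> by (rule measurable_restrict_space1)
  have q_meas [measurable]: "q \<in> borel_measurable cube_measure"
    using q(1) by (rule continuous_cube_measurable)
  have Et: "{x \<in> unit_cube. t < \<sigma> x} \<in> sets cube_measure" for t
  proof -
    have "{x \<in> space cube_measure. t < \<sigma> x} \<in> sets cube_measure" by measurable
    then show ?thesis by (simp add: space_restrict_space)
  qed
  have F: "?F t = measure cube_measure {x \<in> unit_cube. t < \<sigma> x}" for t
    by (subst measure_restrict_space) (auto simp: distribution_fun_def)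
  have F01: "0 \<le> ?F t" "?F t \<le> 1" for t
    unfolding F by auto
  have "mono (\<lambda>t. - ?F t)"
    unfolding F by (intro monoI) (auto intro!: cube.finite_measure_mono Et)
  then have "(\<lambda>t. - ?F t) \<in> borel_measurable borel" by (rule borel_measurable_mono)
  then have F_meas [measurable]: "?F \<in> borel_measurable borel"
    by (subst (asm) borel_measurable_uminus_eq)
  have F0: "?F t = 0" if "M \<le> t" for t
  proof -
    have "AE x in cube_measure. \<sigma> x \<le> M"
      using bound by (auto simp: AE_restrict_space_iff elim: eventually_mono)
    then have "AE x in cube_measure. x \<notin> {x \<in> unit_cube. t < \<sigma> x}"
      by (rule eventually_mono) (use that in auto)
    then have "measure cube_measure {x \<in> unit_cube. t < \<sigma> x} = measure (cube_measure :: (real^'n) measure) {}"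
      using Et by (intro cube.finite_measure_eq_AE) auto
    then show ?thesis by (simp add: F)
  qed
  let ?G = "\<lambda>t. indicator {S..} t * log_modulus (?F t)"
  have G_meas [measurable]: "?G \<in> borel_measurable borel"
    unfolding log_modulus_def by measurable
  have G_int: "integrable lborel ?G"
  proof (rule Bochner_Integration.integrable_bound[of _ "\<lambda>t. 4 * indicator {S..M} t :: real"])
    show "AE t in lborel. norm (?G t) \<le> norm (4 * indicator {S..M} t :: real)"
      using F0 F01 log_modulus_le_4 log_modulus_nonneg
      by (intro AE_I2) (auto simp: indicator_def log_modulus_def[of 0] abs_of_nonneg)
    show "integrable lborel (\<lambda>t. 4 * indicator {S..M} t :: real)"
      by (intro integrable_mult_right integrable_real_indicator) (auto simp: emeasure_lborel_Icc_eq)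
  qed auto
  have "(\<integral>\<^sup>+ x. ennreal (max (\<sigma> x - S) 0 * q x) \<partial>cube_measure)
      = (\<integral>\<^sup>+ x. (\<integral>\<^sup>+ t. indicator {S..} t * (if t < \<sigma> x then ennreal (q x) else 0) \<partial>lborel) \<partial>cube_measure)"
  proof (rule nn_integral_cong)
    fix x
    have "(\<integral>\<^sup>+ t. indicator {S..} t * (if t < \<sigma> x then ennreal (q x) else 0) \<partial>lborel)
        = (\<integral>\<^sup>+ t. ennreal (q x) * indicator {S..<\<sigma> x} t \<partial>lborel)"
      by (intro nn_integral_cong) (auto simp: indicator_def)
    also have "\<dots> = ennreal (q x) * ennreal (max (\<sigma> x - S) 0)"
      by (cases "S \<le> \<sigma> x") (auto simp: nn_integral_cmult_indicator max_def)
    finally show "ennreal (max (\<sigma> x - S) 0 * q x)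
        = (\<integral>\<^sup>+ t. indicator {S..} t * (if t < \<sigma> x then ennreal (q x) else 0) \<partial>lborel)"
      using q(2) by (simp add: ennreal_mult' mult.commute)
  qed
  also have "\<dots> = (\<integral>\<^sup>+ t. (\<integral>\<^sup>+ x. indicator {S..} t * (if t < \<sigma> x then ennreal (q x) else 0) \<partial>cube_measure) \<partial>lborel)"
  proof -
    interpret pair_sigma_finite lborel "cube_measure :: (real^'n) measure"
      by (intro pair_sigma_finite.intro lborel.sigma_finite_measure_axioms cube.sigma_finite_measure_axioms)
    show ?thesis by (rule Fubini') measurable
  qed
  also have "\<dots> \<le> (\<integral>\<^sup>+ t. ennreal (D * ?G t) \<partial>lborel)"
  proof (rule nn_integral_mono)
    fix t
    let ?E = "{x \<in> unit_cube. t < \<sigma> x}"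
    have m: "(\<lambda>x. ennreal (indicator ?E x * q x)) \<in> borel_measurable cube_measure"
      using borel_measurable_times[OF borel_measurable_indicator[OF Et] q_meas] by simp
    have "(\<integral>\<^sup>+ x. indicator {S..} t * (if t < \<sigma> x then ennreal (q x) else 0) \<partial>cube_measure)
        = indicator {S..} t * (\<integral>\<^sup>+ x. ennreal (indicator ?E x * q x) \<partial>cube_measure)"
      by (subst nn_integral_cmult[OF m, symmetric])
        (auto intro!: nn_integral_cong simp: indicator_def space_restrict_space)
    also have "(\<integral>\<^sup>+ x. ennreal (indicator ?E x * q x) \<partial>cube_measure)
        = ennreal (LINT x|cube_measure. indicator ?E x * q x)"
      using q Et continuous_cube_integrable[OF q(1)]
      by (intro nn_integral_eq_integral AE_I2) (auto intro: integrable_mult_indicator[where 'b=real, simplified])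
    also have "indicator {S..} t * \<dots> \<le> indicator {S..} t * ennreal (D * log_modulus (?F t))"
      unfolding F by (intro mult_left_mono ennreal_leI sets Et) auto
    also have "\<dots> = ennreal (D * ?G t)"
      by (auto simp: indicator_def)
    finally show "(\<integral>\<^sup>+ x. indicator {S..} t * (if t < \<sigma> x then ennreal (q x) else 0) \<partial>cube_measure)
        \<le> ennreal (D * ?G t)" .
  qed
  also have "\<dots> = ennreal (D * (LINT t|lborel. ?G t))"
    using G_int D F01 by (subst nn_integral_eq_integral) (auto simp: log_modulus_nonneg)
  finally have "(\<integral>\<^sup>+ x. ennreal (max (\<sigma> x - S) 0 * q x) \<partial>cube_measure) \<le> ennreal (D * (LINT t|lborel. ?G t))" .
  moreover have "0 \<le> D * (LINT t|lborel. ?G t)"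
    using D F01 by (intro mult_nonneg_nonneg integral_nonneg_AE) (auto simp: log_modulus_nonneg)
  ultimately have "(LINT x|cube_measure. max (\<sigma> x - S) 0 * q x) \<le> D * (LINT t|lborel. ?G t)"
    using q(2) by (intro integral_real_bounded)
  also have "(LINT t|lborel. ?G t) = (LINT t:{S..}|lebesgue. ?F t * (1 - ln (?F t))\<^sup>2)"
    using G_meas by (simp add: set_lebesgue_integral_def log_modulus_def integral_completion)
  finally show ?thesis .
qed

section \<open>The Poisson equation\<close>

lemma integral_partial_eq_0:
  assumes "f \<in> trig"
  shows "integral unit_cube (partial i f) = 0"
  using assms
  by (intro integral_cube_derivative_eq_0[of f _ i] trig_periodic trig_continuous trig_partial trig_DERIV)

lemma trig_integrable: "f \<in> trig \<Longrightarrow> f integrable_on unit_cube"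
  by (intro integrable_continuous trig_continuous)

text \<open>
  A mode is divided by \<open>- |w|\<^sup>2\<close>; the mode of frequency \<open>0\<close> is the constant.
\<close>
lemma trig_eq_laplacian_plus_const:
  fixes q :: "real^'n \<Rightarrow> real"
  shows "q \<in> trig \<Longrightarrow> \<exists>\<phi>\<in>trig. \<exists>c. q = (\<lambda>x. laplacian \<phi> x + c)"
proof (induction rule: trig.induct)
  case (trig_mode w a \<theta>)
  show ?case
  proof (cases "w = 0")
    case True
    have "laplacian (mode 0 (0::real^'n) 0) = (\<lambda>x. 0)" by (simp add: laplacian_mode) (simp add: mode_0)
    then show ?thesis
      using True by (intro bexI[of _ "mode 0 0 0"] exI[of _ "a * cos \<theta>"]) (auto simp: mode_0[of a] intro: trig.trig_mode)
  next
    case False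
    then have "laplacian (mode (- a / (norm w)\<^sup>2) w \<theta>) = mode a w \<theta>"
      by (simp add: laplacian_mode)
    then show ?thesis
      using trig_mode by (intro bexI[of _ "mode (- a / (norm w)\<^sup>2) w \<theta>"] exI[of _ 0]) (auto intro: trig.trig_mode)
  qed
next
  case (trig_add f g)
  then obtain \<phi> \<psi> c d where "\<phi> \<in> trig" "\<psi> \<in> trig" "f = (\<lambda>x. laplacian \<phi> x + c)" "g = (\<lambda>x. laplacian \<psi> x + d)"
    by blast
  then show ?case
    by (intro bexI[of _ "\<lambda>x. \<phi> x + \<psi> x"] exI[of _ "c + d"]) (auto simp: laplacian_add intro: trig.trig_add)
qed

lemma integral_laplacian_eq_0: "\<phi> \<in> trig \<Longrightarrow> integral unit_cube (laplacian \<phi>) = 0"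
  unfolding laplacian_def[abs_def]
  by (subst integral_sum) (auto intro!: trig_integrable trig_partial sum.neutral integral_partial_eq_0)

lemma poisson_equation:
  fixes q :: "real^'n \<Rightarrow> real"
  assumes "q \<in> trig" "integral unit_cube q = 0"
  obtains \<phi> where "\<phi> \<in> trig" "laplacian \<phi> = q"
proof -
  obtain \<phi> c where \<phi>: "\<phi> \<in> trig" and q: "q = (\<lambda>x. laplacian \<phi> x + c)"
    using trig_eq_laplacian_plus_const[OF assms(1)] by blast
  have "integral unit_cube q = integral unit_cube (laplacian \<phi>) + integral unit_cube (\<lambda>x::real^'n. c)"
    unfolding q by (intro integral_add trig_integrable trig_laplacian \<phi> trig_const)
  then have "c = 0"
    using assms(2) by (simp add: integral_laplacian_eq_0 \<phi> content_unit_cube)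
  with \<phi> q that show thesis by simp
qed

lemma integral_hessian_square:
  fixes \<phi> :: "real^'n \<Rightarrow> real"
  assumes \<phi>: "\<phi> \<in> trig"
  shows "integral unit_cube (\<lambda>x. \<Sum>i\<in>UNIV. \<Sum>j\<in>UNIV. (partial i (partial j \<phi>) x)\<^sup>2)
    = integral unit_cube (\<lambda>x. (laplacian \<phi> x)\<^sup>2)"
proof -
  note [simp] = \<phi> trig_partial trig_mult trig_power2 trig_sum trig_laplacian trig_integrable
    integral_partial_eq_0 integrable_add integrable_diff integrable_sum
  let ?A = "\<lambda>x. \<Sum>i\<in>UNIV. partial i (partial i (\<lambda>y. \<Sum>j\<in>UNIV. (partial j \<phi> y)\<^sup>2)) x"
  let ?B = "\<lambda>x. \<Sum>i\<in>UNIV. \<Sum>j\<in>UNIV. partial i (partial j (\<lambda>y. partial i \<phi> y * partial j \<phi> y)) x"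
  have "integral unit_cube (\<lambda>x. (laplacian \<phi> x)\<^sup>2 + ?A x - ?B x)
      = integral unit_cube (\<lambda>x. (laplacian \<phi> x)\<^sup>2) + integral unit_cube ?A - integral unit_cube ?B"
    by (subst integral_diff integral_add; simp)+
  moreover have "integral unit_cube ?A = 0" "integral unit_cube ?B = 0"
    by (simp_all add: integral_sum)
  ultimately show ?thesis
    by (simp add: hessian_identity)
qed

section \<open>Bounded approximation by trigonometric polynomials\<close>

lemma trig_integer_shift:
  assumes "f \<in> trig" and z: "\<And>i. z $ i \<in> \<int>"
  shows "f (x + z) = f x"
  using assms(1)
proof (induction rule: trig.induct)
  case (trig_mode w a \<theta>)
  have "\<exists>k::int. w $ i * z $ i = 2 * pi * of_int k" for i
  proof -
    obtain k :: int where "w $ i = 2 * pi * of_int k"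
      using trig_mode by (auto simp: frequencies_def)
    moreover obtain l :: int where "z $ i = of_int l"
      using z[of i] by (rule Ints_cases)
    ultimately show ?thesis by (intro exI[of _ "k * l"]) simp
  qed
  then have "\<forall>i. \<exists>k::int. w $ i * z $ i = 2 * pi * of_int k" by blast
  from choice[OF this] obtain k :: "'a \<Rightarrow> int" where k: "\<And>i. w $ i * z $ i = 2 * pi * of_int (k i)"
    by blast
  define n where "n = (\<Sum>i\<in>UNIV. k i)"
  have "w \<bullet> z = 2 * pi * of_int n"
    by (simp add: inner_vec_def k n_def sum_distrib_left)
  then have "w \<bullet> (x + z) + \<theta> = (w \<bullet> x + \<theta>) + 2 * pi * of_int n"
    by (simp add: inner_add_right)
  moreover have "cos (y + 2 * pi * of_int n) = cos y" for y
    by (simp add: cos_add sin_int_2pin cos_int_2pin)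
  ultimately show ?case
    unfolding mode_def by (simp only:)
qed auto

lemma trig_bound_from_cube:
  fixes f :: "real^'n \<Rightarrow> real"
  assumes "f \<in> trig" "\<And>x. x \<in> unit_cube \<Longrightarrow> \<bar>f x\<bar> \<le> B"
  shows "\<bar>f x\<bar> \<le> B"
proof -
  define z :: "real^'n" where "z = (\<chi> i. - of_int \<lfloor>x $ i\<rfloor>)"
  have "f (x + z) = f x" by (rule trig_integer_shift[OF assms(1)]) (simp add: z_def)
  moreover have "x + z \<in> unit_cube"
    by (auto simp: mem_box_cart z_def) linarith+
  ultimately show ?thesis using assms(2) by metis
qed

text \<open>
  The quotient map from the cube to the torus. It turns boundary identifications into equalities,
  so that the Stone--Weierstrass theorem applies on its image.
\<close>
definition torus_map :: "real^'n \<Rightarrow> complex^'n" where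
  "torus_map x = (\<chi> i. cis (2 * pi * x $ i))"

text \<open>
  A coordinate in which \<open>x\<close> and \<open>y\<close> differ changes by a nonzero integer, hence it is \<open>0\<close> or \<open>1\<close>.
\<close>
lemma torus_map_inj_interior:
  fixes x y :: "real^'n"
  assumes "x \<in> unit_cube" "y \<in> unit_cube" "torus_map x = torus_map y" "x \<noteq> y"
  shows "x \<notin> box 0 1"
proof -
  obtain i where i: "x $ i \<noteq> y $ i" using assms(4) by (auto simp: vec_eq_iff)
  have "cis (2 * pi * x $ i) = cis (2 * pi * y $ i)"
    using assms(3) by (simp add: torus_map_def vec_eq_iff)
  then have "sin (2 * pi * x $ i) = sin (2 * pi * y $ i) \<and> cos (2 * pi * x $ i) = cos (2 * pi * y $ i)"
    by (auto simp: cis.ctr)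
  then obtain k :: int where "2 * pi * x $ i = 2 * pi * y $ i + 2 * pi * k"
    unfolding sin_cos_eq_iff by blast
  then have "2 * pi * (x $ i - y $ i - k) = 0" by (simp add: algebra_simps)
  then have k: "x $ i - y $ i = k" by simp
  have xy: "0 \<le> x $ i" "x $ i \<le> 1" "0 \<le> y $ i" "y $ i \<le> 1"
    using assms(1,2) by (auto simp: mem_box_cart)
  have "k \<noteq> 0" using i k by auto
  then have "k \<ge> 1 \<or> k \<le> -1" by linarith
  then have "x $ i = 0 \<or> x $ i = 1"
  proof
    assume "1 \<le> k"
    then have "1 \<le> x $ i - y $ i" unfolding k by simp
    then show ?thesis using xy by linarith
  next
    assume "k \<le> -1"
    then have "x $ i - y $ i \<le> -1" unfolding k by linarith
    then show ?thesis using xy by linarith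
  qed
  then show ?thesis by (auto simp: mem_box_cart intro!: exI[of _ i])
qed

lemma trig_coordinate:
  "(\<lambda>x::real^'n. cos (2 * pi * x $ i)) \<in> trig" "(\<lambda>x::real^'n. sin (2 * pi * x $ i)) \<in> trig"
proof -
  let ?w = "axis i (2 * pi) :: real^'n"
  have w: "?w \<in> frequencies"
    by (auto simp: frequencies_def axis_def intro: exI[of _ 1] exI[of _ 0])
  have "mode 1 ?w 0 = (\<lambda>x. cos (2 * pi * x $ i))"
    by (auto simp: mode_def inner_axis' fun_eq_iff)
  moreover have "mode 1 ?w (- (pi / 2)) = (\<lambda>x. sin (2 * pi * x $ i))"
    by (auto simp: mode_def inner_axis' fun_eq_iff cos_diff)
  ultimately show "(\<lambda>x::real^'n. cos (2 * pi * x $ i)) \<in> trig" "(\<lambda>x::real^'n. sin (2 * pi * x $ i)) \<in> trig"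
    using trig_mode[OF w] by metis+
qed

text \<open>
  As \<open>g\<close> vanishes on the boundary, it descends to a continuous function on the torus, on which the
  coordinates \<open>cos (2 \<pi> x\<^sub>i)\<close> and \<open>sin (2 \<pi> x\<^sub>i)\<close> separate points.
\<close>
lemma trig_uniform_approximation:
  fixes g :: "real^'n \<Rightarrow> real"
  assumes cont: "continuous_on unit_cube g" and bdry: "\<And>x. x \<in> unit_cube \<Longrightarrow> x \<notin> box 0 1 \<Longrightarrow> g x = 0"
    and "0 < \<epsilon>"
  shows "\<exists>p\<in>trig. \<forall>x\<in>unit_cube. \<bar>g x - p x\<bar> < \<epsilon>"
proof -
  let ?e = "torus_map :: real^'n \<Rightarrow> complex^'n"
  define T where "T = ?e ` unit_cube"
  define G where "G z = g (SOME x. x \<in> unit_cube \<and> ?e x = z)" for z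
  have cont_e: "continuous_on S ?e" for S
    unfolding torus_map_def by (intro continuous_on_vec_lambda continuous_intros)
  have T: "compact T"
    unfolding T_def by (intro compact_continuous_image cont_e) auto
  have Ge: "G (?e x) = g x" if x: "x \<in> unit_cube" for x
  proof -
    let ?y = "SOME y. y \<in> unit_cube \<and> ?e y = ?e x"
    have y: "?y \<in> unit_cube \<and> ?e ?y = ?e x" by (rule someI[of _ x]) (simp add: x)
    show ?thesis
    proof (cases "?y = x")
      case False
      then have "?y \<notin> box 0 1" "x \<notin> box 0 1"
        using torus_map_inj_interior[of ?y x] torus_map_inj_interior[of x ?y] x y by auto
      then show ?thesis using bdry x y by (simp add: G_def)
    qed (simp add: G_def)
  qed
  have contG: "continuous_on T G"
  proof (subst continuous_on_closed_vimage)
    show "closed T" using T by (rule compact_imp_closed)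
    show "\<forall>B. closed B \<longrightarrow> closed (G -` B \<inter> T)"
    proof (intro allI impI)
      fix B :: "real set" assume "closed B"
      then have "closed (g -` B \<inter> unit_cube)"
        using cont continuous_on_closed_vimage[of unit_cube g] by auto
      then have "compact (unit_cube \<inter> (g -` B \<inter> unit_cube))"
        by (intro compact_Int_closed) auto
      then have "compact (?e ` (unit_cube \<inter> (g -` B \<inter> unit_cube)))"
        by (intro compact_continuous_image cont_e)
      moreover have "?e ` (unit_cube \<inter> (g -` B \<inter> unit_cube)) = G -` B \<inter> T"
        using Ge by (auto simp: T_def)
      ultimately show "closed (G -` B \<inter> T)" by (metis compact_imp_closed)
    qed
  qed
  define P where "P F \<longleftrightarrow> continuous_on T F \<and> (\<lambda>x. F (?e x)) \<in> trig" for F :: "complex^'n \<Rightarrow> real"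
  have "\<exists>F. P F \<and> (\<forall>z\<in>T. \<bar>G z - F z\<bar> < \<epsilon>)"
  proof (rule Stone_Weierstrass_HOL[OF T])
    show "P (\<lambda>z. c)" for c by (simp add: P_def)
    show "continuous_on T F" if "P F" for F using that by (simp add: P_def)
    show "P (\<lambda>z. F z + F' z)" "P (\<lambda>z. F z * F' z)" if "P F \<and> P F'" for F F'
      using that by (auto simp: P_def intro: trig_add trig_mult continuous_intros)
    show "\<exists>F. P F \<and> F z \<noteq> F z'" if zz: "z \<in> T \<and> z' \<in> T \<and> z \<noteq> z'" for z z'
    proof -
      obtain i where "z $ i \<noteq> z' $ i" using zz by (auto simp: vec_eq_iff)
      moreover have "P (\<lambda>z. Re (z $ i))" "P (\<lambda>z. Im (z $ i))"
        by (auto simp: P_def torus_map_def trig_coordinate intro!: continuous_intros)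
      ultimately show ?thesis by (metis complex_eqI)
    qed
    show "continuous_on T G" by (rule contG)
    show "0 < \<epsilon>" by fact
  qed
  then obtain F where F: "P F" "\<And>z. z \<in> T \<Longrightarrow> \<bar>G z - F z\<bar> < \<epsilon>" by blast
  have "\<bar>g x - F (?e x)\<bar> < \<epsilon>" if "x \<in> unit_cube" for x
    using F(2)[of "?e x"] Ge[OF that] that by (simp add: T_def)
  then show ?thesis
    using F(1) by (intro bexI[of _ "\<lambda>x. F (?e x)"]) (auto simp: P_def)
qed

text \<open>
  Start from continuous functions that converge to \<open>f\<close> almost everywhere, truncate them at
  height \<open>K\<close>, cut them off near the boundary of the cube, approximate uniformly and subtract the
  mean, which tends to \<open>0\<close> by dominated convergence.
\<close>
theorem trig_bounded_approximation:
  fixes f :: "real^'n \<Rightarrow> real"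
  assumes f: "f \<in> borel_measurable lebesgue" and K: "0 \<le> K" "AE x in cube_measure. \<bar>f x\<bar> \<le> K"
    and mean: "(LINT x|cube_measure. f x) = 0" and \<delta>: "0 < \<delta>"
  obtains p :: "nat \<Rightarrow> real^'n \<Rightarrow> real" where "\<And>k. p k \<in> trig" "\<And>k. integral unit_cube (p k) = 0"
    "\<And>k x. \<bar>p k x\<bar> \<le> K + \<delta>" "AE x in cube_measure. (\<lambda>k. p k x) \<longlonglongrightarrow> f x"
proof -
  have "f measurable_on unit_cube"
    by (intro lebesgue_measurable_imp_measurable_on measurable_completion f) 
      (use f in \<open>auto intro: measurable_restrict_space1\<close>)
  then obtain N g where N: "negligible N" and g: "\<And>k. continuous_on UNIV (g k)"
    and lim: "\<And>x. x \<notin> N \<Longrightarrow> (\<lambda>k. g k x) \<longlonglongrightarrow> (if x \<in> unit_cube then f x else 0)"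
    unfolding measurable_on_def by blast
  let ?C = "- box 0 1 :: (real^'n) set"
  have "0 \<in> ?C" by (simp add: mem_box_cart)
  then have C: "closed ?C" "?C \<noteq> {}" by auto
  define h where "h k x = max (- K) (min K (g k x)) * min 1 (real k * infdist x ?C)" for k x
  have h_cont: "continuous_on S (h k)" for k S
    unfolding h_def by (intro continuous_intros continuous_on_subset[OF g]) auto
  have h_bdry: "h k x = 0" if "x \<notin> box 0 1" for k x
    using that by (simp add: h_def)
  have h_bound: "\<bar>h k x\<bar> \<le> K" for k x
  proof -
    have "\<bar>h k x\<bar> \<le> K * 1"
      unfolding h_def abs_mult using K(1) infdist_nonneg[of x ?C] by (intro mult_mono) auto
    then show ?thesis by simp
  qed
  have "\<exists>p\<in>trig. \<forall>x\<in>unit_cube. \<bar>h k x - p x\<bar> < 1 / real (Suc k)" for k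
    by (rule trig_uniform_approximation[OF h_cont]) (auto simp: h_bdry)
  then have "\<forall>k. \<exists>p. p \<in> trig \<and> (\<forall>x\<in>unit_cube. \<bar>h k x - p x\<bar> < 1 / real (Suc k))"
    by blast
  from choice[OF this] obtain p where p: "\<And>k. p k \<in> trig"
    and ph: "\<And>k x. x \<in> unit_cube \<Longrightarrow> \<bar>h k x - p k x\<bar> < 1 / real (Suc k)"
    by blast
  have ae: "AE x in cube_measure. x \<in> unit_cube \<and> x \<in> box 0 1 \<and> x \<notin> N \<and> \<bar>f x\<bar> \<le> K"
  proof -
    have "negligible (N \<union> (unit_cube - box 0 1))"
      by (intro negligible_Un N negligible_frontier_interval)
    then have "AE x in lebesgue. x \<notin> N \<union> (unit_cube - box 0 1)"
      by (intro AE_not_in) (simp add: negligible_iff_null_sets)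
    then have "AE x in cube_measure. x \<in> unit_cube \<and> x \<notin> N \<union> (unit_cube - box 0 1)"
      by (auto simp: AE_restrict_space_iff elim: eventually_mono)
    with K(2) show ?thesis by eventually_elim auto
  qed
  have plim: "AE x in cube_measure. (\<lambda>k. p k x) \<longlonglongrightarrow> f x"
    using ae
  proof eventually_elim
    case (elim x)
    have "(\<lambda>k. max (- K) (min K (g k x))) \<longlonglongrightarrow> max (- K) (min K (f x))"
      using lim[of x] elim by (intro tendsto_intros) auto
    moreover have "max (- K) (min K (f x)) = f x" using elim by auto
    moreover have "(\<lambda>k. min 1 (real k * infdist x ?C)) \<longlonglongrightarrow> 1"
    proof (rule tendsto_eventually)
      have pos: "0 < infdist x ?C"
        using C elim by (intro infdist_pos_not_in_closed) auto
      obtain n :: nat where n: "1 / infdist x ?C < real n" using reals_Archimedean2 by blast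
      show "\<forall>\<^sub>F k in sequentially. min 1 (real k * infdist x ?C) = 1"
        using eventually_ge_at_top[of n]
      proof eventually_elim
        case (elim k)
        then have "1 / infdist x ?C \<le> real k" using n by linarith
        then show ?case using pos by (simp add: field_simps)
      qed
    qed
    ultimately have "(\<lambda>k. h k x) \<longlonglongrightarrow> f x"
      unfolding h_def using tendsto_mult by fastforce
    moreover have "(\<lambda>k. p k x - h k x) \<longlonglongrightarrow> 0"
    proof (rule Lim_null_comparison[OF _ LIMSEQ_inverse_real_of_nat])
      show "\<forall>\<^sub>F k in sequentially. norm (p k x - h k x) \<le> inverse (real (Suc k))"
        using ph[of x] elim by (intro always_eventually) (auto simp: abs_minus_commute inverse_eq_divide less_imp_le)
    qed
    ultimately show ?case using tendsto_add by fastforce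
  qed
  have p_bound: "\<bar>p k x\<bar> \<le> K + 1 / real (Suc k)" for k x
  proof (rule trig_bound_from_cube[OF p])
    show "\<bar>p k x\<bar> \<le> K + 1 / real (Suc k)" if "x \<in> unit_cube" for x
      using ph[OF that, of k] h_bound[of k x] by linarith
  qed
  define a where "a k = integral unit_cube (p k)" for k
  have p_int: "(LINT x|cube_measure. p k x) = a k" for k
    using p by (simp add: a_def integral_cube_continuous trig_continuous)
  have "(\<lambda>k. LINT x|cube_measure. p k x) \<longlonglongrightarrow> (LINT x|cube_measure. f x)"
  proof (rule integral_dominated_convergence[where w = "\<lambda>_. K + 1"])
    show "AE x in cube_measure. norm (p k x) \<le> K + 1" for k
    proof (rule AE_I2)
      fix x :: "real^'n"
      have "1 / real (Suc k) \<le> 1" by simp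
      then show "norm (p k x) \<le> K + 1" using p_bound[of k x] unfolding real_norm_def by linarith
    qed
    show "p k \<in> borel_measurable cube_measure" for k
      by (intro continuous_cube_measurable trig_continuous p)
    show "f \<in> borel_measurable cube_measure"
      using f by (rule measurable_restrict_space1)
    show "AE x in cube_measure. (\<lambda>k. p k x) \<longlonglongrightarrow> f x" by (rule plim)
    show "integrable cube_measure (\<lambda>x. K + 1)" by simp
  qed
  then have a: "a \<longlonglongrightarrow> 0" unfolding p_int mean by simp
  then have "(\<lambda>k. 1 / real (Suc k) + \<bar>a k\<bar>) \<longlonglongrightarrow> 0 + 0"
    by (intro tendsto_add tendsto_rabs_zero LIMSEQ_Suc lim_1_over_n)
  then have "\<forall>\<^sub>F k in sequentially. 1 / real (Suc k) + \<bar>a k\<bar> < \<delta>"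
    using \<delta> by (simp add: order_tendsto_iff)
  then obtain n where n: "\<And>k. n \<le> k \<Longrightarrow> 1 / real (Suc k) + \<bar>a k\<bar> < \<delta>"
    by (auto simp: eventually_sequentially)
  show thesis
  proof (rule that[of "\<lambda>k x. p (k + n) x - a (k + n)"])
    show "(\<lambda>x. p (k + n) x - a (k + n)) \<in> trig" for k
      by (intro trig_diff p trig_const)
    show "integral unit_cube (\<lambda>x. p (k + n) x - a (k + n)) = 0" for k
      by (subst integral_diff) (auto simp: trig_integrable p a_def content_unit_cube)
    show "\<bar>p (k + n) x - a (k + n)\<bar> \<le> K + \<delta>" for k x
      using n[of "k + n"] p_bound[of "k + n" x] by simp
    show "AE x in cube_measure. (\<lambda>k. p (k + n) x - a (k + n)) \<longlonglongrightarrow> f x"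
      using plim
    proof eventually_elim
      case (elim x)
      then have "(\<lambda>k. p k x - a k) \<longlonglongrightarrow> f x - 0" using a by (rule tendsto_diff)
      then show ?case using LIMSEQ_ignore_initial_segment[of _ _ n] by fastforce
    qed
  qed
qed

section \<open>Trigonometric polynomials in the cell problem\<close>

lemma measure_unit_cube [simp]: "measure (cube_measure :: (real^'n) measure) unit_cube = 1"
  using cube.prob_space by (simp add: space_restrict_space)

lemma continuous_set_integrable:
  fixes f :: "real^'n \<Rightarrow> 'b::euclidean_space"
  assumes "continuous_on UNIV f" "compact T"
  shows "set_integrable lebesgue T f"
proof -
  have "integrable lborel (\<lambda>x. indicator T x *\<^sub>R f x)"
    by (intro borel_integrable_compact assms continuous_on_subset[OF assms(1)]) auto
  then show ?thesis
    unfolding set_integrable_def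
    by (subst integrable_completion) (auto dest: borel_measurable_integrable)
qed

lemma continuous_compact_support_integrable:
  fixes f :: "real^'n \<Rightarrow> 'b::euclidean_space"
  assumes "continuous_on UNIV f" "compact T" "\<And>x. x \<notin> T \<Longrightarrow> f x = 0"
  shows "integrable lebesgue f"
proof -
  have "(\<lambda>x. indicator T x *\<^sub>R f x) = f"
    using assms(3) by (auto simp: indicator_def fun_eq_iff)
  then show ?thesis
    using continuous_set_integrable[OF assms(1,2)] by (simp add: set_integrable_def)
qed

text \<open>
  On a box that exceeds the support by \<open>1\<close> in all directions, translations by at most \<open>1\<close> do not
  change the integral.
\<close>
lemma integral_derivative_compact_support:
  fixes F F' :: "real^'n \<Rightarrow> real"
  assumes cont: "continuous_on UNIV F" "continuous_on UNIV F'"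
    and supp: "\<And>x. x \<notin> cbox a b \<Longrightarrow> F x = 0" "\<And>x. x \<notin> cbox a b \<Longrightarrow> F' x = 0"
    and deriv: "\<And>x s. ((\<lambda>s. F (x + s *\<^sub>R axis i 1)) has_real_derivative F' (x + s *\<^sub>R axis i 1)) (at s)"
  shows "(LINT x|lebesgue. F' x) = 0"
proof -
  let ?e = "axis i 1 :: real^'n"
  let ?B = "cbox (a - 1) (b + 1)"
  let ?J = "\<lambda>s. integral ?B (\<lambda>x. F (x + s *\<^sub>R ?e))"
  have J: "?J s = integral (cbox a b) F" if s: "s \<in> {0..1}" for s
  proof -
    have "?J s = integral (cbox (a - 1 + s *\<^sub>R ?e) (b + 1 + s *\<^sub>R ?e)) F"
      using integral_shift_cbox_plus[of "a - 1" "b + 1" F "s *\<^sub>R ?e"] by (simp add: o_def add.commute)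
    also have "\<dots> = integral (cbox a b) F"
    proof (rule integral_unique, rule has_integral_on_superset[OF _ supp(1)])
      show "(F has_integral integral (cbox a b) F) (cbox a b)"
        by (intro integrable_integral integrable_continuous continuous_on_subset[OF cont(1)]) auto
      have le: "a $ j - 1 + s * ?e $ j \<le> a $ j" "b $ j \<le> b $ j + 1 + s * ?e $ j" for j
        using s by (auto simp: axis_def)
      show "cbox a b \<subseteq> cbox (a - 1 + s *\<^sub>R ?e) (b + 1 + s *\<^sub>R ?e)"
      proof
        fix x assume x: "x \<in> cbox a b"
        have "a $ j - 1 + s * ?e $ j \<le> x $ j \<and> x $ j \<le> b $ j + 1 + s * ?e $ j" for j
          using le[of j] x[unfolded mem_box_cart, rule_format, of j] by linarith
        then show "x \<in> cbox (a - 1 + s *\<^sub>R ?e) (b + 1 + s *\<^sub>R ?e)"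
          by (simp add: mem_box_cart)
      qed
    qed auto
    finally show ?thesis .
  qed
  have "integral ?B F' = 0"
    by (rule integral_derivative_eq_0_if_translation_invariant[OF cont deriv J])
  moreover have "integral\<^sup>L (lebesgue_on ?B) F' = integral ?B F'"
    by (intro lebesgue_integral_eq_integral continuous_imp_integrable continuous_on_subset[OF cont(2)]) auto
  moreover have "integral\<^sup>L (lebesgue_on ?B) F' = (LINT x|lebesgue. indicator ?B x *\<^sub>R F' x)"
    by (intro integral_restrict_space) simp
  moreover have "indicator ?B x *\<^sub>R F' x = F' x" for x
  proof (cases "x \<in> ?B")
    case False
    have "y \<in> ?B" if y: "y \<in> cbox a b" for y
    proof -
      have "a $ j - 1 \<le> y $ j \<and> y $ j \<le> b $ j + 1" for j
        using y[unfolded mem_box_cart, rule_format, of j] by linarith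
      then show ?thesis by (simp add: mem_box_cart)
    qed
    then show ?thesis using False supp(2)[of x] by auto
  qed simp
  ultimately show ?thesis by (simp only:)
qed

lemma test_function_DERIV:
  assumes "test_function \<psi>"
  shows "((\<lambda>s. \<psi> (x + s *\<^sub>R axis i 1)) has_real_derivative partial i \<psi> (x + s *\<^sub>R axis i 1)) (at s)"
    and "continuous_on UNIV \<psi>" "continuous_on UNIV (partial i \<psi>)"
proof -
  have C1: "C_k (Suc 0) \<psi>" using assms by (simp add: test_function_def)
  then have diff: "\<psi> differentiable (at x)" for x by simp
  then show "((\<lambda>s. \<psi> (x + s *\<^sub>R axis i 1)) has_real_derivative partial i \<psi> (x + s *\<^sub>R axis i 1)) (at s)"
    by (rule differentiable_DERIV_along_axis)
  show "continuous_on UNIV (partial i \<psi>)" using C1 by simp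
  show "continuous_on UNIV \<psi>"
    using diff by (meson continuous_at_imp_continuous_on differentiable_imp_continuous_within)
qed

text \<open>
  Integration by parts: \<open>u \<partial>\<^sub>i \<psi> + \<psi> \<partial>\<^sub>i u\<close> is a derivative of the compactly supported \<open>u \<psi>\<close>.
\<close>
lemma trig_has_weak_gradient:
  fixes u :: "real^'n \<Rightarrow> real"
  assumes u: "u \<in> trig"
  shows "has_weak_gradient u (grad u)"
  unfolding has_weak_gradient_def
proof (intro allI impI)
  fix \<psi> :: "real^'n \<Rightarrow> real"
  assume \<psi>: "test_function \<psi>"
  note \<psi>' = test_function_DERIV[OF \<psi>]
  have "compact (closure {x. \<psi> x \<noteq> 0})" using \<psi> by (simp add: test_function_def)
  then have "bounded (closure {x. \<psi> x \<noteq> 0})" by (rule compact_imp_bounded)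
  then obtain a where a: "closure {x. \<psi> x \<noteq> 0} \<subseteq> cbox (- a) a"
    by (rule bounded_subset_cbox_symmetric)
  then have supp: "\<psi> x = 0" if "x \<notin> cbox (- a) a" for x
    using that closure_subset[of "{x. \<psi> x \<noteq> 0}"] by blast
  have supp': "partial i \<psi> x = 0" if "x \<notin> cbox (- a) a" for x i
  proof -
    have "((\<lambda>x. 0) has_derivative (\<lambda>_. 0)) (at x)" by (rule has_derivative_const)
    then have "(\<psi> has_derivative (\<lambda>_. 0)) (at x)"
      by (rule has_derivative_transform_within_open[of _ _ _ _ "- cbox (- a) a"])
        (use that supp in auto)
    then show ?thesis unfolding partial_def using frechet_derivative_at by metis
  qed
  have cu: "continuous_on UNIV u" "continuous_on UNIV (partial i u)" for i
    using u by (auto intro: trig_continuous trig_partial)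
  have cg: "continuous_on UNIV (grad u)" "continuous_on UNIV (grad \<psi>)"
    unfolding grad_def by (intro continuous_on_vec_lambda cu \<psi>')+
  have gsupp: "grad \<psi> x = 0" if "x \<notin> cbox (- a) a" for x
    using supp'[OF that] by (simp add: grad_def vec_eq_iff)
  have int: "integrable lebesgue (\<lambda>x. u x *\<^sub>R grad \<psi> x)" "integrable lebesgue (\<lambda>x. \<psi> x *\<^sub>R grad u x)"
    by (rule continuous_compact_support_integrable[of _ "cbox (- a) a"];
        use supp gsupp in \<open>auto intro!: continuous_intros cu cg \<psi>'\<close>)+
  have "(LINT x|lebesgue. u x *\<^sub>R grad \<psi> x + \<psi> x *\<^sub>R grad u x) = 0"
  proof (rule vec_eq_iff[THEN iffD2], rule allI)
    fix i :: 'n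
    let ?F' = "\<lambda>x. u x * partial i \<psi> x + \<psi> x * partial i u x"
    have "(LINT x|lebesgue. ?F' x) = 0"
    proof (rule integral_derivative_compact_support[of "\<lambda>x. u x * \<psi> x"])
      show "((\<lambda>s. u (x + s *\<^sub>R axis i 1) * \<psi> (x + s *\<^sub>R axis i 1)) has_real_derivative
          ?F' (x + s *\<^sub>R axis i 1)) (at s)" for x s
        using DERIV_mult[OF trig_DERIV[OF u] \<psi>'(1)] by (simp add: algebra_simps)
    qed (use supp supp' in \<open>auto intro!: continuous_intros cu \<psi>'\<close>)
    moreover have "?F' x = (u x *\<^sub>R grad \<psi> x + \<psi> x *\<^sub>R grad u x) \<bullet> axis i 1" for x
      by (simp add: inner_axis grad_def)
    ultimately have "(LINT x|lebesgue. (u x *\<^sub>R grad \<psi> x + \<psi> x *\<^sub>R grad u x) \<bullet> axis i 1) = 0"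
      by simp
    then show "(LINT x|lebesgue. u x *\<^sub>R grad \<psi> x + \<psi> x *\<^sub>R grad u x) $ i = 0 $ i"
      using int by (subst (asm) integral_inner_left) (auto simp: inner_axis)
  qed
  then show "(LINT x|lebesgue. u x *\<^sub>R grad \<psi> x) = - (LINT x|lebesgue. \<psi> x *\<^sub>R grad u x)"
    using int by (simp add: Bochner_Integration.integral_add eq_neg_iff_add_eq_0)
qed

lemma locally_square_integrable_continuous:
  fixes f :: "real^'n \<Rightarrow> 'b::euclidean_space"
  assumes "continuous_on UNIV f"
  shows "locally_square_integrable f"
proof -
  have "f \<in> borel_measurable lebesgue"
    using borel_measurable_continuous_onI[OF assms] by (intro measurable_completion) simp
  then show ?thesis
    using assms by (auto simp: locally_square_integrable_def intro!: continuous_set_integrable continuous_intros)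
qed

lemma trig_H1_periodic:
  assumes u: "u \<in> trig"
  shows "H1_periodic u (grad u)"
proof -
  have "continuous_on UNIV (grad u)"
    unfolding grad_def by (intro continuous_on_vec_lambda trig_continuous trig_partial u)
  then show ?thesis
    using u by (simp add: H1_periodic_def trig_periodic trig_has_weak_gradient
        locally_square_integrable_continuous trig_continuous)
qed

lemma effective_conductivity_le_energy:
  assumes "effective_conductivity_matrix \<sigma> A" "u \<in> trig"
  shows "(A *v v) \<bullet> v \<le> (LINT x|cube_measure. \<sigma> x * (norm (v + grad u x))\<^sup>2)"
  using assms trig_H1_periodic[OF assms(2)]
  unfolding effective_conductivity_matrix_def cell_energies_def set_integral_cube[symmetric] by blast

lemma integrable_times_continuous:
  fixes \<sigma> q :: "real^'n \<Rightarrow> real"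
  assumes \<sigma>: "\<sigma> \<in> borel_measurable cube_measure" "AE x in cube_measure. \<bar>\<sigma> x\<bar> \<le> B"
    and q: "continuous_on UNIV q"
  shows "integrable cube_measure (\<lambda>x. \<sigma> x * q x)"
proof (rule Bochner_Integration.integrable_bound)
  show "integrable cube_measure (\<lambda>x. B * q x)"
    using continuous_cube_integrable[OF q] by simp
  show "(\<lambda>x. \<sigma> x * q x) \<in> borel_measurable cube_measure"
    using \<sigma>(1) continuous_cube_measurable[OF q] by (rule borel_measurable_times)
  show "AE x in cube_measure. norm (\<sigma> x * q x) \<le> norm (B * q x)"
    using \<sigma>(2) by (rule eventually_mono) (auto simp: abs_mult intro!: mult_right_mono)
qed

section \<open>Comparison with the constant conductivity\<close>

text \<open>
  Here \<open>s\<close>, \<open>p\<close> and \<open>d\<close> stand for the values of \<open>\<sigma>\<close>, \<open>\<Delta>\<phi>\<close> and \<open>|D\<^sup>2\<phi>|\<^sup>2\<close>. The traceless part of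
  the Hessian contributes \<open>d - p\<^sup>2 / n\<close>, which is dropped where \<open>s < S\<close> and bounded by \<open>d\<close> elsewhere.
\<close>
lemma comparison_integrand_le:
  fixes s S n p d :: real
  assumes n: "0 < n" and d: "p\<^sup>2 / n \<le> d"
  shows "s * (n + 2 * p + d) \<le> (s - S) * ((n + p)\<^sup>2 / n) + max (s - S) 0 * d + S * (n + 2 * p + d)"
proof -
  have sq: "(n + p)\<^sup>2 / n = n + 2 * p + p\<^sup>2 / n"
    using n by (simp add: power2_eq_square field_simps)
  have "(s - S) * (d - p\<^sup>2 / n) \<le> max (s - S) 0 * d"
  proof -
    have "(s - S) * (d - p\<^sup>2 / n) \<le> max (s - S) 0 * (d - p\<^sup>2 / n)"
      using d by (intro mult_right_mono) auto
    also have "\<dots> \<le> max (s - S) 0 * d"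
      using n by (intro mult_left_mono) auto
    finally show ?thesis .
  qed
  then show ?thesis unfolding sq by (simp add: algebra_simps)
qed

text \<open>
  The energy of the trial functions \<open>\<partial>\<^sub>j \<phi>\<close> with \<open>\<Delta>\<phi> = p\<close>. The terms with the comparison
  conductivity \<open>S\<close> are evaluated exactly, since \<open>\<integral> p = 0\<close> and \<open>\<integral> |D\<^sup>2\<phi>|\<^sup>2 = \<integral> p\<^sup>2\<close>.
\<close>
theorem trace_le_comparison_energy:
  fixes \<sigma> :: "real^'n \<Rightarrow> real" and A :: "real^'n^'n" and p :: "real^'n \<Rightarrow> real"
  assumes \<sigma>: "\<sigma> \<in> borel_measurable lebesgue" and bound: "AE x in lebesgue. \<bar>\<sigma> x\<bar> \<le> M"
    and A: "effective_conductivity_matrix \<sigma> A"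
    and p: "p \<in> trig" "integral unit_cube p = 0" and K: "0 < K" "\<And>x. \<bar>p x\<bar> \<le> K"
  defines "n \<equiv> real CARD('n)"
  shows "trace A \<le> (LINT x|cube_measure. (\<sigma> x - S) * ((n + p x)\<^sup>2 / n) + S * (n + (p x)\<^sup>2))
    + n\<^sup>2 * hessian_const TYPE('n) * K\<^sup>2
      * (LINT t:{S..}|lebesgue. distribution_fun \<sigma> t * (1 - ln (distribution_fun \<sigma> t))\<^sup>2)"
proof -
  obtain \<phi> where \<phi>: "\<phi> \<in> trig" and lap: "laplacian \<phi> = p"
    using poisson_equation[OF p] .
  note [simp] = \<phi> trig_partial trig_continuous
  have n: "0 < n" by (simp add: n_def)
  let ?h = "\<lambda>i j x. partial i (partial j \<phi>) x"
  let ?L = "LINT t:{S..}|lebesgue. distribution_fun \<sigma> t * (1 - ln (distribution_fun \<sigma> t))\<^sup>2"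
  define D where "D x = (\<Sum>j\<in>UNIV. \<Sum>i\<in>UNIV. (?h i j x)\<^sup>2)" for x
  have D': "D x = (\<Sum>i\<in>UNIV. \<Sum>j\<in>UNIV. (?h i j x)\<^sup>2)" for x
    unfolding D_def by (rule sum.swap)
  have contD: "continuous_on UNIV D"
    unfolding D_def by (intro continuous_intros) simp
  have contp: "continuous_on UNIV p" using p(1) by simp
  have \<sigma>Q: "\<sigma> \<in> borel_measurable cube_measure"
    using \<sigma> by (rule measurable_restrict_space1)
  have boundQ: "AE x in cube_measure. \<bar>\<sigma> x\<bar> \<le> M"
    using bound by (auto simp: AE_restrict_space_iff elim: eventually_mono)
  have "AE x in cube_measure :: (real^'n) measure. 0 \<le> M"
    using boundQ by (rule eventually_mono) linarith
  then have M: "0 \<le> M" by simp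
  have norm_eq: "(\<Sum>j\<in>UNIV. (norm (axis j 1 + grad (partial j \<phi>) x))\<^sup>2) = n + 2 * p x + D x" for x
  proof -
    have "(norm (axis j 1 + grad (partial j \<phi>) x))\<^sup>2 = 1 + 2 * ?h j j x + (\<Sum>i\<in>UNIV. (?h i j x)\<^sup>2)" for j
    proof -
      have "(norm (axis j 1 + grad (partial j \<phi>) x))\<^sup>2
          = (norm (axis j 1 :: real^'n))\<^sup>2 + 2 * (axis j 1 \<bullet> grad (partial j \<phi>) x) + (norm (grad (partial j \<phi>) x))\<^sup>2"
        by (simp add: power2_norm_eq_inner inner_add_left inner_add_right inner_commute)
      also have "(norm (grad (partial j \<phi>) x))\<^sup>2 = (\<Sum>i\<in>UNIV. (?h i j x)\<^sup>2)"
        by (simp add: norm_vec_def L2_set_def sum_nonneg grad_def)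
      finally show ?thesis by (simp add: inner_axis' grad_def)
    qed
    then show ?thesis
      by (simp add: sum.distrib D_def n_def lap[symmetric] laplacian_def flip: sum_distrib_left)
  qed
  have trace_sq: "(p x)\<^sup>2 / n \<le> D x" for x
  proof -
    have "(p x)\<^sup>2 \<le> (\<Sum>i\<in>UNIV. (?h i i x)\<^sup>2) * n"
      using Cauchy_Schwarz_ineq_sum[of "\<lambda>i. ?h i i x" "\<lambda>_. 1" UNIV]
      by (simp add: lap[symmetric] laplacian_def n_def)
    also have "(\<Sum>i\<in>UNIV. (?h i i x)\<^sup>2) \<le> D x"
      unfolding D' by (intro sum_mono member_le_sum) auto
    finally show ?thesis using n by (simp add: field_simps)
  qed
  define a where "a x = (\<sigma> x - S) * ((n + p x)\<^sup>2 / n)" for x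
  define b where "b x = max (\<sigma> x - S) 0 * D x" for x
  have ia: "integrable cube_measure a"
    unfolding a_def using boundQ \<sigma>Q n M
    by (intro integrable_times_continuous[of _ "M + \<bar>S\<bar>"] continuous_intros contp)
      (auto elim!: eventually_mono)
  have ib: "integrable cube_measure b"
    unfolding b_def using boundQ \<sigma>Q M
    by (intro integrable_times_continuous[of _ "M + \<bar>S\<bar>"] contD) (auto elim!: eventually_mono)
  have ip: "integrable cube_measure p" and ip2: "integrable cube_measure (\<lambda>x. (p x)\<^sup>2)"
    and iD: "integrable cube_measure D"
    by (intro continuous_cube_integrable continuous_intros contp contD)+
  have p_mean: "(LINT x|cube_measure. p x) = 0"
    using p by (simp add: integral_cube_continuous)
  have D_mean: "(LINT x|cube_measure. D x) = (LINT x|cube_measure. (p x)\<^sup>2)"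
    using integral_hessian_square[OF \<phi>] contD contp
    by (simp add: integral_cube_continuous continuous_intros D'[abs_def] lap)
  have "trace A = (\<Sum>j\<in>UNIV. (A *v axis j 1) \<bullet> axis j 1)"
    by (simp add: trace_def matrix_vector_mult_basis column_def inner_axis)
  also have "\<dots> \<le> (\<Sum>j\<in>UNIV. (LINT x|cube_measure. \<sigma> x * (norm (axis j 1 + grad (partial j \<phi>) x))\<^sup>2))"
    by (intro sum_mono effective_conductivity_le_energy A) simp
  also have "\<dots> = (LINT x|cube_measure. (\<Sum>j\<in>UNIV. \<sigma> x * (norm (axis j 1 + grad (partial j \<phi>) x))\<^sup>2))"
    by (intro Bochner_Integration.integral_sum[symmetric] integrable_times_continuous[OF \<sigma>Q boundQ] continuous_intros)
      (simp_all add: grad_def continuous_on_vec_lambda)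
  also have "\<dots> = (LINT x|cube_measure. \<sigma> x * (n + 2 * p x + D x))"
    by (simp add: norm_eq flip: sum_distrib_left)
  also have "\<dots> \<le> (LINT x|cube_measure. a x + b x + S * (n + 2 * p x + D x))"
  proof (intro integral_mono)
    show "\<sigma> x * (n + 2 * p x + D x) \<le> a x + b x + S * (n + 2 * p x + D x)" for x
      unfolding a_def b_def by (intro comparison_integrand_le trace_sq n)
    show "integrable cube_measure (\<lambda>x. \<sigma> x * (n + 2 * p x + D x))"
      by (intro integrable_times_continuous[OF \<sigma>Q boundQ] continuous_intros contp contD)
    show "integrable cube_measure (\<lambda>x. a x + b x + S * (n + 2 * p x + D x))"
      using ia ib ip iD by simp
  qed
  also have "\<dots> = (LINT x|cube_measure. a x) + (LINT x|cube_measure. b x) + S * (n + (LINT x|cube_measure. (p x)\<^sup>2))"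
    using ia ib ip ip2 iD p_mean D_mean by (simp add: Bochner_Integration.integral_add cube.prob_space)
  also have "\<dots> = (LINT x|cube_measure. a x + S * (n + (p x)\<^sup>2)) + (LINT x|cube_measure. b x)"
    using ia ib ip ip2 by (simp add: Bochner_Integration.integral_add cube.prob_space)
  also have "(LINT x|cube_measure. b x) \<le> n\<^sup>2 * hessian_const TYPE('n) * K\<^sup>2 * ?L"
    unfolding b_def
  proof (rule layer_cake_log_modulus[OF \<sigma> _ contD])
    show "AE x in lebesgue. \<sigma> x \<le> M" using bound by (rule eventually_mono) auto
    show "0 \<le> D x" for x unfolding D_def by (intro sum_nonneg) auto
    show "0 \<le> n\<^sup>2 * hessian_const TYPE('n) * K\<^sup>2"
      by (simp add: hessian_const_def bmo_const_def)
    fix E :: "(real^'n) set" assume E: "E \<in> sets cube_measure"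
    have int: "integrable cube_measure (\<lambda>x. indicator E x * (?h i j x)\<^sup>2)" for i j
      using integrable_mult_indicator[OF E continuous_cube_integrable[of "\<lambda>x. (?h i j x)\<^sup>2"]]
      by (simp add: continuous_intros)
    have "(LINT x|cube_measure. indicator E x * D x)
        = (\<Sum>j\<in>UNIV. \<Sum>i\<in>UNIV. (LINT x|cube_measure. indicator E x * (?h i j x)\<^sup>2))"
      unfolding D_def sum_distrib_left
      by (simp only: Bochner_Integration.integral_sum Bochner_Integration.integrable_sum int)
    also have "\<dots> \<le> (\<Sum>j\<in>(UNIV::'n set). \<Sum>i\<in>(UNIV::'n set). hessian_const TYPE('n) * K\<^sup>2 * log_modulus (measure cube_measure E))"
      using K by (intro sum_mono hessian_set_integral_le E) (auto simp: lap)
    also have "\<dots> = n\<^sup>2 * hessian_const TYPE('n) * K\<^sup>2 * log_modulus (measure cube_measure E)"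
      by (simp add: n_def power2_eq_square)
    finally show "(LINT x|cube_measure. indicator E x * D x)
        \<le> n\<^sup>2 * hessian_const TYPE('n) * K\<^sup>2 * log_modulus (measure cube_measure E)" .
  qed
  finally show ?thesis by (simp add: a_def)
qed


lemma ess_bounds:
  fixes \<sigma> :: "real^'n \<Rightarrow> real"
  assumes "\<sigma> \<in> borel_measurable lebesgue" "0 < ess_inf \<sigma>" "ess_sup \<sigma> < \<infinity>"
  defines "m \<equiv> real_of_ereal (ess_inf \<sigma>)" and "M \<equiv> real_of_ereal (ess_sup \<sigma>)"
  shows "0 < m" "m \<le> M" "AE x in lebesgue. m \<le> \<sigma> x" "AE x in lebesgue. \<sigma> x \<le> M"
proof -
  have up: "AE x in lebesgue. ereal (\<sigma> x) \<le> ess_sup \<sigma>"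
    unfolding ess_sup_def by (rule esssup_AE)
  have "AE x in lebesgue. - ereal (\<sigma> x) \<le> - ess_inf \<sigma>"
    unfolding ess_inf_def using esssup_AE[of "\<lambda>x. - ereal (\<sigma> x)" lebesgue] by simp
  then have lo: "AE x in lebesgue. ess_inf \<sigma> \<le> ereal (\<sigma> x)"
    by (rule eventually_mono) (simp only: ereal_minus_le_minus)
  have "AE x in cube_measure. ess_inf \<sigma> \<le> ereal (\<sigma> x) \<and> ereal (\<sigma> x) \<le> ess_sup \<sigma>"
    using up lo by (auto simp: AE_restrict_space_iff elim: eventually_elim2)
  then obtain x where x: "ess_inf \<sigma> \<le> ereal (\<sigma> x)" "ereal (\<sigma> x) \<le> ess_sup \<sigma>"
    using eventually_happens[of _ "ae_filter (cube_measure :: (real^'n) measure)"] cube.ae_filter_bot by blast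
  have inf: "ess_inf \<sigma> = ereal m"
    using assms(2) x(1) unfolding m_def by (cases "ess_inf \<sigma>") auto
  have sup: "ess_sup \<sigma> = ereal M"
    using assms(3) x(2) unfolding M_def by (cases "ess_sup \<sigma>") auto
  show "0 < m" using assms(2) inf by simp
  show "m \<le> M" using x inf sup by simp
  show "AE x in lebesgue. m \<le> \<sigma> x" using lo inf by simp
  show "AE x in lebesgue. \<sigma> x \<le> M" using up sup by simp
qed

text \<open>
  Both \<open>1 / \<tau>\<close> and its mean \<open>J\<close> lie in the interval from \<open>1 / b\<close> to \<open>1 / a\<close>, whose length is
  \<open>(b - a) / (a b)\<close>.
\<close>
lemma trial_field_identities:
  fixes \<tau> :: "real^'n \<Rightarrow> real"
  assumes \<tau>: "\<tau> \<in> borel_measurable cube_measure" and a: "0 < a"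
    and bounds: "AE x in cube_measure. a \<le> \<tau> x" "AE x in cube_measure. \<tau> x \<le> b"
  defines "J \<equiv> (LINT x|cube_measure. inverse (\<tau> x))"
  shows "integrable cube_measure (\<lambda>x. inverse (\<tau> x))"
    "0 < J" "AE x in cube_measure. \<bar>inverse J * inverse (\<tau> x) - 1\<bar> \<le> inverse J * (b - a) / (a * b)"
proof -
  have "AE x in cube_measure :: (real^'n) measure. a \<le> b"
    using bounds by eventually_elim linarith
  then have b: "0 < b" using a by simp
  have inv: "AE x in cube_measure. inverse b \<le> inverse (\<tau> x) \<and> inverse (\<tau> x) \<le> inverse a"
    using bounds by eventually_elim (use a in \<open>auto intro!: le_imp_inverse_le\<close>)
  have meas: "(\<lambda>x. inverse (\<tau> x)) \<in> borel_measurable cube_measure"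
    using \<tau> by simp
  show int: "integrable cube_measure (\<lambda>x. inverse (\<tau> x))"
  proof (rule cube.integrable_const_bound[OF _ meas])
    show "AE x in cube_measure. norm (inverse (\<tau> x)) \<le> inverse a"
      using inv
    proof eventually_elim
      case (elim x)
      have "0 < inverse b" using b by simp
      then show ?case using elim unfolding real_norm_def by linarith
    qed
  qed
  have "(LINT x|(cube_measure :: (real^'n) measure). inverse b) \<le> J"
    unfolding J_def using inv int by (intro integral_mono_AE) (auto elim: eventually_mono)
  then have J1: "inverse b \<le> J" by (simp add: cube.prob_space)
  have "J \<le> (LINT x|(cube_measure :: (real^'n) measure). inverse a)"
    unfolding J_def using inv int by (intro integral_mono_AE) (auto elim: eventually_mono)
  then have J2: "J \<le> inverse a" by (simp add: cube.prob_space)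
  show J: "0 < J" using J1 b by (meson inverse_positive_iff_positive less_le_trans)
  show "AE x in cube_measure. \<bar>inverse J * inverse (\<tau> x) - 1\<bar> \<le> inverse J * (b - a) / (a * b)"
    using inv
  proof eventually_elim
    case (elim x)
    have "inverse J * inverse (\<tau> x) - 1 = inverse J * (inverse (\<tau> x) - J)"
      using J by (simp add: algebra_simps)
    then have "\<bar>inverse J * inverse (\<tau> x) - 1\<bar> = inverse J * \<bar>inverse (\<tau> x) - J\<bar>"
      using J by (simp add: abs_mult)
    also have "\<dots> \<le> inverse J * (inverse a - inverse b)"
      using elim J1 J2 J by (intro mult_left_mono) (auto simp: abs_le_iff)
    also have "\<dots> = inverse J * (b - a) / (a * b)"
      using a b by (simp add: field_simps)
    finally show ?case .
  qed
qed

lemma comparison_energy_tendsto: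
  fixes \<sigma> f :: "real^'n \<Rightarrow> real" and p :: "nat \<Rightarrow> real^'n \<Rightarrow> real"
  assumes \<sigma>: "\<sigma> \<in> borel_measurable cube_measure" "AE x in cube_measure. \<bar>\<sigma> x\<bar> \<le> M"
    and f: "f \<in> borel_measurable cube_measure"
    and p: "\<And>k. p k \<in> trig" "\<And>k x. \<bar>p k x\<bar> \<le> K" "AE x in cube_measure. (\<lambda>k. p k x) \<longlonglongrightarrow> f x"
    and n: "0 < n"
  shows "(\<lambda>k. LINT x|cube_measure. (\<sigma> x - S) * ((n + p k x)\<^sup>2 / n) + S * (n + (p k x)\<^sup>2))
    \<longlonglongrightarrow> (LINT x|cube_measure. (\<sigma> x - S) * ((n + f x)\<^sup>2 / n) + S * (n + (f x)\<^sup>2))"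
proof (rule integral_dominated_convergence)
  let ?w = "(M + \<bar>S\<bar>) * ((n + K)\<^sup>2 / n) + \<bar>S\<bar> * (n + K\<^sup>2)"
  have pm: "p k \<in> borel_measurable cube_measure" for k
    by (intro continuous_cube_measurable trig_continuous p)
  show "integrable cube_measure (\<lambda>x::real^'n. ?w)" by simp
  show "(\<lambda>x. (\<sigma> x - S) * ((n + p k x)\<^sup>2 / n) + S * (n + (p k x)\<^sup>2)) \<in> borel_measurable cube_measure" for k
    using \<sigma>(1) pm by simp
  show "(\<lambda>x. (\<sigma> x - S) * ((n + f x)\<^sup>2 / n) + S * (n + (f x)\<^sup>2)) \<in> borel_measurable cube_measure"
    using \<sigma>(1) f by simp
  show "AE x in cube_measure. (\<lambda>k. (\<sigma> x - S) * ((n + p k x)\<^sup>2 / n) + S * (n + (p k x)\<^sup>2))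
      \<longlonglongrightarrow> (\<sigma> x - S) * ((n + f x)\<^sup>2 / n) + S * (n + (f x)\<^sup>2)"
    using p(3) by eventually_elim (use n in \<open>auto intro!: tendsto_intros\<close>)
  show "AE x in cube_measure. norm ((\<sigma> x - S) * ((n + p k x)\<^sup>2 / n) + S * (n + (p k x)\<^sup>2)) \<le> ?w" for k
    using \<sigma>(2)
  proof eventually_elim
    case (elim x)
    have K: "0 \<le> K" using p(2)[of k x] by linarith
    have "(n + p k x)\<^sup>2 \<le> (n + K)\<^sup>2" "(p k x)\<^sup>2 \<le> K\<^sup>2"
      using p(2)[of k x] n K by (auto simp: abs_le_square_iff[symmetric])
    then have "\<bar>(\<sigma> x - S) * ((n + p k x)\<^sup>2 / n)\<bar> \<le> (M + \<bar>S\<bar>) * ((n + K)\<^sup>2 / n)"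
      "\<bar>S * (n + (p k x)\<^sup>2)\<bar> \<le> \<bar>S\<bar> * (n + K\<^sup>2)"
      using elim n unfolding abs_mult by (auto intro!: mult_mono divide_right_mono)
    then show ?case unfolding real_norm_def by linarith
  qed
qed

text \<open>
  With \<open>\<tau> = \<sigma> + (n - 1) S\<close> and \<open>f = n (g - 1)\<close> the integrand is
  \<open>n \<tau> g\<^sup>2 - 2 n\<^sup>2 S g + (n + n\<^sup>2) S\<close>, and the present \<open>g\<close> is the multiple of \<open>1 / \<tau>\<close> with mean one, for which
  \<open>\<tau> g\<close> is constant.
\<close>
lemma comparison_energy_optimal:
  fixes \<sigma> :: "real^'n \<Rightarrow> real"
  assumes \<sigma>: "\<sigma> \<in> borel_measurable cube_measure"
    and int: "integrable cube_measure (\<lambda>x. inverse (\<sigma> x + (n - 1) * S))"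
    and pos: "AE x in cube_measure. 0 < \<sigma> x + (n - 1) * S" and n: "0 < n"
  defines "J \<equiv> (LINT x|cube_measure. inverse (\<sigma> x + (n - 1) * S))"
  assumes J: "0 < J"
  defines "f \<equiv> \<lambda>x. n * (inverse J * inverse (\<sigma> x + (n - 1) * S) - 1)"
  shows "(LINT x|cube_measure. f x) = 0"
    "(LINT x|cube_measure. (\<sigma> x - S) * ((n + f x)\<^sup>2 / n) + S * (n + (f x)\<^sup>2)) = n * (inverse J - (n - 1) * S)"
proof -
  let ?\<tau> = "\<lambda>x. \<sigma> x + (n - 1) * S"
  show "(LINT x|cube_measure. f x) = 0"
    unfolding f_def using int J by (simp add: J_def[symmetric] cube.prob_space)
  have "AE x in cube_measure. (\<sigma> x - S) * ((n + f x)\<^sup>2 / n) + S * (n + (f x)\<^sup>2)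
      = (n * (inverse J)\<^sup>2 - 2 * n\<^sup>2 * S * inverse J) * inverse (?\<tau> x) + (n + n\<^sup>2) * S"
    using pos
  proof eventually_elim
    case (elim x)
    define g where "g = inverse J * inverse (?\<tau> x)"
    have f: "f x = n * (g - 1)" by (simp add: f_def g_def)
    have "(\<sigma> x - S) * ((n + f x)\<^sup>2 / n) + S * (n + (f x)\<^sup>2)
        = n * (?\<tau> x * g) * g - 2 * n\<^sup>2 * S * g + (n + n\<^sup>2) * S"
      unfolding f using n by (simp add: power2_eq_square field_simps)
    also have "?\<tau> x * g = inverse J" using elim by (simp add: g_def)
    finally show ?case by (simp add: g_def power2_eq_square algebra_simps)
  qed
  then have "(LINT x|cube_measure. (\<sigma> x - S) * ((n + f x)\<^sup>2 / n) + S * (n + (f x)\<^sup>2))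
      = (LINT x|cube_measure. (n * (inverse J)\<^sup>2 - 2 * n\<^sup>2 * S * inverse J) * inverse (?\<tau> x) + (n + n\<^sup>2) * S)"
    by (intro integral_cong_AE) (use \<sigma> in \<open>auto simp: f_def\<close>)
  also have "\<dots> = (n * (inverse J)\<^sup>2 - 2 * n\<^sup>2 * S * inverse J) * J + (n + n\<^sup>2) * S"
    using int by (simp add: J_def[symmetric] cube.prob_space)
  also have "\<dots> = n * (inverse J - (n - 1) * S)"
    using J by (simp add: power2_eq_square field_simps)
  finally show "(LINT x|cube_measure. (\<sigma> x - S) * ((n + f x)\<^sup>2 / n) + S * (n + (f x)\<^sup>2))
      = n * (inverse J - (n - 1) * S)" .
qed


theorem theorem1p1:
  shows "\<exists>C::real. \<forall>(\<sigma> :: real^'n \<Rightarrow> real) (A :: real^'n^'n) (S :: real).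
    \<sigma> \<in> borel_measurable lebesgue \<longrightarrow> cube_periodic \<sigma> \<longrightarrow>
    0 < ess_inf \<sigma> \<longrightarrow> ess_sup \<sigma> < \<infinity> \<longrightarrow>
    effective_conductivity_matrix \<sigma> A \<longrightarrow> S > 0 \<longrightarrow>
    mean_conductivity A \<le> H_term \<sigma> S + E_term C \<sigma> S"
proof (intro exI allI impI)
  fix \<sigma> :: "real^'n \<Rightarrow> real" and A :: "real^'n^'n" and S :: real
  assume \<sigma>: "\<sigma> \<in> borel_measurable lebesgue" and ess: "0 < ess_inf \<sigma>" "ess_sup \<sigma> < \<infinity>"
    and A: "effective_conductivity_matrix \<sigma> A" and S: "S > 0"
  define n where "n = real CARD('n)"
  define m where "m = real_of_ereal (ess_inf \<sigma>)"
  define M where "M = real_of_ereal (ess_sup \<sigma>)"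
  define a where "a = m + (n - 1) * S"
  define b where "b = M + (n - 1) * S"
  let ?\<tau> = "\<lambda>x. \<sigma> x + (n - 1) * S"
  define J where "J = (LINT x|cube_measure. inverse (?\<tau> x))"
  define f where "f = (\<lambda>x. n * (inverse J * inverse (?\<tau> x) - 1))"
  define K where "K = n * (inverse J * (b - a) / (a * b))"
  define L where "L = (LINT t:{S..}|lebesgue. distribution_fun \<sigma> t * (1 - ln (distribution_fun \<sigma> t))\<^sup>2)"
  note mM = ess_bounds[OF \<sigma> ess, folded m_def M_def]
  have n1: "1 \<le> n" by (simp add: n_def)
  then have n: "0 < n" by simp
  have nS: "0 \<le> (n - 1) * S" using n1 S by simp
  have a: "0 < a" and ab: "a \<le> b" using mM(1,2) nS by (auto simp: a_def b_def)
  have \<sigma>Q: "\<sigma> \<in> borel_measurable cube_measure"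
    using \<sigma> by (rule measurable_restrict_space1)
  have mMQ: "AE x in cube_measure. m \<le> \<sigma> x" "AE x in cube_measure. \<sigma> x \<le> M"
    using mM(3,4) by (auto simp: AE_restrict_space_iff elim: eventually_mono)
  have \<tau>: "?\<tau> \<in> borel_measurable cube_measure" using \<sigma>Q by simp
  have \<tau>_bounds: "AE x in cube_measure. a \<le> ?\<tau> x" "AE x in cube_measure. ?\<tau> x \<le> b"
    using mMQ by (auto simp: a_def b_def)
  have pos: "AE x in cube_measure. 0 < ?\<tau> x"
    using \<tau>_bounds(1) by (rule eventually_mono) (use a in linarith)
  note trial = trial_field_identities[OF \<tau> a \<tau>_bounds, folded J_def]
  have abs_\<sigma>: "AE x in lebesgue. \<bar>\<sigma> x\<bar> \<le> M" "AE x in cube_measure. \<bar>\<sigma> x\<bar> \<le> M"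
    using mM(3,4) mMQ mM(1) by (auto elim!: eventually_elim2)
  have f_meas: "f \<in> borel_measurable lebesgue" using \<sigma> by (simp add: f_def)
  have f_bound: "AE x in cube_measure. \<bar>f x\<bar> \<le> K"
    using trial(3)
  proof eventually_elim
    case (elim x)
    have "\<bar>f x\<bar> = n * \<bar>inverse J * inverse (?\<tau> x) - 1\<bar>"
      using n by (simp add: f_def abs_mult)
    also have "\<dots> \<le> K"
      unfolding K_def using elim n by (intro mult_left_mono) auto
    finally show ?case .
  qed
  have K: "0 \<le> K" using n a ab trial(2) by (simp add: K_def)
  note opt = comparison_energy_optimal[OF \<sigma>Q trial(1) pos n, folded J_def, OF trial(2)]
  have opt_mean: "(LINT x|cube_measure. f x) = 0"
    and opt_value: "(LINT x|cube_measure. (\<sigma> x - S) * ((n + f x)\<^sup>2 / n) + S * (n + (f x)\<^sup>2))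
      = n * (inverse J - (n - 1) * S)"
    using opt by (simp_all only: f_def)
  let ?h = "hessian_const TYPE('n)"
  \<comment> \<open>The approximants of \<open>f\<close> are bounded by \<open>K + \<delta>\<close> only; \<open>\<delta>\<close> tends to \<open>0\<close> afterwards.\<close>
  have *: "trace A \<le> n * (inverse J - (n - 1) * S) + n\<^sup>2 * ?h * (K + \<delta>)\<^sup>2 * L" if \<delta>: "0 < \<delta>" for \<delta>
  proof -
    obtain p :: "nat \<Rightarrow> real^'n \<Rightarrow> real" where p: "\<And>k. p k \<in> trig" "\<And>k. integral unit_cube (p k) = 0"
      "\<And>k x. \<bar>p k x\<bar> \<le> K + \<delta>" "AE x in cube_measure. (\<lambda>k. p k x) \<longlonglongrightarrow> f x"
      using trig_bounded_approximation[OF f_meas K f_bound opt_mean \<delta>] by blast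
    let ?I = "\<lambda>k. LINT x|cube_measure. (\<sigma> x - S) * ((n + p k x)\<^sup>2 / n) + S * (n + (p k x)\<^sup>2)"
    have "?I \<longlonglongrightarrow> n * (inverse J - (n - 1) * S)"
      using comparison_energy_tendsto[OF \<sigma>Q abs_\<sigma>(2) measurable_restrict_space1[OF f_meas] p(1,3,4) n, of S]
      unfolding opt_value .
    then have "(\<lambda>k. ?I k + n\<^sup>2 * ?h * (K + \<delta>)\<^sup>2 * L)
        \<longlonglongrightarrow> n * (inverse J - (n - 1) * S) + n\<^sup>2 * ?h * (K + \<delta>)\<^sup>2 * L"
      by (intro tendsto_add tendsto_const)
    moreover have "trace A \<le> ?I k + n\<^sup>2 * ?h * (K + \<delta>)\<^sup>2 * L" for k
      using trace_le_comparison_energy[OF \<sigma> abs_\<sigma>(1) A p(1,2) _ p(3), of S] K \<delta>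
      by (simp add: n_def L_def)
    ultimately show ?thesis
      by (intro LIMSEQ_le_const) auto
  qed
  have "((\<lambda>\<delta>. n * (inverse J - (n - 1) * S) + n\<^sup>2 * ?h * (K + \<delta>)\<^sup>2 * L)
      \<longlongrightarrow> n * (inverse J - (n - 1) * S) + n\<^sup>2 * ?h * (K + 0)\<^sup>2 * L) (at_right 0)"
    by (intro tendsto_intros)
  then have "trace A \<le> n * (inverse J - (n - 1) * S) + n\<^sup>2 * ?h * (K + 0)\<^sup>2 * L"
    by (rule tendsto_lowerbound) (auto simp: eventually_at_filter * intro!: always_eventually)
  then have "trace A / n \<le> (n * (inverse J - (n - 1) * S) + n\<^sup>2 * ?h * K\<^sup>2 * L) / n"
    using n by (simp add: divide_right_mono)
  also have "\<dots> = - (n - 1) * S + inverse J + n * ?h * K\<^sup>2 * L"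
  proof -
    have "n * (inverse J - (n - 1) * S) + n\<^sup>2 * ?h * K\<^sup>2 * L
        = n * (- (n - 1) * S + inverse J + n * ?h * K\<^sup>2 * L)"
      by (simp add: power2_eq_square[of n] algebra_simps)
    then show ?thesis using n by simp
  qed
  also have "K\<^sup>2 = n\<^sup>2 * ((M - m)\<^sup>2 * (inverse J)\<^sup>2 / (a\<^sup>2 * b\<^sup>2))"
    by (simp add: K_def a_def b_def power_mult_distrib power_divide mult.commute)
  also have "n * ?h * (n\<^sup>2 * ((M - m)\<^sup>2 * (inverse J)\<^sup>2 / (a\<^sup>2 * b\<^sup>2))) * L
      = n ^ 3 * ?h * (M - m)\<^sup>2 * (inverse J)\<^sup>2 / (a\<^sup>2 * b\<^sup>2) * L"
    by (simp add: power3_eq_cube power2_eq_square[of n])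
  finally show "mean_conductivity A \<le> H_term \<sigma> S + E_term (real CARD('n) ^ 3 * ?h) \<sigma> S"
    unfolding mean_conductivity_def H_term_def E_term_def Let_def inverse_mean_def set_integral_cube
    by (simp add: n_def J_def m_def M_def a_def b_def L_def)
qed

end
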